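(* Let $H$ be a bialgebra with a family $\{\mathcal R^{(c)}\}_{c\in C}$ of co-quasi-triangular structures. For any $n\ge1$ and any transitive $\mathbf c:\{(i,j):1\le i<j\le n\}\to C$, the iterated multiplication map $m_H^{(n)}:H^{\otimes n}\to H$, $h_1\otimes\cdots\otimes h_n\mapsto h_1\cdots h_n$, is a homomorphism of bialgebras $(H^{\otimes n},\bullet_{\mathbf c})\to H$, where $H^{\otimes n}$ has its standard coalgebra structure and the multiplication $\bullet_{\mathbf c}$ twisted by $\mathcal J_{\mathbf c}$.
   Context: $\Bbbk$ is a field of characteristic zero; Sweedler notation is used. For a coalgebra $D$, the convolution on $\operatorname{Hom}_\Bbbk(D,\Bbbk)$ is $(f*g)(d)=f(d_{(1)})g(d_{(2)})$ with unit $\varepsilon$, and $f^{*-1}$ is the convolution inverse; tensor powers $H^{\otimes N}$ carry the standard bialgebra structure. For $f\in\operatorname{Hom}_\Bbbk(H^{\otimes r},\Bbbk)$ and distinct $i_1,\dots,i_r\in\{1,\dots,N\}$, $f_{i_1,\dots,i_r}(h_1\otimes\cdots\otimes h_N)=f(h_{i_1}\otimes\cdots\otimes h_{i_r})\prod_{j\notin\{i_1,\dots,i_r\}}\varepsilon(h_j)$. A co-quasi-triangular structure on $H$ is a $*$-invertible $\mathcal R\in\operatorname{Hom}_\Bbbk(H\otimes H,\Bbbk)$ with $\mathcal R(a_{(1)},a'_{(1)})a_{(2)}a'_{(2)}=\mathcal R(a_{(2)},a'_{(2)})a'_{(1)}a_{(1)}$ for $a,a'\in H$, $\mathcal R\circ(m_H\otimes\mathrm{id})=\mathcal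 R_{1,3}*\mathcal R_{2,3}$ and $\mathcal R\circ(\mathrm{id}\otimes m_H)=\mathcal R_{1,3}*\mathcal R_{1,2}$, where $m_H$ is the multiplication. $\mathcal J_{\mathbf c}\in\operatorname{Hom}_\Bbbk(H^{\otimes n}\otimes H^{\otimes n},\Bbbk)$ is the convolution product, over $i=2,\dots,n$ in increasing order and for each $i$ over $j=i-1,\dots,1$ in decreasing order, of $\mathcal R^{(\mathbf c(j,i))}_{i,n+j}$ (and $\mathcal J_{\mathbf c}=\varepsilon\otimes\varepsilon$ for $n=1$). The twisted multiplication is $\mathbf h\bullet_{\mathbf c}\mathbf h'=\mathcal J_{\mathbf c}^{*-1}(\mathbf h_{(1)},\mathbf h'_{(1)})\,\mathcal J_{\mathbf c}(\mathbf h_{(3)},\mathbf h'_{(3)})\,\mathbf h_{(2)}\mathbf h'_{(2)}$, with the standard coproduct and product of $H^{\otimes n}$ on the right; for transitive $\mathbf c$ this makes $H^{\otimes n}$ a bialgebra with its standard comultiplication. $\mathbf c$ is transitive if $\mathbf c(i,k)\in\{\mathbf c(i,j),\mathbf c(j,k)\}$ for all $1\le i<j<k\le n$. *)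

theory Defs
  imports Complex_Main "HOL-Library.Function_Algebras"
begin

section \<open>Vector spaces and multilinear maps\<close>

text \<open>A vector space over the field \<open>'k\<close> is a subspace \<open>carrier V\<close> of some ambient type.
  Carriers are needed because \<open>H\<^sup>\<otimes>\<^sup>n\<close>, for varying \<open>n\<close>, is not a type.\<close>

record ('k, 'a) vspace =
  carrier :: "'a set"
  smult :: "'k \<Rightarrow> 'a \<Rightarrow> 'a"

definition is_vspace :: "('k::field, 'a::ab_group_add, 'z) vspace_scheme \<Rightarrow> bool" where
  "is_vspace V \<longleftrightarrow> vector_space (smult V) \<and> module.subspace (smult V) (carrier V)"

definition ground :: "('k::field, 'k) vspace" where
  "ground = \<lparr>carrier = UNIV, smult = (*)\<rparr>"

definition lin_map ::
  "('k::field, 'a::ab_group_add, 'z) vspace_scheme \<Rightarrow> ('k, 'b::ab_group_add, 'y) vspace_scheme \<Rightarrow> ('a \<Rightarrow> 'b) \<Rightarrow> bool"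
  where
  "lin_map V W f \<longleftrightarrow>
     (\<forall>x\<in>carrier V. f x \<in> carrier W) \<and>
     (\<forall>x\<in>carrier V. \<forall>y\<in>carrier V. f (x + y) = f x + f y) \<and>
     (\<forall>c. \<forall>x\<in>carrier V. f (smult V c x) = smult W c (f x))"

definition tuples :: "('k, 'a, 'z) vspace_scheme \<Rightarrow> nat \<Rightarrow> 'a list set" where
  "tuples V n = {hs. length hs = n \<and> set hs \<subseteq> carrier V}"

definition multilinear ::
  "('k::field, 'a::ab_group_add, 'z) vspace_scheme \<Rightarrow> ('k, 'b::ab_group_add, 'y) vspace_scheme \<Rightarrow> nat \<Rightarrow> ('a list \<Rightarrow> 'b) \<Rightarrow> bool"
  where
  "multilinear V W n F \<longleftrightarrow>
     (\<forall>hs\<in>tuples V n. F hs \<in> carrier W) \<and>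
     (\<forall>hs\<in>tuples V n. \<forall>i<n. \<forall>x\<in>carrier V. \<forall>y\<in>carrier V.
        F (hs[i := x + y]) = F (hs[i := x]) + F (hs[i := y])) \<and>
     (\<forall>hs\<in>tuples V n. \<forall>i<n. \<forall>c. \<forall>x\<in>carrier V.
        F (hs[i := smult V c x]) = smult W c (F (hs[i := x])))"


section \<open>Tensor powers\<close>

text \<open>As \<open>'k\<close> is a field, the natural map from \<open>V\<^sup>\<otimes>\<^sup>n\<close> to the dual of the space of \<open>n\<close>-linear forms
  on \<open>V\<close> is injective. The tensor power is modelled as its image: \<open>h\<^sub>1 \<otimes> \<dots> \<otimes> h\<^sub>n\<close> is evaluation of
  \<open>n\<close>-linear forms at \<open>(h\<^sub>1, \<dots>, h\<^sub>n)\<close> (extended by 0 to all functions), and \<open>V\<^sup>\<otimes>\<^sup>n\<close> is the span of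
  these. The universal property is proved below (\<open>multilinear_pure\<close>, \<open>tensor_universal\<close>).\<close>

type_synonym ('k, 'a) tensor = "('a list \<Rightarrow> 'k) \<Rightarrow> 'k"

definition pure :: "('k::field, 'a::ab_group_add, 'z) vspace_scheme \<Rightarrow> 'a list \<Rightarrow> ('k, 'a) tensor" where
  "pure V hs = (\<lambda>f. if multilinear V ground (length hs) f then f hs else 0)"

definition tscale :: "'k::field \<Rightarrow> ('k, 'a) tensor \<Rightarrow> ('k, 'a) tensor" where
  "tscale c t = (\<lambda>f. c * t f)"

definition tpow :: "('k::field, 'a::ab_group_add, 'z) vspace_scheme \<Rightarrow> nat \<Rightarrow> ('k, ('k, 'a) tensor) vspace" where
  "tpow V n = \<lparr>carrier = module.span tscale (pure V ` tuples V n), smult = tscale\<rparr>"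

text \<open>\<open>tlift V W n F\<close> is the linear map \<open>V\<^sup>\<otimes>\<^sup>n \<rightarrow> W\<close> induced by an \<open>n\<close>-linear \<open>F : V\<^sup>n \<rightarrow> W\<close>.
  It is meaningful only for multilinear \<open>F\<close> and on the carrier of \<open>V\<^sup>\<otimes>\<^sup>n\<close>.\<close>

definition tlift ::
  "('k::field, 'a::ab_group_add, 'z) vspace_scheme \<Rightarrow> ('k, 'b::ab_group_add, 'y) vspace_scheme \<Rightarrow> nat \<Rightarrow>
   ('a list \<Rightarrow> 'b) \<Rightarrow> ('k, 'a) tensor \<Rightarrow> 'b" where
  "tlift V W n F t = (THE w. \<exists>S c. finite S \<and> S \<subseteq> tuples V n \<and>
     t = (\<Sum>hs\<in>S. tscale (c hs) (pure V hs)) \<and> w = (\<Sum>hs\<in>S. smult W (c hs) (F hs)))"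

lemma sum_fun_apply: "(\<Sum>x\<in>A. f x) y = (\<Sum>x\<in>A. f x y :: 'b::comm_monoid_add)"
  by (induction A rule: infinite_finite_induct) auto

lemma vector_space_tscale: "vector_space (tscale :: 'k::field \<Rightarrow> ('k, 'a) tensor \<Rightarrow> ('k, 'a) tensor)"
  by unfold_locales (auto simp: tscale_def algebra_simps fun_eq_iff)

lemma vector_space_ground: "vector_space ((*) :: 'k::field \<Rightarrow> 'k \<Rightarrow> 'k)"
  by unfold_locales (auto simp: algebra_simps)

lemma tpow_carrier:
  fixes V :: "('k::field, 'a::ab_group_add, 'z) vspace_scheme"
  shows "t \<in> carrier (tpow V n) \<longleftrightarrow>
     (\<exists>S c. finite S \<and> S \<subseteq> tuples V n \<and> t = (\<Sum>hs\<in>S. tscale (c hs) (pure V hs)))"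
proof -
  interpret T: vector_space "tscale :: 'k \<Rightarrow> ('k, 'a) tensor \<Rightarrow> ('k, 'a) tensor"
    by (rule vector_space_tscale)
  show ?thesis
  proof
    assume "t \<in> carrier (tpow V n)"
    then obtain U r where U: "finite U" "U \<subseteq> pure V ` tuples V n" "t = (\<Sum>a\<in>U. tscale (r a) a)"
      by (auto simp: tpow_def T.span_explicit)
    then obtain S where S: "S \<subseteq> tuples V n" "inj_on (pure V) S" "U = pure V ` S"
      by (auto simp: subset_image_inj)
    have "finite S" using U(1) S(2,3) by (simp add: finite_image_iff)
    moreover have "t = (\<Sum>hs\<in>S. tscale (r (pure V hs)) (pure V hs))"
      using U(3) S(2,3) by (simp add: sum.reindex)
    ultimately show "\<exists>S c. finite S \<and> S \<subseteq> tuples V n \<and> t = (\<Sum>hs\<in>S. tscale (c hs) (pure V hs))"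
      using S(1) by (intro exI[of _ S] exI[of _ "\<lambda>hs. r (pure V hs)"]) auto
  next
    assume "\<exists>S c. finite S \<and> S \<subseteq> tuples V n \<and> t = (\<Sum>hs\<in>S. tscale (c hs) (pure V hs))"
    then show "t \<in> carrier (tpow V n)"
      unfolding tpow_def
      by (clarsimp, intro T.span_sum T.span_scale T.span_base) auto
  qed
qed

lemma is_vspace_tpow: "is_vspace (tpow V n)"
  using vector_space_tscale module.subspace_span
  by (force simp: is_vspace_def tpow_def module_iff_vector_space)

lemma separating_functional:
  assumes "vector_space (s :: 'k::field \<Rightarrow> 'b::ab_group_add \<Rightarrow> 'b)" and "w \<noteq> 0"
  shows "\<exists>\<phi>. Vector_Spaces.linear s (*) \<phi> \<and> \<phi> w \<noteq> 0"
proof -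
  interpret vector_space s by fact
  interpret P: vector_space_pair s "(*) :: 'k \<Rightarrow> 'k \<Rightarrow> 'k"
    by (intro vector_space_pair.intro assms vector_space_ground)
  have ind: "independent {w}" using assms(2) by simp
  show ?thesis
    using P.linear_construct[OF ind, of "\<lambda>_. 1"] P.construct_basis[OF ind, of w "\<lambda>_. 1"]
    by (intro exI[of _ "P.construct {w} (\<lambda>_. 1)"]) simp
qed

text \<open>Relations between pure tensors are preserved by multilinear maps.\<close>

lemma multilinear_respects:
  assumes W: "is_vspace W" and F: "multilinear V W n F"
    and S: "finite S" "S \<subseteq> tuples V n" and S': "finite S'" "S' \<subseteq> tuples V n"
    and eq: "(\<Sum>hs\<in>S. tscale (c hs) (pure V hs)) = (\<Sum>hs\<in>S'. tscale (c' hs) (pure V hs))"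
  shows "(\<Sum>hs\<in>S. smult W (c hs) (F hs)) = (\<Sum>hs\<in>S'. smult W (c' hs) (F hs))"
proof (rule ccontr)
  assume "\<not> ?thesis"
  then have "(\<Sum>hs\<in>S. smult W (c hs) (F hs)) - (\<Sum>hs\<in>S'. smult W (c' hs) (F hs)) \<noteq> 0"
    by simp
  then obtain \<phi> where lin: "Vector_Spaces.linear (smult W) (*) \<phi>"
    and ne: "\<phi> ((\<Sum>hs\<in>S. smult W (c hs) (F hs)) - (\<Sum>hs\<in>S'. smult W (c' hs) (F hs))) \<noteq> 0"
    using separating_functional W unfolding is_vspace_def by blast
  interpret L: Vector_Spaces.linear "smult W" "(*)" \<phi> by (rule lin)
  have form: "multilinear V ground n (\<lambda>hs. \<phi> (F hs))"
    using F by (auto simp: multilinear_def ground_def L.add L.scale)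
  have ev: "(\<Sum>hs\<in>A. tscale (d hs) (pure V hs)) (\<lambda>hs. \<phi> (F hs)) = \<phi> (\<Sum>hs\<in>A. smult W (d hs) (F hs))"
    if "A \<subseteq> tuples V n" for A d
    unfolding sum_fun_apply L.sum
    using that form by (intro sum.cong) (auto simp: tscale_def pure_def tuples_def L.scale)
  show False
    using ne ev[OF S(2), of c] ev[OF S'(2), of c'] eq by (simp add: L.diff)
qed

lemma tlift_eq:
  assumes W: "is_vspace W" and F: "multilinear V W n F"
    and S: "finite S" "S \<subseteq> tuples V n"
  shows "tlift V W n F (\<Sum>hs\<in>S. tscale (c hs) (pure V hs)) = (\<Sum>hs\<in>S. smult W (c hs) (F hs))"
  unfolding tlift_def
proof (rule the_equality)
  show "\<exists>S' c'. finite S' \<and> S' \<subseteq> tuples V n \<and>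
      (\<Sum>hs\<in>S. tscale (c hs) (pure V hs)) = (\<Sum>hs\<in>S'. tscale (c' hs) (pure V hs)) \<and>
      (\<Sum>hs\<in>S. smult W (c hs) (F hs)) = (\<Sum>hs\<in>S'. smult W (c' hs) (F hs))"
    using S by blast
next
  fix w
  assume "\<exists>S' c'. finite S' \<and> S' \<subseteq> tuples V n \<and>
      (\<Sum>hs\<in>S. tscale (c hs) (pure V hs)) = (\<Sum>hs\<in>S'. tscale (c' hs) (pure V hs)) \<and>
      w = (\<Sum>hs\<in>S'. smult W (c' hs) (F hs))"
  then obtain S' c' where S': "finite S'" "S' \<subseteq> tuples V n"
    and eq: "(\<Sum>hs\<in>S. tscale (c hs) (pure V hs)) = (\<Sum>hs\<in>S'. tscale (c' hs) (pure V hs))"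
    and w: "w = (\<Sum>hs\<in>S'. smult W (c' hs) (F hs))"
    by blast
  show "w = (\<Sum>hs\<in>S. smult W (c hs) (F hs))"
    unfolding w by (rule multilinear_respects[OF W F S S' eq, symmetric])
qed

lemma lin_map_sum:
  assumes V: "is_vspace V" and W: "is_vspace W" and g: "lin_map V W g"
    and A: "finite A" "\<And>x. x \<in> A \<Longrightarrow> v x \<in> carrier V"
  shows "g (\<Sum>x\<in>A. smult V (c x) (v x)) = (\<Sum>x\<in>A. smult W (c x) (g (v x)))"
proof -
  interpret v: vector_space "smult V" using V by (simp add: is_vspace_def)
  interpret w: vector_space "smult W" using W by (simp add: is_vspace_def)
  have sub: "v.subspace (carrier V)" using V by (simp add: is_vspace_def)
  have "g (smult V 0 0) = smult W 0 (g 0)"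
    using g v.subspace_0[OF sub] unfolding lin_map_def by blast
  then have g0: "g 0 = 0" by simp
  show ?thesis using A
  proof (induction A rule: finite_induct)
    case (insert x A)
    have "smult V (c x) (v x) \<in> carrier V" "(\<Sum>x\<in>A. smult V (c x) (v x)) \<in> carrier V"
      using insert.prems by (auto intro!: v.subspace_scale[OF sub] v.subspace_sum[OF sub])
    then show ?case using insert g by (simp add: lin_map_def)
  qed (simp add: g0)
qed

theorem multilinear_pure:
  fixes V :: "('k::field, 'a::ab_group_add, 'z) vspace_scheme"
  assumes V: "is_vspace V"
  shows "multilinear V (tpow V n) n (pure V)"
proof -
  interpret v: vector_space "smult V" using V by (simp add: is_vspace_def)
  interpret T: vector_space "tscale :: 'k \<Rightarrow> ('k, 'a) tensor \<Rightarrow> ('k, 'a) tensor"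
    by (rule vector_space_tscale)
  show ?thesis
    unfolding multilinear_def
  proof (intro conjI ballI allI impI)
    fix hs i x y c assume *: "hs \<in> tuples V n" "i < n" "x \<in> carrier V" "y \<in> carrier V"
    have len: "length hs = n" using *(1) by (simp add: tuples_def)
    have add: "f (hs[i := x + y]) = f (hs[i := x]) + f (hs[i := y])"
      and scale: "f (hs[i := smult V c x]) = c * f (hs[i := x])" if "multilinear V ground n f" for f
      using that * unfolding multilinear_def ground_def vspace.simps by blast+
    show "pure V (hs[i := x + y]) = pure V (hs[i := x]) + pure V (hs[i := y])"
      by (rule ext) (simp add: pure_def len add)
    show "pure V (hs[i := smult V c x]) = smult (tpow V n) c (pure V (hs[i := x]))"
      by (rule ext) (simp add: pure_def tpow_def tscale_def len scale)
  qed (auto simp: tpow_def intro: T.span_base)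
qed

theorem tensor_universal:
  fixes V :: "('k::field, 'a::ab_group_add, 'z) vspace_scheme"
  assumes W: "is_vspace W" and F: "multilinear V W n F"
  shows "lin_map (tpow V n) W (tlift V W n F)"
    and "hs \<in> tuples V n \<Longrightarrow> tlift V W n F (pure V hs) = F hs"
    and "lin_map (tpow V n) W g \<Longrightarrow> (\<And>hs. hs \<in> tuples V n \<Longrightarrow> g (pure V hs) = F hs) \<Longrightarrow>
         t \<in> carrier (tpow V n) \<Longrightarrow> g t = tlift V W n F t"
proof -
  interpret w: vector_space "smult W" using W by (simp add: is_vspace_def)
  have sub: "w.subspace (carrier W)" using W by (simp add: is_vspace_def)
  interpret T: vector_space "tscale :: 'k \<Rightarrow> ('k, 'a) tensor \<Rightarrow> ('k, 'a) tensor"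
    by (rule vector_space_tscale)
  have sm: "smult (tpow V n) = tscale" by (simp add: tpow_def)
  show "lin_map (tpow V n) W (tlift V W n F)"
    unfolding lin_map_def
  proof (intro conjI ballI allI)
    fix t assume "t \<in> carrier (tpow V n)"
    then obtain S c where t: "finite S" "S \<subseteq> tuples V n" "t = (\<Sum>hs\<in>S. tscale (c hs) (pure V hs))"
      unfolding tpow_carrier by blast
    show "tlift V W n F t \<in> carrier W"
      unfolding t(3) tlift_eq[OF W F t(1,2)] using F t(2)
      by (auto simp: multilinear_def intro!: w.subspace_sum[OF sub] w.subspace_scale[OF sub])
    fix k
    have "smult (tpow V n) k t = (\<Sum>hs\<in>S. tscale (k * c hs) (pure V hs))"
      by (simp add: sm t(3) T.scale_sum_right)
    then show "tlift V W n F (smult (tpow V n) k t) = smult W k (tlift V W n F t)"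
      unfolding t(3) by (simp add: tlift_eq[OF W F t(1,2)] w.scale_sum_right)
  next
    fix t u assume "t \<in> carrier (tpow V n)" "u \<in> carrier (tpow V n)"
    then obtain S c S' c' where t: "finite S" "S \<subseteq> tuples V n" "t = (\<Sum>hs\<in>S. tscale (c hs) (pure V hs))"
      and u: "finite S'" "S' \<subseteq> tuples V n" "u = (\<Sum>hs\<in>S'. tscale (c' hs) (pure V hs))"
      unfolding tpow_carrier by blast
    define d where "d hs = (if hs \<in> S then c hs else 0)" for hs
    define d' where "d' hs = (if hs \<in> S' then c' hs else 0)" for hs
    have fin: "finite (S \<union> S')" "S \<union> S' \<subseteq> tuples V n" using t u by auto
    have t': "t = (\<Sum>hs\<in>S\<union>S'. tscale (d hs) (pure V hs))"
      unfolding t(3) using fin by (intro sum.mono_neutral_cong_left) (auto simp: d_def)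
    have u': "u = (\<Sum>hs\<in>S\<union>S'. tscale (d' hs) (pure V hs))"
      unfolding u(3) using fin by (intro sum.mono_neutral_cong_left) (auto simp: d'_def)
    have "t + u = (\<Sum>hs\<in>S\<union>S'. tscale (d hs + d' hs) (pure V hs))"
      unfolding t' u' by (simp add: sum.distrib T.scale_left_distrib)
    then show "tlift V W n F (t + u) = tlift V W n F t + tlift V W n F u"
      unfolding t' u' by (simp add: tlift_eq[OF W F fin] w.scale_left_distrib sum.distrib)
  qed
  show val: "tlift V W n F (pure V hs) = F hs" if "hs \<in> tuples V n" for hs
    using tlift_eq[OF W F, of "{hs}" "\<lambda>_. 1"] that by simp
  show "g t = tlift V W n F t"
    if g: "lin_map (tpow V n) W g" and gp: "\<And>hs. hs \<in> tuples V n \<Longrightarrow> g (pure V hs) = F hs"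
      and t: "t \<in> carrier (tpow V n)"
  proof -
    from t obtain S c where t: "finite S" "S \<subseteq> tuples V n" "t = (\<Sum>hs\<in>S. tscale (c hs) (pure V hs))"
      unfolding tpow_carrier by blast
    have "pure V hs \<in> carrier (tpow V n)" if "hs \<in> S" for hs
      using that t(2) by (auto simp: tpow_def intro!: T.span_base)
    then have "g t = (\<Sum>hs\<in>S. smult W (c hs) (g (pure V hs)))"
      unfolding t(3) using lin_map_sum[OF is_vspace_tpow W g t(1), of "pure V" c] by (simp add: sm)
    also have "\<dots> = (\<Sum>hs\<in>S. smult W (c hs) (F hs))"
      using gp t(2) by (intro sum.cong) auto
    finally show ?thesis unfolding t(3) tlift_eq[OF W F t(1,2)] .
  qed
qed

text \<open>Juxtaposition \<open>H\<^sup>\<otimes>\<^sup>m \<times> H\<^sup>\<otimes>\<^sup>n \<rightarrow> H\<^sup>\<otimes>\<^sup>m\<^sup>+\<^sup>n\<close>, i.e. \<open>t \<otimes> u\<close> under the identification of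
  \<open>H\<^sup>\<otimes>\<^sup>m \<otimes> H\<^sup>\<otimes>\<^sup>n\<close> with \<open>H\<^sup>\<otimes>\<^sup>m\<^sup>+\<^sup>n\<close>.\<close>

definition tjoin ::
  "('k::field, 'a::ab_group_add, 'z) vspace_scheme \<Rightarrow> nat \<Rightarrow> nat \<Rightarrow> ('k, 'a) tensor \<Rightarrow> ('k, 'a) tensor \<Rightarrow> ('k, 'a) tensor"
  where
  "tjoin V m n t u =
     tlift V (tpow V (m + n)) m (\<lambda>hs. tlift V (tpow V (m + n)) n (\<lambda>ks. pure V (hs @ ks)) u) t"


section \<open>Bialgebras\<close>

record ('k, 'a) bialg = "('k, 'a) vspace" +
  mul :: "'a \<Rightarrow> 'a \<Rightarrow> 'a"
  unit :: 'a
  comul :: "'a \<Rightarrow> ('k, 'a) tensor"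
  counit :: "'a \<Rightarrow> 'k"

text \<open>Sweedler sums with values in \<open>W\<close>: \<open>sweedler D W F d\<close> is \<open>\<Sum> F d\<^sub>(\<^sub>1\<^sub>) d\<^sub>(\<^sub>2\<^sub>)\<close>, for bilinear \<open>F\<close>.\<close>

definition sweedler ::
  "('k::field, 'a::ab_group_add) bialg \<Rightarrow> ('k, 'b::ab_group_add, 'y) vspace_scheme \<Rightarrow> ('a \<Rightarrow> 'a \<Rightarrow> 'b) \<Rightarrow> 'a \<Rightarrow> 'b"
  where
  "sweedler D W F d = tlift D W 2 (\<lambda>xs. F (xs ! 0) (xs ! 1)) (comul D d)"

definition sweedler3 ::
  "('k::field, 'a::ab_group_add) bialg \<Rightarrow> ('k, 'b::ab_group_add, 'y) vspace_scheme \<Rightarrow> ('a \<Rightarrow> 'a \<Rightarrow> 'a \<Rightarrow> 'b) \<Rightarrow> 'a \<Rightarrow> 'b"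
  where
  "sweedler3 D W F d = sweedler D W (\<lambda>d1 x. sweedler D W (\<lambda>d2 d3. F d1 d2 d3) x) d"

text \<open>The factorwise product of \<open>H\<^sup>\<otimes>\<^sup>N\<close>.\<close>

definition tmul :: "('k::field, 'a::ab_group_add) bialg \<Rightarrow> nat \<Rightarrow> ('k, 'a) tensor \<Rightarrow> ('k, 'a) tensor \<Rightarrow> ('k, 'a) tensor" where
  "tmul H N t u =
     tlift H (tpow H N) N (\<lambda>hs. tlift H (tpow H N) N (\<lambda>ks. pure H (map2 (mul H) hs ks)) u) t"

definition is_algebra :: "('k::field, 'a::ab_group_add) bialg \<Rightarrow> bool" where
  "is_algebra H \<longleftrightarrow> is_vspace H \<and>
     (\<forall>a\<in>carrier H. lin_map H H (mul H a)) \<and>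
     (\<forall>a\<in>carrier H. lin_map H H (\<lambda>b. mul H b a)) \<and>
     (\<forall>a\<in>carrier H. \<forall>b\<in>carrier H. \<forall>c\<in>carrier H. mul H (mul H a b) c = mul H a (mul H b c)) \<and>
     unit H \<in> carrier H \<and>
     (\<forall>a\<in>carrier H. mul H (unit H) a = a \<and> mul H a (unit H) = a)"

definition is_coalgebra :: "('k::field, 'a::ab_group_add) bialg \<Rightarrow> bool" where
  "is_coalgebra H \<longleftrightarrow> is_vspace H \<and>
     lin_map H (tpow H 2) (comul H) \<and> lin_map H ground (counit H) \<and>
     (\<forall>a\<in>carrier H.
        sweedler H (tpow H 3) (\<lambda>x y. tjoin H 2 1 (comul H x) (pure H [y])) a =
        sweedler H (tpow H 3) (\<lambda>x y. tjoin H 1 2 (pure H [x]) (comul H y)) a) \<and>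
     (\<forall>a\<in>carrier H. sweedler H H (\<lambda>x y. smult H (counit H x) y) a = a) \<and>
     (\<forall>a\<in>carrier H. sweedler H H (\<lambda>x y. smult H (counit H y) x) a = a)"

definition is_bialgebra :: "('k::field, 'a::ab_group_add) bialg \<Rightarrow> bool" where
  "is_bialgebra H \<longleftrightarrow> is_algebra H \<and> is_coalgebra H \<and>
     comul H (unit H) = pure H [unit H, unit H] \<and> counit H (unit H) = 1 \<and>
     (\<forall>a\<in>carrier H. \<forall>b\<in>carrier H.
        comul H (mul H a b) = tmul H 2 (comul H a) (comul H b) \<and>
        counit H (mul H a b) = counit H a * counit H b)"

text \<open>\<open>sweedler_list H W F [h\<^sub>1, \<dots>, h\<^sub>N]\<close> is
  \<open>\<Sum> F [h\<^sub>1\<^sub>(\<^sub>1\<^sub>), \<dots>, h\<^sub>N\<^sub>(\<^sub>1\<^sub>)] [h\<^sub>1\<^sub>(\<^sub>2\<^sub>), \<dots>, h\<^sub>N\<^sub>(\<^sub>2\<^sub>)]\<close>.\<close>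

fun sweedler_list ::
  "('k::field, 'a::ab_group_add) bialg \<Rightarrow> ('k, 'b::ab_group_add, 'y) vspace_scheme \<Rightarrow>
   ('a list \<Rightarrow> 'a list \<Rightarrow> 'b) \<Rightarrow> 'a list \<Rightarrow> 'b" where
  "sweedler_list H W F [] = F [] []"
| "sweedler_list H W F (h # hs) =
     sweedler H W (\<lambda>x y. sweedler_list H W (\<lambda>xs ys. F (x # xs) (y # ys)) hs) h"

text \<open>\<open>H\<^sup>\<otimes>\<^sup>N\<close> with its standard bialgebra structure.\<close>

definition tpow_bialg :: "('k::field, 'a::ab_group_add) bialg \<Rightarrow> nat \<Rightarrow> ('k, ('k, 'a) tensor) bialg" where
  "tpow_bialg H N =
     \<lparr>carrier = carrier (tpow H N), smult = smult (tpow H N),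
      mul = tmul H N,
      unit = pure H (replicate N (unit H)),
      comul = tlift H (tpow (tpow H N) 2) N
        (sweedler_list H (tpow (tpow H N) 2) (\<lambda>xs ys. pure (tpow H N) [pure H xs, pure H ys])),
      counit = tlift H ground N (\<lambda>hs. \<Prod>h\<leftarrow>hs. counit H h)\<rparr>"

text \<open>Preservation of all structure maps. The bialgebra axioms for \<open>A\<close> and \<open>B\<close> are not part of
  this definition. The last clause is \<open>\<Delta> \<circ> \<phi> = (\<phi> \<otimes> \<phi>) \<circ> \<Delta>\<close>.\<close>

definition bialgebra_hom ::
  "('k::field, 'a::ab_group_add) bialg \<Rightarrow> ('k, 'b::ab_group_add) bialg \<Rightarrow> ('a \<Rightarrow> 'b) \<Rightarrow> bool" where
  "bialgebra_hom A B \<phi> \<longleftrightarrow> lin_map A B \<phi> \<and>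
     \<phi> (unit A) = unit B \<and>
     (\<forall>x\<in>carrier A. \<forall>y\<in>carrier A. \<phi> (mul A x y) = mul B (\<phi> x) (\<phi> y)) \<and>
     (\<forall>x\<in>carrier A. counit B (\<phi> x) = counit A x) \<and>
     (\<forall>x\<in>carrier A. comul B (\<phi> x) = sweedler A (tpow B 2) (\<lambda>y z. pure B [\<phi> y, \<phi> z]) x)"


section \<open>Convolution and co-quasi-triangular structures\<close>

definition conv :: "('k::field, 'a::ab_group_add) bialg \<Rightarrow> ('a \<Rightarrow> 'k) \<Rightarrow> ('a \<Rightarrow> 'k) \<Rightarrow> 'a \<Rightarrow> 'k" where
  "conv D f g d = sweedler D ground (\<lambda>x y. f x * g y) d"

definition is_conv_inverse :: "('k::field, 'a::ab_group_add) bialg \<Rightarrow> ('a \<Rightarrow> 'k) \<Rightarrow> ('a \<Rightarrow> 'k) \<Rightarrow> bool" where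
  "is_conv_inverse D f g \<longleftrightarrow> lin_map D ground g \<and>
     (\<forall>d\<in>carrier D. conv D f g d = counit D d \<and> conv D g f d = counit D d)"

text \<open>A convolution inverse is unique on \<open>carrier D\<close>, but arbitrary outside it.\<close>

definition conv_inv :: "('k::field, 'a::ab_group_add) bialg \<Rightarrow> ('a \<Rightarrow> 'k) \<Rightarrow> 'a \<Rightarrow> 'k" where
  "conv_inv D f = (SOME g. is_conv_inverse D f g)"

definition conv_prod :: "('k::field, 'a::ab_group_add) bialg \<Rightarrow> ('a \<Rightarrow> 'k) list \<Rightarrow> 'a \<Rightarrow> 'k" where
  "conv_prod D fs = foldr (conv D) fs (counit D)"

text \<open>\<open>leg H N f [i\<^sub>1, \<dots>, i\<^sub>r]\<close> is \<open>f\<close> with subscripts \<open>i\<^sub>1, \<dots>, i\<^sub>r\<close>, an element of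
  \<open>Hom(H\<^sup>\<otimes>\<^sup>N, 'k)\<close>. Positions are counted from 1, list entries from 0.\<close>

definition leg ::
  "('k::field, 'a::ab_group_add) bialg \<Rightarrow> nat \<Rightarrow> (('k, 'a) tensor \<Rightarrow> 'k) \<Rightarrow> nat list \<Rightarrow> ('k, 'a) tensor \<Rightarrow> 'k" where
  "leg H N f is = tlift H ground N
     (\<lambda>hs. f (pure H (map (\<lambda>i. hs ! (i - 1)) is)) * (\<Prod>j\<in>{1..N} - set is. counit H (hs ! (j - 1))))"

definition coquasitriangular :: "('k::field, 'a::ab_group_add) bialg \<Rightarrow> (('k, 'a) tensor \<Rightarrow> 'k) \<Rightarrow> bool" where
  "coquasitriangular H R \<longleftrightarrow>
     lin_map (tpow H 2) ground R \<and>
     (\<exists>R'. is_conv_inverse (tpow_bialg H 2) R R') \<and>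
     (\<forall>a\<in>carrier H. \<forall>b\<in>carrier H.
        sweedler H H (\<lambda>a1 a2. sweedler H H (\<lambda>b1 b2. smult H (R (pure H [a1, b1])) (mul H a2 b2)) b) a =
        sweedler H H (\<lambda>a1 a2. sweedler H H (\<lambda>b1 b2. smult H (R (pure H [a2, b2])) (mul H b1 a1)) b) a) \<and>
     (\<forall>a\<in>carrier H. \<forall>b\<in>carrier H. \<forall>c\<in>carrier H.
        R (pure H [mul H a b, c]) =
        conv (tpow_bialg H 3) (leg H 3 R [1, 3]) (leg H 3 R [2, 3]) (pure H [a, b, c])) \<and>
     (\<forall>a\<in>carrier H. \<forall>b\<in>carrier H. \<forall>c\<in>carrier H.
        R (pure H [a, mul H b c]) =
        conv (tpow_bialg H 3) (leg H 3 R [1, 3]) (leg H 3 R [1, 2]) (pure H [a, b, c]))"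


section \<open>The twisted tensor power\<close>

definition transitive_colouring :: "nat \<Rightarrow> (nat \<times> nat \<Rightarrow> 'c) \<Rightarrow> bool" where
  "transitive_colouring n c \<longleftrightarrow>
     (\<forall>i j k. 1 \<le> i \<and> i < j \<and> j < k \<and> k \<le> n \<longrightarrow> c (i, k) \<in> {c (i, j), c (j, k)})"

text \<open>\<open>\<J>\<^sub>c\<close> as a functional on \<open>H\<^sup>\<otimes>\<^sup>2\<^sup>n\<close>, identified with \<open>H\<^sup>\<otimes>\<^sup>n \<otimes> H\<^sup>\<otimes>\<^sup>n\<close> via \<open>tjoin\<close>.\<close>

definition twist ::
  "('k::field, 'a::ab_group_add) bialg \<Rightarrow> ('c \<Rightarrow> ('k, 'a) tensor \<Rightarrow> 'k) \<Rightarrow> nat \<Rightarrow> (nat \<times> nat \<Rightarrow> 'c) \<Rightarrow>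
   ('k, 'a) tensor \<Rightarrow> 'k" where
  "twist H R n c = conv_prod (tpow_bialg H (2 * n))
     (concat (map (\<lambda>i. map (\<lambda>j. leg H (2 * n) (R (c (j, i))) [i, n + j]) (rev [1..<i])) [2..<Suc n]))"

definition twisted_mul ::
  "('k::field, 'a::ab_group_add) bialg \<Rightarrow> nat \<Rightarrow> (('k, 'a) tensor \<Rightarrow> 'k) \<Rightarrow>
   ('k, 'a) tensor \<Rightarrow> ('k, 'a) tensor \<Rightarrow> ('k, 'a) tensor" where
  "twisted_mul H n J t u =
     (let D = tpow_bialg H n; J' = conv_inv (tpow_bialg H (2 * n)) J in
      sweedler3 D D (\<lambda>t1 t2 t3. sweedler3 D D (\<lambda>u1 u2 u3.
        smult D (J' (tjoin H n n t1 u1) * J (tjoin H n n t3 u3)) (mul D t2 u2)) u) t)"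

definition twisted_bialg ::
  "('k::field, 'a::ab_group_add) bialg \<Rightarrow> ('c \<Rightarrow> ('k, 'a) tensor \<Rightarrow> 'k) \<Rightarrow> nat \<Rightarrow> (nat \<times> nat \<Rightarrow> 'c) \<Rightarrow>
   ('k, ('k, 'a) tensor) bialg" where
  "twisted_bialg H R n c = (tpow_bialg H n)\<lparr>mul := twisted_mul H n (twist H R n c)\<rparr>"

definition iterated_mul :: "('k::field, 'a::ab_group_add) bialg \<Rightarrow> nat \<Rightarrow> ('k, 'a) tensor \<Rightarrow> 'a" where
  "iterated_mul H n = tlift H H n (\<lambda>hs. foldr (mul H) hs (unit H))"

end

(*
  Write m for the iterated multiplication. On H^{(x)2n} consider the maps h (x) h' |-> m(h h') = h_1 h'_1 ... h_n h'_n
  and h (x) h' |-> m(h) m(h') = h_1 ... h_n h'_1 ... h'_n. The first axiom of a co-quasi-triangular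
  structure says that convolving with R_{i,n+j} exchanges adjacent factors h'_j h_i for h_i h'_j.
  The factors of J occur in exactly the order in which these exchanges transform the first product
  into the second one, so (first) * J = J * (second), and J^{-1} * (first) * J = (second) is
  multiplicativity for the twisted product. All convolutions are made scalar by composing
  with linear functionals on H.
*)
theory Submission
  imports Defs
begin

section \<open>Multilinear maps\<close>

text \<open>The order of the factors of \<open>J\<close> is forced by adjacency. Once the indices
  below i are sorted, the word begins h_1 ... h_{i-1} h'_1 ... h'_{i-1} h_i, so h_i has to pass
  h'_{i-1} first, then h'_{i-2}, and so on down to h'_1; this is row i of \<open>J\<close>. An
  exchange stays local because a leg is the counit on all remaining tensor factors, and the counit
  laws remove those from the convolution. The obstacle is the meaning of Sweedler sums.
  \<open>sweedler\<close> is a definite description on tensors whose value is under control only for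
  a bilinear integrand, so that nesting, reordering and rewriting such sums would call for
  multilinearity at each move. With \<open>csum\<close>, a finite sum over a chosen representative
  of the coproduct, reordering is the exchange of finite sums. Bilinearity is paid for only at the
  passage from \<open>sweedler\<close>, and where the summed element itself varies linearly or its
  coproduct is expressed in another way.\<close>

definition bilin where
  "bilin V V' W F \<longleftrightarrow> (\<forall>y\<in>carrier V'. lin_map V W (\<lambda>x. F x y)) \<and> (\<forall>x\<in>carrier V. lin_map V' W (F x))"

definition bimultilinear where
  "bimultilinear V W m n F \<longleftrightarrow>
     (\<forall>ys\<in>tuples V n. multilinear V W m (\<lambda>xs. F xs ys)) \<and> (\<forall>xs\<in>tuples V m. multilinear V W n (F xs))"

lemma ground_simps [simp]: "carrier ground = UNIV" "smult ground = (*)"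
  by (simp_all add: ground_def)

lemma is_vspace_ground [simp]: "is_vspace ground"
  using vector_space_ground
  by (auto simp: is_vspace_def module_iff_vector_space intro: module.subspace_UNIV)

lemma is_vspaceD:
  assumes "is_vspace W"
  shows "vector_space (smult W)" "module (smult W)" "module.subspace (smult W) (carrier W)"
  using assms by (auto simp: is_vspace_def module_iff_vector_space)

lemma vspace_zero: "is_vspace W \<Longrightarrow> 0 \<in> carrier W"
  by (meson is_vspaceD module.subspace_0)

lemma vspace_add: "is_vspace W \<Longrightarrow> x \<in> carrier W \<Longrightarrow> y \<in> carrier W \<Longrightarrow> x + y \<in> carrier W"
  by (meson is_vspaceD module.subspace_add)

lemma vspace_smult: "is_vspace W \<Longrightarrow> x \<in> carrier W \<Longrightarrow> smult W k x \<in> carrier W"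
  by (meson is_vspaceD module.subspace_scale)

lemma vspace_sum: "is_vspace W \<Longrightarrow> (\<And>i. i \<in> A \<Longrightarrow> f i \<in> carrier W) \<Longrightarrow> sum f A \<in> carrier W"
  by (meson is_vspaceD module.subspace_sum)

lemmas vspace_closed = vspace_zero vspace_add vspace_smult vspace_sum

lemma smult_laws:
  assumes "is_vspace W"
  shows "smult W k (x + y) = smult W k x + smult W k y"
    and "smult W (k + l) x = smult W k x + smult W l x"
    and "smult W k (smult W l x) = smult W (k * l) x"
    and "smult W 1 x = x"
    and "smult W k (sum f A) = (\<Sum>i\<in>A. smult W k (f i))"
proof -
  interpret vector_space "smult W" by (rule is_vspaceD[OF assms])
  show "smult W k (x + y) = smult W k x + smult W k y" "smult W (k + l) x = smult W k x + smult W l x"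
    "smult W k (smult W l x) = smult W (k * l) x"  "smult W 1 x = x"
    "smult W k (sum f A) = (\<Sum>i\<in>A. smult W k (f i))"
    by (simp_all add: scale_right_distrib scale_left_distrib scale_sum_right)
qed

lemma lin_mapD:
  assumes "lin_map V W f"
  shows "x \<in> carrier V \<Longrightarrow> f x \<in> carrier W"
    and "x \<in> carrier V \<Longrightarrow> y \<in> carrier V \<Longrightarrow> f (x + y) = f x + f y"
    and "x \<in> carrier V \<Longrightarrow> f (smult V k x) = smult W k (f x)"
  using assms by (auto simp: lin_map_def)

lemma lin_map_sum_maps:
  assumes "is_vspace W" "\<And>i. i \<in> A \<Longrightarrow> lin_map V W (f i)"
  shows "lin_map V W (\<lambda>x. \<Sum>i\<in>A. f i x)"
  using assms unfolding lin_map_def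
  by (auto simp: smult_laws sum.distrib[symmetric] intro!: vspace_sum sum.cong)

lemma lin_map_smult: "is_vspace W \<Longrightarrow> lin_map V W f \<Longrightarrow> lin_map V W (\<lambda>x. smult W k (f x))"
  by (auto simp: lin_map_def smult_laws vspace_smult mult.commute)

lemma lin_map_smult_left:
  "is_vspace W \<Longrightarrow> lin_map V ground g \<Longrightarrow> w \<in> carrier W \<Longrightarrow> lin_map V W (\<lambda>x. smult W (g x) w)"
  by (auto simp: lin_map_def smult_laws vspace_smult)

lemma lin_map_mult_left: "lin_map V ground f \<Longrightarrow> lin_map V ground (\<lambda>x. k * f x)"
  using lin_map_smult[of ground V f k] by simp

lemma lin_map_mult_right: "lin_map V ground f \<Longrightarrow> lin_map V ground (\<lambda>x. f x * k)"
  using lin_map_smult[of ground V f k] by (simp add: mult.commute)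

lemma lin_map_comp: "lin_map V W f \<Longrightarrow> lin_map W U g \<Longrightarrow> lin_map V U (\<lambda>x. g (f x))"
  by (auto simp: lin_map_def)

lemma lin_map_id [simp]: "lin_map V V (\<lambda>x. x)"
  by (simp add: lin_map_def)

lemma lin_map_cong:
  assumes "is_vspace V" "\<And>x. x \<in> carrier V \<Longrightarrow> f x = g x"
  shows "lin_map V W f \<longleftrightarrow> lin_map V W g"
  using assms by (auto simp: lin_map_def vspace_closed)

lemma bilinI:
  "(\<And>y. y \<in> carrier V' \<Longrightarrow> lin_map V W (\<lambda>x. F x y)) \<Longrightarrow> (\<And>x. x \<in> carrier V \<Longrightarrow> lin_map V' W (F x)) \<Longrightarrow> bilin V V' W F"
  by (simp add: bilin_def)

lemma bilinD:
  assumes "bilin V V' W F"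
  shows "y \<in> carrier V' \<Longrightarrow> lin_map V W (\<lambda>x. F x y)" "x \<in> carrier V \<Longrightarrow> lin_map V' W (F x)"
    "x \<in> carrier V \<Longrightarrow> lin_map V' W (\<lambda>y. F x y)"
    "x \<in> carrier V \<Longrightarrow> y \<in> carrier V' \<Longrightarrow> F x y \<in> carrier W"
  using assms by (auto simp: bilin_def lin_map_def)

lemma tuples_simps [simp]: "[] \<in> tuples V n \<longleftrightarrow> n = 0"
  "tuples V 0 = {[]}"
  "x # hs \<in> tuples V (Suc n) \<longleftrightarrow> x \<in> carrier V \<and> hs \<in> tuples V n"
  by (auto simp: tuples_def)

lemma tuples_update: "hs \<in> tuples V n \<Longrightarrow> x \<in> carrier V \<Longrightarrow> hs[i := x] \<in> tuples V n"
  using set_update_subset_insert by (fastforce simp: tuples_def)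

lemma tuples_append: "hs \<in> tuples V m \<Longrightarrow> ks \<in> tuples V n \<Longrightarrow> hs @ ks \<in> tuples V (m + n)"
  by (auto simp: tuples_def)

lemma tuples_nth: "hs \<in> tuples V n \<Longrightarrow> i < n \<Longrightarrow> hs ! i \<in> carrier V"
  by (auto simp: tuples_def)

lemma tuples_length: "hs \<in> tuples V n \<Longrightarrow> length hs = n"
  by (auto simp: tuples_def)

lemma tuples_Suc: "hs \<in> tuples V (Suc n) \<longleftrightarrow> (\<exists>x ks. hs = x # ks \<and> x \<in> carrier V \<and> ks \<in> tuples V n)"
  by (cases hs) (auto simp: tuples_def)

lemma tuples_2: "hs \<in> tuples V 2 \<longleftrightarrow> (\<exists>x y. hs = [x, y] \<and> x \<in> carrier V \<and> y \<in> carrier V)"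
  by (auto simp: numeral_2_eq_2 tuples_Suc)

lemma tuples_3: "hs \<in> tuples V 3 \<longleftrightarrow> (\<exists>x y z. hs = [x, y, z] \<and> x \<in> carrier V \<and> y \<in> carrier V \<and> z \<in> carrier V)"
  by (auto simp: numeral_3_eq_3 tuples_Suc)

lemma multilinear_iff_update:
  "multilinear V W n F \<longleftrightarrow> (\<forall>hs\<in>tuples V n. F hs \<in> carrier W) \<and>
     (\<forall>hs\<in>tuples V n. \<forall>i<n. lin_map V W (\<lambda>x. F (hs[i := x])))"
  unfolding multilinear_def lin_map_def using tuples_update[of _ V n] by blast

lemma multilinear_0 [simp]: "multilinear V W 0 F \<longleftrightarrow> F [] \<in> carrier W"
  by (simp add: multilinear_iff_update)

text \<open>Recursion on the head of the argument list replaces reasoning about updated positions;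
  later multilinearity proofs are inductions with this equivalence as their step.\<close>

lemma multilinear_Suc:
  "multilinear V W (Suc n) F \<longleftrightarrow> (\<forall>hs\<in>tuples V n. lin_map V W (\<lambda>x. F (x # hs))) \<and>
     (\<forall>x\<in>carrier V. multilinear V W n (\<lambda>hs. F (x # hs)))" (is "?L \<longleftrightarrow> ?R")
proof
  assume L: ?L
  show ?R
  proof (intro conjI ballI)
    fix hs assume hs: "hs \<in> tuples V n"
    show "lin_map V W (\<lambda>x. F (x # hs))"
    \<comment> \<open>\<open>multilinear\<close> speaks of updates of full tuples, so some head is
      needed to form one. \<open>V\<close> is an arbitrary record here; with an empty carrier the
      claim is vacuous.\<close>
    proof (cases "carrier V = {}")
      case False
      then obtain x where "x \<in> carrier V" by auto
      then have "x # hs \<in> tuples V (Suc n)" using hs by simp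
      then have "lin_map V W (\<lambda>y. F ((x # hs)[0 := y]))"
        using L unfolding multilinear_iff_update by blast
      then show ?thesis by simp
    qed (simp add: lin_map_def)
  next
    fix x assume x: "x \<in> carrier V"
    show "multilinear V W n (\<lambda>hs. F (x # hs))"
      unfolding multilinear_iff_update
    proof (intro conjI ballI allI impI)
      fix hs assume hs: "hs \<in> tuples V n"
      with x L show "F (x # hs) \<in> carrier W" by (auto simp: multilinear_iff_update)
      fix i assume "i < n"
      then have "lin_map V W (\<lambda>y. F ((x # hs)[Suc i := y]))"
        using L x hs unfolding multilinear_iff_update by (metis Suc_less_eq tuples_simps(3))
      then show "lin_map V W (\<lambda>y. F (x # hs[i := y]))" by simp
    qed
  qed
next
  assume R: ?R
  show ?L
    unfolding multilinear_iff_update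
  proof (intro conjI ballI allI impI)
    fix ks assume "ks \<in> tuples V (Suc n)"
    then obtain x hs where ks: "ks = x # hs" "x \<in> carrier V" "hs \<in> tuples V n" by (auto simp: tuples_Suc)
    then show "F ks \<in> carrier W" using R by (auto simp: multilinear_iff_update)
    fix i assume "i < Suc n"
    then show "lin_map V W (\<lambda>y. F (ks[i := y]))"
      using R ks by (cases i) (auto simp: multilinear_iff_update)
  qed
qed

lemma multilinear_1: "multilinear V W 1 F \<longleftrightarrow> lin_map V W (\<lambda>x. F [x])"
  by (auto simp: multilinear_Suc[of V W 0, simplified] lin_map_def)

lemma multilinear_2:
  "multilinear V W 2 F \<longleftrightarrow> bilin V V W (\<lambda>x y. F [x, y])"
  unfolding numeral_2_eq_2 multilinear_Suc[of V W "Suc 0"] multilinear_1[simplified]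
  by (auto simp: bilin_def tuples_Suc)

lemma multilinear_2_nth:
  "multilinear V W 2 (\<lambda>xs. F (xs ! 0) (xs ! 1)) \<longleftrightarrow> bilin V V W F"
  by (simp add: multilinear_2)

lemma multilinear_3:
  "multilinear V W 3 F \<longleftrightarrow> (\<forall>y\<in>carrier V. \<forall>z\<in>carrier V. lin_map V W (\<lambda>x. F [x, y, z])) \<and>
     (\<forall>x\<in>carrier V. \<forall>z\<in>carrier V. lin_map V W (\<lambda>y. F [x, y, z])) \<and>
     (\<forall>x\<in>carrier V. \<forall>y\<in>carrier V. lin_map V W (\<lambda>z. F [x, y, z]))"
  unfolding numeral_3_eq_3 multilinear_Suc[of V W "Suc (Suc 0)"] multilinear_2[unfolded numeral_2_eq_2]
  by (auto simp: bilin_def tuples_Suc)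

lemma multilinear_carrier: "multilinear V W n F \<Longrightarrow> hs \<in> tuples V n \<Longrightarrow> F hs \<in> carrier W"
  by (simp add: multilinear_def)

lemma multilinear_comp: "multilinear V W n F \<Longrightarrow> lin_map W U g \<Longrightarrow> multilinear V U n (\<lambda>hs. g (F hs))"
  unfolding multilinear_iff_update by (auto intro: lin_map_comp simp: lin_map_def)

lemma multilinear_sum_maps:
  "is_vspace W \<Longrightarrow> (\<And>i. i \<in> A \<Longrightarrow> multilinear V W n (f i)) \<Longrightarrow> multilinear V W n (\<lambda>hs. \<Sum>i\<in>A. f i hs)"
  unfolding multilinear_iff_update by (auto intro!: lin_map_sum_maps vspace_sum)

lemma multilinear_smult: "is_vspace W \<Longrightarrow> multilinear V W n f \<Longrightarrow> multilinear V W n (\<lambda>hs. smult W k (f hs))"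
  unfolding multilinear_iff_update by (auto intro!: lin_map_smult vspace_smult)

lemma multilinear_cong:
  assumes "is_vspace V" "\<And>hs. hs \<in> tuples V n \<Longrightarrow> f hs = g hs"
  shows "multilinear V W n f \<longleftrightarrow> multilinear V W n g"
proof -
  have "lin_map V W (\<lambda>x. f (hs[i := x])) \<longleftrightarrow> lin_map V W (\<lambda>x. g (hs[i := x]))" if "hs \<in> tuples V n" for hs i
    using assms that by (intro lin_map_cong) (auto simp: tuples_update)
  then show ?thesis unfolding multilinear_iff_update using assms(2) by auto
qed

lemma multilinear_mult_left: "multilinear V ground n f \<Longrightarrow> multilinear V ground n (\<lambda>hs. k * f hs)"
  using multilinear_smult[of ground V n f k] by simp
lemma multilinear_mult_right: "multilinear V ground n f \<Longrightarrow> multilinear V ground n (\<lambda>hs. f hs * k)"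
  using multilinear_smult[of ground V n f k] by (simp add: mult.commute)

lemma multilinear_append_left:
  "multilinear V W (m + n) F \<Longrightarrow> ks \<in> tuples V n \<Longrightarrow> multilinear V W m (\<lambda>hs. F (hs @ ks))"
proof (induction m arbitrary: F)
  case 0
  then show ?case by (simp add: multilinear_carrier)
next
  case (Suc m)
  then show ?case by (auto simp: multilinear_Suc tuples_append)
qed

lemma multilinear_append_right:
  "multilinear V W (m + n) F \<Longrightarrow> hs \<in> tuples V m \<Longrightarrow> multilinear V W n (\<lambda>ks. F (hs @ ks))"
proof (induction m arbitrary: F hs)
  case (Suc m)
  obtain x ks where hs: "hs = x # ks" "x \<in> carrier V" "ks \<in> tuples V m"
    using Suc.prems(2) by (auto simp: tuples_Suc)
  show ?case
    using Suc.IH[of "\<lambda>hs. F (x # hs)" ks] Suc.prems(1) hs by (simp add: multilinear_Suc)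
qed simp

lemma bimultilinearI:
  "(\<And>ys. ys \<in> tuples V n \<Longrightarrow> multilinear V W m (\<lambda>xs. F xs ys)) \<Longrightarrow>
   (\<And>xs. xs \<in> tuples V m \<Longrightarrow> multilinear V W n (F xs)) \<Longrightarrow> bimultilinear V W m n F"
  by (simp add: bimultilinear_def)

lemma bimultilinearD:
  assumes "bimultilinear V W m n F"
  shows "ys \<in> tuples V n \<Longrightarrow> multilinear V W m (\<lambda>xs. F xs ys)"
   and "xs \<in> tuples V m \<Longrightarrow> multilinear V W n (\<lambda>ys. F xs ys)"
   and "xs \<in> tuples V m \<Longrightarrow> ys \<in> tuples V n \<Longrightarrow> F xs ys \<in> carrier W"
  using assms multilinear_carrier unfolding bimultilinear_def by blast+

lemma bimultilinear_append:
  "multilinear V W (m + n) F \<Longrightarrow> bimultilinear V W m n (\<lambda>hs ks. F (hs @ ks))"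
  by (auto simp: bimultilinear_def multilinear_append_left multilinear_append_right)

section \<open>Linear and bilinear maps out of tensor powers\<close>

lemma pure_in_tpow: "is_vspace V \<Longrightarrow> hs \<in> tuples V n \<Longrightarrow> pure V hs \<in> carrier (tpow V n)"
  using multilinear_pure multilinear_carrier by blast

text \<open>Both maps are the lift of the same multilinear map, and lifts are unique.\<close>

lemma lin_map_tpow_eqI:
  assumes W: "is_vspace W" and V: "is_vspace V" and f: "lin_map (tpow V n) W f" and g: "lin_map (tpow V n) W g"
    and eq: "\<And>hs. hs \<in> tuples V n \<Longrightarrow> f (pure V hs) = g (pure V hs)"
    and t: "t \<in> carrier (tpow V n)"
  shows "f t = g t"
proof -
  have m: "multilinear V W n (\<lambda>hs. f (pure V hs))"
    using multilinear_comp[OF multilinear_pure[OF V] f] .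
  show ?thesis
    using tensor_universal(3)[OF W m f _ t] tensor_universal(3)[OF W m g _ t] eq by simp
qed

text \<open>The \<open>THE\<close> inside \<open>tlift\<close> hides how its value depends on the
  lifted map. Fixing one expression of \<open>t\<close> through pure tensors turns it into a finite
  sum of terms linear in \<open>u\<close>.\<close>

lemma lin_map_tlift_param:
  assumes W: "is_vspace W" and U: "is_vspace U"
    and F: "\<And>u. u \<in> carrier U \<Longrightarrow> multilinear V W n (F u)"
    and lin: "\<And>hs. hs \<in> tuples V n \<Longrightarrow> lin_map U W (\<lambda>u. F u hs)"
    and t: "t \<in> carrier (tpow V n)"
  shows "lin_map U W (\<lambda>u. tlift V W n (F u) t)"
proof -
  obtain S c where t: "finite S" "S \<subseteq> tuples V n" "t = (\<Sum>hs\<in>S. tscale (c hs) (pure V hs))"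
    using t unfolding tpow_carrier by blast
  have "lin_map U W (\<lambda>u. \<Sum>hs\<in>S. smult W (c hs) (F u hs))"
    using t(2) by (intro lin_map_sum_maps W lin_map_smult lin) auto
  then show ?thesis unfolding t(3)
    by (subst lin_map_cong[OF U tlift_eq[OF W F t(1,2)]])
qed

text \<open>Common pattern of \<open>tjoin\<close> and \<open>tmul\<close>, which are both a lift
  nested in a lift. \<open>T\<close> repeats that nesting literally, so that unfolding either
  definition matches it.\<close>

lemma tlift_bimultilinear:
  assumes V: "is_vspace V" and W: "is_vspace W" and B: "bimultilinear V W m n B"
  defines "T \<equiv> (\<lambda>t u. tlift V W m (\<lambda>hs. tlift V W n (\<lambda>ks. B hs ks) u) t)"
  shows "bilin (tpow V m) (tpow V n) W T"
    and "hs \<in> tuples V m \<Longrightarrow> ks \<in> tuples V n \<Longrightarrow> T (pure V hs) (pure V ks) = B hs ks"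
proof -
  have in1: "multilinear V W m (\<lambda>hs. tlift V W n (\<lambda>ks. B hs ks) u)" if u: "u \<in> carrier (tpow V n)" for u
    unfolding multilinear_iff_update
  proof (intro conjI ballI allI impI)
    fix hs assume hs: "hs \<in> tuples V m"
    show "tlift V W n (B hs) u \<in> carrier W"
      using lin_mapD(1)[OF tensor_universal(1)[OF W bimultilinearD(2)[OF B hs]] u] .
    fix i assume i: "i < m"
    show "lin_map V W (\<lambda>x. tlift V W n (B (hs[i := x])) u)"
    proof (rule lin_map_tlift_param[OF W V _ _ u])
      show "multilinear V W n (B (hs[i := x]))" if "x \<in> carrier V" for x
        using bimultilinearD(2)[OF B tuples_update[OF hs that]] .
      show "lin_map V W (\<lambda>x. B (hs[i := x]) ks)" if "ks \<in> tuples V n" for ks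
        using bimultilinearD(1)[OF B that] hs i by (simp add: multilinear_iff_update)
    qed
  qed
  have lin2: "lin_map (tpow V n) W (\<lambda>u. tlift V W n (B hs) u)" if "hs \<in> tuples V m" for hs
    using tensor_universal(1)[OF W bimultilinearD(2)[OF B that]] .
  show "bilin (tpow V m) (tpow V n) W T"
  proof (rule bilinI)
    show "lin_map (tpow V m) W (\<lambda>t. T t u)" if "u \<in> carrier (tpow V n)" for u
      unfolding T_def by (rule tensor_universal(1)[OF W in1[OF that]])
    show "lin_map (tpow V n) W (T t)" if "t \<in> carrier (tpow V m)" for t
      unfolding T_def by (rule lin_map_tlift_param[OF W is_vspace_tpow in1 lin2 that])
  qed
  show "T (pure V hs) (pure V ks) = B hs ks" if "hs \<in> tuples V m" "ks \<in> tuples V n"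
    unfolding T_def
    using tensor_universal(2)[OF W in1[OF pure_in_tpow[OF V that(2)]] that(1)]
      tensor_universal(2)[OF W bimultilinearD(2)[OF B that(1)] that(2)] by simp
qed

lemma
  assumes V: "is_vspace V"
  shows bilin_tjoin: "bilin (tpow V m) (tpow V n) (tpow V (m + n)) (tjoin V m n)"
    and tjoin_pure: "hs \<in> tuples V m \<Longrightarrow> ks \<in> tuples V n \<Longrightarrow>
      tjoin V m n (pure V hs) (pure V ks) = pure V (hs @ ks)"
proof -
  have B: "bimultilinear V (tpow V (m + n)) m n (\<lambda>hs ks. pure V (hs @ ks))"
    by (rule bimultilinear_append[OF multilinear_pure[OF V]])
  show "bilin (tpow V m) (tpow V n) (tpow V (m + n)) (tjoin V m n)"
   "hs \<in> tuples V m \<Longrightarrow> ks \<in> tuples V n \<Longrightarrow>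
      tjoin V m n (pure V hs) (pure V ks) = pure V (hs @ ks)"
    using tlift_bimultilinear[OF V is_vspace_tpow B]
    unfolding tjoin_def by auto
qed

section \<open>Sweedler sums\<close>

definition comul_rep :: "('k::field, 'a::ab_group_add) bialg \<Rightarrow> 'a \<Rightarrow> 'a list set \<times> ('a list \<Rightarrow> 'k)" where
  "comul_rep D d = (SOME (S, c). finite S \<and> S \<subseteq> tuples D 2 \<and> comul D d = (\<Sum>p\<in>S. tscale (c p) (pure D p)))"

text \<open>A Sweedler sum computed from a fixed representation of the coproduct. Unlike \<open>sweedler\<close>, it makes
  sense for arbitrary \<open>F\<close>, so that sums may be interchanged without any linearity assumption.\<close>

definition csum ::
  "('k::field, 'a::ab_group_add) bialg \<Rightarrow> ('k, 'b::ab_group_add, 'y) vspace_scheme \<Rightarrow> ('a \<Rightarrow> 'a \<Rightarrow> 'b) \<Rightarrow> 'a \<Rightarrow> 'b"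
  where
  "csum D W F d = (\<Sum>p\<in>fst (comul_rep D d). smult W (snd (comul_rep D d) p) (F (p ! 0) (p ! 1)))"

text \<open>Split off from \<open>is_coalgebra\<close> because sums over the coproduct of H^{(x)N}
  must already be computed while the coassociativity and counit laws of H^{(x)N} are being
  proved.\<close>

definition comul_linear :: "('k::field, 'a::ab_group_add) bialg \<Rightarrow> bool" where
  "comul_linear D \<longleftrightarrow> is_vspace D \<and> lin_map D (tpow D 2) (comul D)"

lemma comul_linear_vspace: "comul_linear D \<Longrightarrow> is_vspace D"
  by (simp add: comul_linear_def)

lemma comul_rep:
  assumes "comul_linear D" "d \<in> carrier D"
  shows "finite (fst (comul_rep D d))" "fst (comul_rep D d) \<subseteq> tuples D 2"
    "comul D d = (\<Sum>p\<in>fst (comul_rep D d). tscale (snd (comul_rep D d) p) (pure D p))"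
proof -
  have "comul D d \<in> carrier (tpow D 2)"
    using assms by (auto simp: comul_linear_def lin_map_def)
  then have "\<exists>S c. finite S \<and> S \<subseteq> tuples D 2 \<and> comul D d = (\<Sum>p\<in>S. tscale (c p) (pure D p))"
    unfolding tpow_carrier .
  then have "\<exists>q. case q of (S, c) \<Rightarrow> finite S \<and> S \<subseteq> tuples D 2 \<and> comul D d = (\<Sum>p\<in>S. tscale (c p) (pure D p))"
    by auto
  from someI_ex[OF this]
  show "finite (fst (comul_rep D d))" "fst (comul_rep D d) \<subseteq> tuples D 2"
    "comul D d = (\<Sum>p\<in>fst (comul_rep D d). tscale (snd (comul_rep D d) p) (pure D p))"
    unfolding comul_rep_def[symmetric] by (auto simp: case_prod_unfold)
qed

lemma comul_rep_nth:
  assumes "comul_linear D" "d \<in> carrier D" "p \<in> fst (comul_rep D d)"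
  shows "p ! 0 \<in> carrier D" "p ! Suc 0 \<in> carrier D"  "p = [p ! 0, p ! Suc 0]"
  using comul_rep(2)[OF assms(1,2)] assms(3) by (auto simp: tuples_2 subset_iff)

lemma csum_cong:
  assumes "comul_linear D" "d \<in> carrier D"
    and "\<And>x y. x \<in> carrier D \<Longrightarrow> y \<in> carrier D \<Longrightarrow> F x y = G x y"
  shows "csum D W F d = csum D W G d"
  unfolding csum_def using comul_rep_nth[OF assms(1,2)] assms(3) by (intro sum.cong) auto

lemma csum_carrier:
  assumes "comul_linear D" "is_vspace W" "d \<in> carrier D"
    and "\<And>x y. x \<in> carrier D \<Longrightarrow> y \<in> carrier D \<Longrightarrow> F x y \<in> carrier W"
  shows "csum D W F d \<in> carrier W"
  unfolding csum_def using comul_rep_nth[OF assms(1,3)] assms(4)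
  by (intro vspace_sum vspace_smult assms(2)) auto

text \<open>The coproduct is a finite combination of pure tensors, through which a linear map may be
  moved. This is how axioms stated for \<open>comul\<close> reach \<open>csum\<close>.\<close>

lemma lin_map_comul:
  assumes D: "comul_linear D" and W: "is_vspace W" and g: "lin_map (tpow D 2) W g" and d: "d \<in> carrier D"
  shows "g (comul D d) = csum D W (\<lambda>x y. g (pure D [x, y])) d"
proof -
  note r = comul_rep[OF D d] and n = comul_rep_nth[OF D d]
  have p: "pure D p \<in> carrier (tpow D 2)" if "p \<in> fst (comul_rep D d)" for p
    using that r(2) by (intro pure_in_tpow comul_linear_vspace D) auto
  have "g (comul D d) = (\<Sum>p\<in>fst (comul_rep D d). smult W (snd (comul_rep D d) p) (g (pure D p)))"
    using lin_map_sum[OF is_vspace_tpow W g r(1), of "pure D" "snd (comul_rep D d)"] p r(3)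
    by (simp add: tpow_def)
  also have "\<dots> = csum D W (\<lambda>x y. g (pure D [x, y])) d"
    unfolding csum_def using n(3) by (intro sum.cong) (auto simp flip: n(3))
  finally show ?thesis .
qed

lemma lin_map_csum:
  assumes D: "comul_linear D" and W: "is_vspace W" and U: "is_vspace U" and g: "lin_map W U g" and d: "d \<in> carrier D"
    and F: "\<And>x y. x \<in> carrier D \<Longrightarrow> y \<in> carrier D \<Longrightarrow> F x y \<in> carrier W"
  shows "g (csum D W F d) = csum D U (\<lambda>x y. g (F x y)) d"
  unfolding csum_def using comul_rep(1)[OF D d] comul_rep_nth[OF D d] F
  by (intro lin_map_sum[OF W U g]) auto

lemma bilin_tlift:
  assumes V: "is_vspace V" and W: "is_vspace W" and F: "bilin V V W F"
  shows "lin_map (tpow V 2) W (tlift V W 2 (\<lambda>xs. F (xs ! 0) (xs ! 1)))"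
    and "x \<in> carrier V \<Longrightarrow> y \<in> carrier V \<Longrightarrow> tlift V W 2 (\<lambda>xs. F (xs ! 0) (xs ! 1)) (pure V [x, y]) = F x y"
  using tensor_universal(1,2)[OF W F[folded multilinear_2_nth]] by (auto simp: tuples_2)

text \<open>The lift of a bilinear \<open>F\<close> to the tensor square is linear, so its value
  does not depend on the representative chosen in \<open>comul_rep\<close>. This is the passage from
  the definitions, written with \<open>sweedler\<close>, to \<open>csum\<close>.\<close>

lemma sweedler_eq_csum:
  assumes D: "comul_linear D" and W: "is_vspace W" and F: "bilin D D W F" and d: "d \<in> carrier D"
  shows "sweedler D W F d = csum D W F d"
proof -
  note B = bilin_tlift[OF comul_linear_vspace[OF D] W F]
  show ?thesis
    unfolding sweedler_def lin_map_comul[OF D W B(1) d] by (rule csum_cong[OF D d]) (rule B(2))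
qed

text \<open>The representatives chosen for different elements are unrelated, so linearity in the
  summed element is invisible in \<open>csum\<close> itself. It is inherited from
  \<open>sweedler\<close>, which explains why \<open>F\<close> has to be bilinear.\<close>

lemma lin_map_csum_arg:
  assumes D: "comul_linear D" and W: "is_vspace W" and F: "bilin D D W F"
  shows "lin_map D W (csum D W F)"
proof -
  have "lin_map D W (sweedler D W F)"
    unfolding sweedler_def
    by (rule lin_map_comp[OF _ bilin_tlift(1)[OF comul_linear_vspace[OF D] W F]])
       (use D in \<open>simp add: comul_linear_def\<close>)
  then show ?thesis
    by (subst (asm) lin_map_cong[OF comul_linear_vspace[OF D] sweedler_eq_csum[OF D W F]])
qed

text \<open>In contrast to \<open>lin_map_csum_arg\<close>, the element \<open>d\<close> is fixed
  and with it the representative of its coproduct, so linearity in an outside parameter is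
  termwise.\<close>

lemma lin_map_csum_param:
  assumes D: "comul_linear D" and W: "is_vspace W" and d: "d \<in> carrier D"
    and F: "\<And>x y. x \<in> carrier D \<Longrightarrow> y \<in> carrier D \<Longrightarrow> lin_map U W (\<lambda>u. F u x y)"
  shows "lin_map U W (\<lambda>u. csum D W (F u) d)"
  unfolding csum_def using comul_rep_nth[OF D d] F by (intro lin_map_sum_maps W lin_map_smult) auto

lemma multilinear_csum_param:
  assumes D: "comul_linear D" and W: "is_vspace W" and d: "d \<in> carrier D"
    and F: "\<And>x y. x \<in> carrier D \<Longrightarrow> y \<in> carrier D \<Longrightarrow> multilinear V W n (\<lambda>hs. F hs x y)"
  shows "multilinear V W n (\<lambda>hs. csum D W (F hs) d)"
  unfolding csum_def using comul_rep_nth[OF D d] F by (intro multilinear_sum_maps W multilinear_smult) auto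

lemma csum_swap:
  assumes W: "is_vspace W"
  shows "csum D W (\<lambda>x y. csum E W (F x y) e) d = csum E W (\<lambda>u v. csum D W (\<lambda>x y. F x y u v) d) e"
  unfolding csum_def smult_laws(5)[OF W] smult_laws(3)[OF W]
  by (subst sum.swap) (simp add: mult.commute)

lemma csum_smult:
  assumes W: "is_vspace W"
  shows "csum D W (\<lambda>x y. smult W k (F x y)) d = smult W k (csum D W F d)"
  unfolding csum_def smult_laws(5)[OF W] smult_laws(3)[OF W] by (simp add: mult.commute)

lemma csum_mult_left: "csum D ground (\<lambda>x y. k * F x y) d = k * csum D ground F d"
  using csum_smult[of ground D k F d] by simp

lemma csum_mult_right: "csum D ground (\<lambda>x y. F x y * k) d = csum D ground F d * k"
  using csum_mult_left[of D k F d] by (simp add: mult.commute)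

section \<open>Coassociativity and counit laws for Sweedler sums\<close>

definition trilin where
  "trilin V W F \<longleftrightarrow> (\<forall>y\<in>carrier V. \<forall>z\<in>carrier V. lin_map V W (\<lambda>x. F x y z)) \<and>
     (\<forall>x\<in>carrier V. \<forall>z\<in>carrier V. lin_map V W (\<lambda>y. F x y z)) \<and>
     (\<forall>x\<in>carrier V. \<forall>y\<in>carrier V. lin_map V W (\<lambda>z. F x y z))"

lemma trilinI:
  assumes "\<And>y z. y \<in> carrier V \<Longrightarrow> z \<in> carrier V \<Longrightarrow> lin_map V W (\<lambda>x. F x y z)"
    "\<And>x z. x \<in> carrier V \<Longrightarrow> z \<in> carrier V \<Longrightarrow> lin_map V W (\<lambda>y. F x y z)"
    "\<And>x y. x \<in> carrier V \<Longrightarrow> y \<in> carrier V \<Longrightarrow> lin_map V W (\<lambda>z. F x y z)"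
  shows "trilin V W F"
  using assms by (simp add: trilin_def)

lemma trilinD:
  assumes "trilin V W F"
  shows "y \<in> carrier V \<Longrightarrow> z \<in> carrier V \<Longrightarrow> lin_map V W (\<lambda>x. F x y z)"
    "x \<in> carrier V \<Longrightarrow> z \<in> carrier V \<Longrightarrow> lin_map V W (\<lambda>y. F x y z)"
    "x \<in> carrier V \<Longrightarrow> y \<in> carrier V \<Longrightarrow> lin_map V W (\<lambda>z. F x y z)"
    "x \<in> carrier V \<Longrightarrow> y \<in> carrier V \<Longrightarrow> z \<in> carrier V \<Longrightarrow> F x y z \<in> carrier W"
  using assms by (auto simp: trilin_def lin_map_def)

lemma trilin_pure: "is_vspace V \<Longrightarrow> trilin V (tpow V 3) (\<lambda>x y z. pure V [x, y, z])"
  using multilinear_pure[of V 3] by (simp add: multilinear_3 trilin_def)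

lemma bilin_pure: "is_vspace V \<Longrightarrow> bilin V V (tpow V 2) (\<lambda>x y. pure V [x, y])"
  using multilinear_pure[of V 2] by (simp add: multilinear_2)

text \<open>For nested sums in which the inner one runs over a component of the outer one: the
  component that is split again varies by \<open>lin_map_csum_arg\<close>, the other one by
  \<open>lin_map_csum_param\<close>.\<close>

lemma bilin_csum_left:
  assumes D: "comul_linear D" and W: "is_vspace W" and F: "trilin D W F"
  shows "bilin D D W (\<lambda>x z. csum D W (\<lambda>u v. F x u v) z)"
proof (intro bilinI)
  note t = trilinD[OF F]
  show "lin_map D W (\<lambda>x. csum D W (F x) y)" if "y \<in> carrier D" for y
    by (rule lin_map_csum_param[OF D W that t(1)])
  show "lin_map D W (\<lambda>z. csum D W (F x) z)" if "x \<in> carrier D" for x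
    by (rule lin_map_csum_arg[OF D W bilinI]) (use t that in auto)
qed

lemma bilin_csum_right:
  assumes D: "comul_linear D" and W: "is_vspace W" and F: "trilin D W F"
  shows "bilin D D W (\<lambda>z y. csum D W (\<lambda>u v. F u v y) z)"
proof (intro bilinI)
  note t = trilinD[OF F]
  show "lin_map D W (\<lambda>y. csum D W (\<lambda>u v. F u v y) z)" if "z \<in> carrier D" for z
    by (rule lin_map_csum_param[OF D W that t(3)])
  show "lin_map D W (\<lambda>z. csum D W (\<lambda>u v. F u v y) z)" if "y \<in> carrier D" for y
    by (rule lin_map_csum_arg[OF D W bilinI]) (use t that in auto)
qed

lemma tjoin_comul:
  assumes D: "comul_linear D" and x: "x \<in> carrier D" "y \<in> carrier D"
  shows "tjoin D 2 1 (comul D x) (pure D [y]) = csum D (tpow D 3) (\<lambda>u v. pure D [u, v, y]) x"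
    and "tjoin D 1 2 (pure D [x]) (comul D y) = csum D (tpow D 3) (\<lambda>u v. pure D [x, u, v]) y"
proof -
  note V = comul_linear_vspace[OF D]
  have y: "pure D [y] \<in> carrier (tpow D 1)" and x': "pure D [x] \<in> carrier (tpow D 1)"
    by (intro pure_in_tpow V; use x in simp)+
  have l1: "lin_map (tpow D 2) (tpow D 3) (\<lambda>t. tjoin D 2 1 t (pure D [y]))"
    using bilinD(1)[OF bilin_tjoin[OF V, of 2 1] y] by simp
  have l2: "lin_map (tpow D 2) (tpow D 3) (\<lambda>t. tjoin D 1 2 (pure D [x]) t)"
    using bilinD(3)[OF bilin_tjoin[OF V, of 1 2] x'] by (simp add: numeral_3_eq_3)
  show "tjoin D 2 1 (comul D x) (pure D [y]) = csum D (tpow D 3) (\<lambda>u v. pure D [u, v, y]) x"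
    unfolding lin_map_comul[OF D is_vspace_tpow l1 x(1)]
    by (rule csum_cong[OF D x(1)]) (use x in \<open>simp add: tjoin_pure[OF V] tuples_2\<close>)
  show "tjoin D 1 2 (pure D [x]) (comul D y) = csum D (tpow D 3) (\<lambda>u v. pure D [x, u, v]) y"
    unfolding lin_map_comul[OF D is_vspace_tpow l2 x(2)]
    by (rule csum_cong[OF D x(2)]) (use x in \<open>simp add: tjoin_pure[OF V] tuples_2\<close>)
qed

lemma bilin_cong:
  assumes "is_vspace V" "is_vspace V'" "\<And>x y. x \<in> carrier V \<Longrightarrow> y \<in> carrier V' \<Longrightarrow> F x y = G x y"
  shows "bilin V V' W F \<longleftrightarrow> bilin V V' W G"
  unfolding bilin_def by (intro conj_cong ball_cong refl lin_map_cong assms)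

text \<open>\<open>is_coalgebra\<close> states coassociativity as an identity in H^{(x)3} written
  with \<open>sweedler\<close> and \<open>tjoin\<close>; these are its two sides in the form used
  for computation.\<close>

lemma sweedler_tjoin:
  assumes D: "comul_linear D" and a: "a \<in> carrier D"
  shows "sweedler D (tpow D 3) (\<lambda>x y. tjoin D 2 1 (comul D x) (pure D [y])) a =
      csum D (tpow D 3) (\<lambda>x y. csum D (tpow D 3) (\<lambda>u v. pure D [u, v, y]) x) a"
    and "sweedler D (tpow D 3) (\<lambda>x y. tjoin D 1 2 (pure D [x]) (comul D y)) a =
      csum D (tpow D 3) (\<lambda>x y. csum D (tpow D 3) (\<lambda>u v. pure D [x, u, v]) y) a"
proof -
  note V = comul_linear_vspace[OF D]
  note b1 = bilin_csum_right[OF D is_vspace_tpow trilin_pure[OF V]]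
  note b2 = bilin_csum_left[OF D is_vspace_tpow trilin_pure[OF V]]
  \<comment> \<open>The integrands agree with sums of pure tensors on the carrier, and bilinearity
    is transported from those.\<close>
  have "bilin D D (tpow D 3) (\<lambda>x y. tjoin D 2 1 (comul D x) (pure D [y]))"
    "bilin D D (tpow D 3) (\<lambda>x y. tjoin D 1 2 (pure D [x]) (comul D y))"
    by (rule iffD2[OF bilin_cong[OF V V tjoin_comul(1)[OF D]] b1] iffD2[OF bilin_cong[OF V V tjoin_comul(2)[OF D]] b2]; assumption)+
  then show "sweedler D (tpow D 3) (\<lambda>x y. tjoin D 2 1 (comul D x) (pure D [y])) a =
      csum D (tpow D 3) (\<lambda>x y. csum D (tpow D 3) (\<lambda>u v. pure D [u, v, y]) x) a"
    "sweedler D (tpow D 3) (\<lambda>x y. tjoin D 1 2 (pure D [x]) (comul D y)) a =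
      csum D (tpow D 3) (\<lambda>x y. csum D (tpow D 3) (\<lambda>u v. pure D [x, u, v]) y) a"
    by (simp_all add: sweedler_eq_csum[OF D is_vspace_tpow _ a] tjoin_comul[OF D]
      del: One_nat_def cong: csum_cong[OF D a])
qed

lemma is_coalgebra_comul_linear: "is_coalgebra D \<Longrightarrow> comul_linear D"
  by (simp add: is_coalgebra_def comul_linear_def)

text \<open>The axiom is the case where \<open>F\<close> is the pure tensor map. A trilinear
  \<open>F\<close> factors through a linear map \<open>T\<close> on H^{(x)3}, and \<open>T\<close>
  is applied to both sides of the axiom.\<close>

lemma csum_coassoc:
  assumes C: "is_coalgebra D" and W: "is_vspace W" and F: "trilin D W F" and a: "a \<in> carrier D"
  shows "csum D W (\<lambda>z y. csum D W (\<lambda>u v. F u v y) z) a = csum D W (\<lambda>x z. csum D W (\<lambda>u v. F x u v) z) a"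
proof -
  note D = is_coalgebra_comul_linear[OF C]
  note V = comul_linear_vspace[OF D]
  define T where "T = tlift D W 3 (\<lambda>xs. F (xs ! 0) (xs ! 1) (xs ! 2))"
  have m: "multilinear D W 3 (\<lambda>xs. F (xs ! 0) (xs ! 1) (xs ! 2))"
    using F by (simp add: multilinear_3 trilin_def)
  have T: "lin_map (tpow D 3) W T"
    using tensor_universal(1)[OF W m] unfolding T_def .
  have Tp: "T (pure D [x, y, z]) = F x y z"
    if "x \<in> carrier D" "y \<in> carrier D" "z \<in> carrier D" for x y z
    using tensor_universal(2)[OF W m] that unfolding T_def by (auto simp: tuples_3)
  note p = trilinD(4)[OF trilin_pure[OF V]]
  have T1: "T (csum D (tpow D 3) (\<lambda>x y. csum D (tpow D 3) (\<lambda>u v. pure D [u, v, y]) x) a) =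
    csum D W (\<lambda>z y. csum D W (\<lambda>u v. F u v y) z) a"
    using a p by (simp add: lin_map_csum[OF D is_vspace_tpow W T] Tp csum_carrier[OF D is_vspace_tpow] cong: csum_cong[OF D])
  have T2: "T (csum D (tpow D 3) (\<lambda>x y. csum D (tpow D 3) (\<lambda>u v. pure D [x, u, v]) y) a) =
    csum D W (\<lambda>x z. csum D W (\<lambda>u v. F x u v) z) a"
    using a p by (simp add: lin_map_csum[OF D is_vspace_tpow W T] Tp csum_carrier[OF D is_vspace_tpow] cong: csum_cong[OF D])
  show ?thesis
    using C a unfolding T1[symmetric] T2[symmetric] sweedler_tjoin[OF D a, symmetric]
    by (simp add: is_coalgebra_def)
qed

lemma bilin_smult:
  "is_vspace W \<Longrightarrow> lin_map V ground e \<Longrightarrow> lin_map V' W f \<Longrightarrow> bilin V V' W (\<lambda>x y. smult W (e x) (f y))"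
  by (intro bilinI lin_map_smult lin_map_smult_left) (auto simp: lin_map_def)

lemma bilin_flip: "bilin V V' W (\<lambda>x y. F y x) \<longleftrightarrow> bilin V' V W F"
  by (auto simp: bilin_def)

text \<open>The axioms are the case where \<open>f\<close> is the identity; the general case applies
  \<open>f\<close> to them.\<close>

lemma csum_counit:
  assumes C: "is_coalgebra D" and W: "is_vspace W" and f: "lin_map D W f" and a: "a \<in> carrier D"
  shows "csum D W (\<lambda>x y. smult W (counit D x) (f y)) a = f a"
    and "csum D W (\<lambda>x y. smult W (counit D y) (f x)) a = f a"
proof -
  note D = is_coalgebra_comul_linear[OF C]
  note V = comul_linear_vspace[OF D]
  have e: "lin_map D ground (counit D)" using C by (simp add: is_coalgebra_def)
  note b1 = bilin_smult[OF V e lin_map_id]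
  have b2: "bilin D D D (\<lambda>x y. smult D (counit D y) x)"
    by (subst bilin_flip) (rule b1)
  have "csum D D (\<lambda>x y. smult D (counit D x) y) a = a" "csum D D (\<lambda>x y. smult D (counit D y) x) a = a"
    using C a sweedler_eq_csum[OF D V b1 a] sweedler_eq_csum[OF D V b2 a] by (auto simp: is_coalgebra_def)
  then have "f (csum D D (\<lambda>x y. smult D (counit D x) y) a) = f a" "f (csum D D (\<lambda>x y. smult D (counit D y) x) a) = f a"
    by auto
  then show "csum D W (\<lambda>x y. smult W (counit D x) (f y)) a = f a"
    "csum D W (\<lambda>x y. smult W (counit D y) (f x)) a = f a"
    by (simp_all add: lin_map_csum[OF D V W f] lin_mapD(3)[OF f] vspace_smult[OF V] a cong: csum_cong[OF D a])
qed

section \<open>Sweedler sums over tuples\<close>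

fun csum_list ::
  "('k::field, 'a::ab_group_add) bialg \<Rightarrow> ('k, 'b::ab_group_add, 'y) vspace_scheme \<Rightarrow>
   ('a list \<Rightarrow> 'a list \<Rightarrow> 'b) \<Rightarrow> 'a list \<Rightarrow> 'b" where
  "csum_list H W F [] = F [] []"
| "csum_list H W F (h # hs) = csum H W (\<lambda>x y. csum_list H W (\<lambda>xs ys. F (x # xs) (y # ys)) hs) h"

lemma csum_list_cong:
  assumes H: "comul_linear H" and hs: "hs \<in> tuples H n"
    and "\<And>xs ys. xs \<in> tuples H n \<Longrightarrow> ys \<in> tuples H n \<Longrightarrow> F xs ys = G xs ys"
  shows "csum_list H W F hs = csum_list H W G hs"
  using hs assms(3)
proof (induction n arbitrary: hs F G)
  case (Suc n)
  then obtain h ks where hs: "hs = h # ks" "h \<in> carrier H" "ks \<in> tuples H n" by (auto simp: tuples_Suc)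
  show ?case
    unfolding hs(1) csum_list.simps by (rule csum_cong[OF H hs(2)]) (rule Suc.IH[OF hs(3)], use Suc.prems in auto)
qed simp

lemma csum_list_carrier:
  assumes H: "comul_linear H" and W: "is_vspace W" and hs: "hs \<in> tuples H n"
    and "\<And>xs ys. xs \<in> tuples H n \<Longrightarrow> ys \<in> tuples H n \<Longrightarrow> F xs ys \<in> carrier W"
  shows "csum_list H W F hs \<in> carrier W"
  using hs assms(4)
proof (induction n arbitrary: hs F)
  case (Suc n)
  then obtain h ks where hs: "hs = h # ks" "h \<in> carrier H" "ks \<in> tuples H n" by (auto simp: tuples_Suc)
  show ?case
    unfolding hs(1) csum_list.simps by (rule csum_carrier[OF H W hs(2)]) (rule Suc.IH[OF hs(3)], use Suc.prems in auto)
qed simp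

lemma lin_map_csum_list:
  assumes H: "comul_linear H" and W: "is_vspace W" and U: "is_vspace U" and g: "lin_map W U g"
    and hs: "hs \<in> tuples H n"
    and "\<And>xs ys. xs \<in> tuples H n \<Longrightarrow> ys \<in> tuples H n \<Longrightarrow> F xs ys \<in> carrier W"
  shows "g (csum_list H W F hs) = csum_list H U (\<lambda>xs ys. g (F xs ys)) hs"
  using hs assms(6)
proof (induction n arbitrary: hs F)
  case (Suc n)
  then obtain h ks where hs: "hs = h # ks" "h \<in> carrier H" "ks \<in> tuples H n" by (auto simp: tuples_Suc)
  have "g (csum_list H W F hs) = csum H U (\<lambda>x y. g (csum_list H W (\<lambda>xs ys. F (x # xs) (y # ys)) ks)) h"
    unfolding hs(1) csum_list.simps
    by (rule lin_map_csum[OF H W U g hs(2)]) (rule csum_list_carrier[OF H W hs(3)], use Suc.prems in auto)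
  also have "\<dots> = csum_list H U (\<lambda>xs ys. g (F xs ys)) hs"
    unfolding hs(1) csum_list.simps by (rule csum_cong[OF H hs(2)]) (rule Suc.IH[OF hs(3)], use Suc.prems in auto)
  finally show ?case .
qed simp

lemma lin_map_csum_list_param:
  assumes H: "comul_linear H" and W: "is_vspace W" and hs: "hs \<in> tuples H n"
    and "\<And>xs ys. xs \<in> tuples H n \<Longrightarrow> ys \<in> tuples H n \<Longrightarrow> lin_map U W (\<lambda>u. F u xs ys)"
  shows "lin_map U W (\<lambda>u. csum_list H W (F u) hs)"
  using hs assms(4)
proof (induction n arbitrary: hs F)
  case (Suc n)
  then obtain h ks where hs: "hs = h # ks" "h \<in> carrier H" "ks \<in> tuples H n" by (auto simp: tuples_Suc)
  show ?case
    unfolding hs(1) csum_list.simps by (rule lin_map_csum_param[OF H W hs(2)]) (rule Suc.IH[OF hs(3)], use Suc.prems in auto)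
qed simp

lemma bimultilinear_Suc:
  assumes "bimultilinear V W (Suc m) (Suc n) F"
  shows "x \<in> carrier V \<Longrightarrow> y \<in> carrier V \<Longrightarrow> bimultilinear V W m n (\<lambda>xs ys. F (x # xs) (y # ys))"
    and "xs \<in> tuples V m \<Longrightarrow> ys \<in> tuples V n \<Longrightarrow> bilin V V W (\<lambda>x y. F (x # xs) (y # ys))"
  using bimultilinearD(1,2)[OF assms] by (auto simp: multilinear_Suc bimultilinear_def bilin_def)

lemma bilin_csum_list:
  assumes H: "comul_linear H" and W: "is_vspace W" and hs: "hs \<in> tuples H n"
    and F: "bimultilinear H W (Suc n) (Suc n) F"
  shows "bilin H H W (\<lambda>x y. csum_list H W (\<lambda>xs ys. F (x # xs) (y # ys)) hs)"
  by (intro bilinI lin_map_csum_list_param[OF H W hs]) (use bilinD[OF bimultilinear_Suc(2)[OF F]] in auto)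

text \<open>The coproduct of a tensor power is a lift, for which this multilinearity is needed. The
  head varies by \<open>lin_map_csum_arg\<close>; for the tail, the sum over the head is a fixed
  finite sum.\<close>

lemma multilinear_csum_list:
  assumes H: "comul_linear H" and W: "is_vspace W" and F: "bimultilinear H W n n F"
  shows "multilinear H W n (csum_list H W F)"
  using F
proof (induction n arbitrary: F)
  case 0
  then show ?case by (auto simp: bimultilinear_def)
next
  case (Suc n)
  show ?case
    unfolding multilinear_Suc csum_list.simps
  proof (intro conjI ballI)
    show "lin_map H W (csum H W (\<lambda>x y. csum_list H W (\<lambda>xs ys. F (x # xs) (y # ys)) hs))" if "hs \<in> tuples H n" for hs
      by (rule lin_map_csum_arg[OF H W bilin_csum_list[OF H W that Suc.prems]])
    show "multilinear H W n (\<lambda>hs. csum H W (\<lambda>x y. csum_list H W (\<lambda>xs ys. F (x # xs) (y # ys)) hs) h)" if "h \<in> carrier H" for h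
      by (rule multilinear_csum_param[OF H W that]) (rule Suc.IH, rule bimultilinear_Suc[OF Suc.prems])
  qed
qed

lemma sweedler_list_eq_csum_list:
  assumes H: "comul_linear H" and W: "is_vspace W" and F: "bimultilinear H W n n F" and hs: "hs \<in> tuples H n"
  shows "sweedler_list H W F hs = csum_list H W F hs"
  using F hs
proof (induction n arbitrary: F hs)
  case (Suc n)
  then obtain h ks where hs: "hs = h # ks" "h \<in> carrier H" "ks \<in> tuples H n" by (auto simp: tuples_Suc)
  have eq: "sweedler_list H W (\<lambda>xs ys. F (x # xs) (y # ys)) ks = csum_list H W (\<lambda>xs ys. F (x # xs) (y # ys)) ks"
    if "x \<in> carrier H" "y \<in> carrier H" for x y
    by (rule Suc.IH[OF bimultilinear_Suc(1)[OF Suc.prems(1) that] hs(3)])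
  have "bilin H H W (\<lambda>x y. sweedler_list H W (\<lambda>xs ys. F (x # xs) (y # ys)) ks)"
    by (rule iffD2[OF bilin_cong[OF comul_linear_vspace[OF H] comul_linear_vspace[OF H] eq]
          bilin_csum_list[OF H W hs(3) Suc.prems(1)]])
  from sweedler_eq_csum[OF H W this hs(2)] show ?case
    unfolding hs(1) by (simp add: eq cong: csum_cong[OF H hs(2)])
qed simp

text \<open>Moving the sum of one element past those of a tuple is what separates head and tail in
  the proof of \<open>csum_list_coassoc\<close>.\<close>

lemma csum_list_csum_swap:
  assumes W: "is_vspace W"
  shows "csum_list H W (\<lambda>xs ys. csum E W (F xs ys) e) hs = csum E W (\<lambda>u v. csum_list H W (\<lambda>xs ys. F xs ys u v) hs) e"
proof (induction hs arbitrary: F)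
  case (Cons h hs)
  show ?case by (simp add: Cons) (rule csum_swap[OF W])
qed simp

lemma csum_list_append:
  "csum_list H W F (hs @ ks) = csum_list H W (\<lambda>xs ys. csum_list H W (\<lambda>us vs. F (xs @ us) (ys @ vs)) ks) hs"
  by (induction hs arbitrary: F) simp_all

lemma csum_list_mult_left: "csum_list H ground (\<lambda>xs ys. k * F xs ys) hs = k * csum_list H ground F hs"
  by (induction hs arbitrary: F) (simp_all add: csum_mult_left)

lemma csum_list_mult_right: "csum_list H ground (\<lambda>xs ys. F xs ys * k) hs = csum_list H ground F hs * k"
  using csum_list_mult_left[of H k F hs] by (simp add: mult.commute)

definition trimultilinear where
  "trimultilinear V W n F \<longleftrightarrow>
     (\<forall>ys\<in>tuples V n. \<forall>zs\<in>tuples V n. multilinear V W n (\<lambda>xs. F xs ys zs)) \<and>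
     (\<forall>xs\<in>tuples V n. \<forall>zs\<in>tuples V n. multilinear V W n (\<lambda>ys. F xs ys zs)) \<and>
     (\<forall>xs\<in>tuples V n. \<forall>ys\<in>tuples V n. multilinear V W n (\<lambda>zs. F xs ys zs))"

lemma trimultilinear_Suc:
  assumes "trimultilinear V W (Suc n) F"
  shows "x \<in> carrier V \<Longrightarrow> y \<in> carrier V \<Longrightarrow> z \<in> carrier V \<Longrightarrow>
      trimultilinear V W n (\<lambda>xs ys zs. F (x # xs) (y # ys) (z # zs))"
    and "xs \<in> tuples V n \<Longrightarrow> ys \<in> tuples V n \<Longrightarrow> zs \<in> tuples V n \<Longrightarrow>
      trilin V W (\<lambda>x y z. F (x # xs) (y # ys) (z # zs))"
  using assms by (auto simp: multilinear_Suc trimultilinear_def trilin_def)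

text \<open>Both sums of the head are moved outside those of the tail. Then coassociativity in
  \<open>H\<close> rearranges the head around the trilinear \<open>G\<close>, and the induction
  hypothesis rearranges the tail inside, replacing \<open>G\<close> by \<open>G'\<close>.\<close>

lemma csum_list_coassoc:
  assumes C: "is_coalgebra H" and W: "is_vspace W" and F: "trimultilinear H W n F" and hs: "hs \<in> tuples H n"
  shows "csum_list H W (\<lambda>zs vs. csum_list H W (\<lambda>xs us. F xs us vs) zs) hs = csum_list H W (\<lambda>xs zs. csum_list H W (\<lambda>us vs. F xs us vs) zs) hs"
  using F hs
proof (induction n arbitrary: F hs)
  case (Suc n)
  note H = is_coalgebra_comul_linear[OF C]
  obtain h ks where hs: "hs = h # ks" "h \<in> carrier H" "ks \<in> tuples H n"
    using Suc.prems(2) by (auto simp: tuples_Suc)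
  define G where "G x u v = csum_list H W (\<lambda>zs vs. csum_list H W (\<lambda>xs us. F (x # xs) (u # us) (v # vs)) zs) ks" for x u v
  define G' where "G' x u v = csum_list H W (\<lambda>xs zs. csum_list H W (\<lambda>us vs. F (x # xs) (u # us) (v # vs)) zs) ks" for x u v
  have G: "trilin H W G"
    unfolding G_def by (intro trilinI lin_map_csum_list_param[OF H W]) (use hs trilinD[OF trimultilinear_Suc(2)[OF Suc.prems(1)]] in auto)
  have GG: "G x u v = G' x u v" if "x \<in> carrier H" "u \<in> carrier H" "v \<in> carrier H" for x u v
    unfolding G_def G'_def by (rule Suc.IH[OF trimultilinear_Suc(1)[OF Suc.prems(1) that] hs(3)])
  have "csum_list H W (\<lambda>zs vs. csum_list H W (\<lambda>xs us. F xs us vs) zs) hs = csum H W (\<lambda>z v. csum H W (\<lambda>x u. G x u v) z) h"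
    by (simp add: hs(1) G_def csum_list_csum_swap[OF W])
  also have "\<dots> = csum H W (\<lambda>x z. csum H W (\<lambda>u v. G x u v) z) h"
    by (rule csum_coassoc[OF C W G hs(2)])
  also have "\<dots> = csum H W (\<lambda>x z. csum H W (\<lambda>u v. G' x u v) z) h"
    by (intro csum_cong[OF H] hs GG)
  also have "\<dots> = csum_list H W (\<lambda>xs zs. csum_list H W (\<lambda>us vs. F xs us vs) zs) hs"
    by (simp add: hs(1) G'_def csum_list_csum_swap[OF W])
  finally show ?case .
qed simp

definition counits :: "('k::field, 'a::ab_group_add) bialg \<Rightarrow> 'a list \<Rightarrow> 'k" where
  "counits H hs = (\<Prod>h\<leftarrow>hs. counit H h)"

lemma counits_simps [simp]:
  "counits H [] = 1" "counits H (h # hs) = counit H h * counits H hs"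
  "counits H (hs @ ks) = counits H hs * counits H ks"
  by (simp_all add: counits_def)

lemma multilinear_counits: "is_coalgebra H \<Longrightarrow> multilinear H ground n (counits H)"
  by (induction n) (auto simp: multilinear_Suc is_coalgebra_def intro!: lin_map_mult_right multilinear_mult_left)

lemma csum_list_smult:
  assumes W: "is_vspace W"
  shows "csum_list H W (\<lambda>xs ys. smult W k (F xs ys)) hs = smult W k (csum_list H W F hs)"
  by (induction hs arbitrary: F) (simp_all add: csum_smult[OF W])

text \<open>One induction serves both laws: the counit of the head is pulled out of the tail sum,
  the tail collapses by induction and the head by \<open>csum_counit\<close>.\<close>

lemma csum_list_counits:
  assumes C: "is_coalgebra H" and W: "is_vspace W" and f: "multilinear H W n f" and hs: "hs \<in> tuples H n"
  shows "csum_list H W (\<lambda>xs ys. smult W (counits H xs) (f ys)) hs = f hs"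
    and "csum_list H W (\<lambda>xs ys. smult W (counits H ys) (f xs)) hs = f hs"
proof -
  note H = is_coalgebra_comul_linear[OF C]
  have "csum_list H W (\<lambda>xs ys. smult W (counits H xs) (f ys)) hs = f hs \<and>
      csum_list H W (\<lambda>xs ys. smult W (counits H ys) (f xs)) hs = f hs"
    using f hs
  proof (induction n arbitrary: f hs)
    case 0
    then show ?case by (simp add: smult_laws[OF W])
  next
    case (Suc n)
    obtain h ks where hs: "hs = h # ks" "h \<in> carrier H" "ks \<in> tuples H n"
      using Suc.prems(2) by (auto simp: tuples_Suc)
    have f: "lin_map H W (\<lambda>x. f (x # ks))" using Suc.prems hs by (simp add: multilinear_Suc)
    have IH: "csum_list H W (\<lambda>xs ys. smult W (counits H xs) (f (x # ys))) ks = f (x # ks)"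
       "csum_list H W (\<lambda>xs ys. smult W (counits H ys) (f (x # xs))) ks = f (x # ks)" if "x \<in> carrier H" for x
      using Suc.IH[of "\<lambda>ys. f (x # ys)"] Suc.prems hs that by (auto simp: multilinear_Suc)
    have "csum_list H W (\<lambda>xs ys. smult W (counits H xs) (f ys)) hs
        = csum H W (\<lambda>x y. smult W (counit H x) (csum_list H W (\<lambda>xs ys. smult W (counits H xs) (f (y # ys))) ks)) h"
      by (simp add: hs(1) smult_laws(3)[OF W, symmetric] csum_list_smult[OF W])
    also have "\<dots> = f (h # ks)"
      using csum_counit(1)[OF C W f hs(2)] by (simp add: IH hs(2) cong: csum_cong[OF H hs(2)])
    finally have 1: "csum_list H W (\<lambda>xs ys. smult W (counits H xs) (f ys)) hs = f (h # ks)" .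
    have "csum_list H W (\<lambda>xs ys. smult W (counits H ys) (f xs)) hs
        = csum H W (\<lambda>x y. smult W (counit H y) (csum_list H W (\<lambda>xs ys. smult W (counits H ys) (f (x # xs))) ks)) h"
      by (simp add: hs(1) smult_laws(3)[OF W, symmetric] csum_list_smult[OF W])
    also have "\<dots> = f (h # ks)"
      using csum_counit(2)[OF C W f hs(2)] by (simp add: IH hs(2) cong: csum_cong[OF H hs(2)])
    finally show ?case using 1 hs by simp
  qed
  then show "csum_list H W (\<lambda>xs ys. smult W (counits H xs) (f ys)) hs = f hs"
    "csum_list H W (\<lambda>xs ys. smult W (counits H ys) (f xs)) hs = f hs" by auto
qed

text \<open>\<open>tpow_bialg H N\<close> and \<open>tpow H N\<close> are different records with the
  same carrier and scalars. The notions listed read only these two fields, so all of them are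
  normalised to \<open>tpow H N\<close>.\<close>

lemma tpow_bialg_vspace [simp]:
  "carrier (tpow_bialg H N) = carrier (tpow H N)" "smult (tpow_bialg H N) = smult (tpow H N)"
  "lin_map (tpow_bialg H N) = lin_map (tpow H N)"
  "lin_map V (tpow_bialg H N) = lin_map V (tpow H N)"
  "tuples (tpow_bialg H N) = tuples (tpow H N)"
  "multilinear (tpow_bialg H N) = multilinear (tpow H N)"
  "pure (tpow_bialg H N) = pure (tpow H N)"
  "tpow (tpow_bialg H N) = tpow (tpow H N)"
  "tlift (tpow_bialg H N) = tlift (tpow H N)"
  "csum E (tpow_bialg H N) = csum E (tpow H N)"
  "bilin (tpow_bialg H N) = bilin (tpow H N)"
  "bilin V (tpow_bialg H N) = bilin V (tpow H N)"
  "bilin V V' (tpow_bialg H N) = bilin V V' (tpow H N)"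
  "is_vspace (tpow_bialg H N)"
  using is_vspace_tpow[of H N]
  by (simp_all add: fun_eq_iff tpow_bialg_def lin_map_def tuples_def multilinear_def pure_def tpow_def tlift_def
      csum_def bilin_def is_vspace_def)

section \<open>Tensor powers of a coalgebra\<close>

text \<open>The integrand in the definition of the coproduct of H^{(x)N}; its multilinearity makes
  the universal property applicable to that definition.\<close>

lemma bimultilinear_pure_pure:
  assumes V: "is_vspace V"
  shows "bimultilinear V (tpow (tpow V N) 2) N N (\<lambda>xs ys. pure (tpow V N) [pure V xs, pure V ys])"
proof (rule bimultilinearI)
  note b = bilin_pure[OF is_vspace_tpow[of V N]]
  note m = multilinear_pure[OF V]
  show "multilinear V (tpow (tpow V N) 2) N (\<lambda>xs. pure (tpow V N) [pure V xs, pure V ys])" if "ys \<in> tuples V N" for ys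
    by (rule multilinear_comp[OF m bilinD(1)[OF b]]) (rule pure_in_tpow[OF V that])
  show "multilinear V (tpow (tpow V N) 2) N (\<lambda>ys. pure (tpow V N) [pure V xs, pure V ys])" if "xs \<in> tuples V N" for xs
    by (rule multilinear_comp[OF m bilinD(3)[OF b]]) (rule pure_in_tpow[OF V that])
qed

lemma
  assumes H: "comul_linear H"
  shows comul_linear_tpow: "comul_linear (tpow_bialg H N)"
    and comul_tpow_pure: "hs \<in> tuples H N \<Longrightarrow> comul (tpow_bialg H N) (pure H hs) =
      csum_list H (tpow (tpow H N) 2) (\<lambda>xs ys. pure (tpow H N) [pure H xs, pure H ys]) hs"
proof -
  note V = comul_linear_vspace[OF H]
  note B = bimultilinear_pure_pure[OF V, of N]
  have eq: "sweedler_list H (tpow (tpow H N) 2) (\<lambda>xs ys. pure (tpow H N) [pure H xs, pure H ys]) hs =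
    csum_list H (tpow (tpow H N) 2) (\<lambda>xs ys. pure (tpow H N) [pure H xs, pure H ys]) hs" if "hs \<in> tuples H N" for hs
    by (rule sweedler_list_eq_csum_list[OF H is_vspace_tpow B that])
  have m: "multilinear H (tpow (tpow H N) 2) N (sweedler_list H (tpow (tpow H N) 2) (\<lambda>xs ys. pure (tpow H N) [pure H xs, pure H ys]))"
    by (rule iffD2[OF multilinear_cong[OF V eq] multilinear_csum_list[OF H is_vspace_tpow B]])
  have c: "comul (tpow_bialg H N) = tlift H (tpow (tpow H N) 2) N
        (sweedler_list H (tpow (tpow H N) 2) (\<lambda>xs ys. pure (tpow H N) [pure H xs, pure H ys]))"
    by (simp add: tpow_bialg_def)
  show "comul_linear (tpow_bialg H N)"
    using tensor_universal(1)[OF is_vspace_tpow m] by (simp add: comul_linear_def c)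
  show "comul (tpow_bialg H N) (pure H hs) =
      csum_list H (tpow (tpow H N) 2) (\<lambda>xs ys. pure (tpow H N) [pure H xs, pure H ys]) hs" if "hs \<in> tuples H N"
    unfolding c tensor_universal(2)[OF is_vspace_tpow m that] by (rule eq[OF that])
qed

text \<open>The representative chosen for the coproduct of \<open>pure H hs\<close> need not be the
  one built from representatives of the entries. The detour through \<open>sweedler\<close>, which
  does not depend on the choice, exchanges one for the other.\<close>

lemma csum_tpow_pure:
  assumes H: "comul_linear H" and W: "is_vspace W" and F: "bilin (tpow H N) (tpow H N) W F" and hs: "hs \<in> tuples H N"
  shows "csum (tpow_bialg H N) W F (pure H hs) = csum_list H W (\<lambda>xs ys. F (pure H xs) (pure H ys)) hs"
proof -
  note V = comul_linear_vspace[OF H]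
  note p = pure_in_tpow[OF V hs]
  note P = bilin_tlift[OF is_vspace_tpow W F]
  have "csum (tpow_bialg H N) W F (pure H hs) = sweedler (tpow_bialg H N) W F (pure H hs)"
    by (rule sweedler_eq_csum[OF comul_linear_tpow[OF H] W, symmetric]) (use F p in auto)
  also have "\<dots> = csum_list H W (\<lambda>xs ys. tlift (tpow H N) W 2 (\<lambda>xs. F (xs ! 0) (xs ! 1)) (pure (tpow H N) [pure H xs, pure H ys])) hs"
    unfolding sweedler_def comul_tpow_pure[OF H hs] tpow_bialg_vspace
    by (rule lin_map_csum_list[OF H is_vspace_tpow W P(1) hs])
       (auto intro!: pure_in_tpow is_vspace_tpow V simp: tuples_2)
  also have "\<dots> = csum_list H W (\<lambda>xs ys. F (pure H xs) (pure H ys)) hs"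
    by (rule csum_list_cong[OF H hs]) (intro P(2) pure_in_tpow V)
  finally show ?thesis .
qed

lemma trilin_pure_trimultilinear:
  assumes V: "is_vspace V" and F: "trilin (tpow V n) W F"
  shows "trimultilinear V W n (\<lambda>xs ys zs. F (pure V xs) (pure V ys) (pure V zs))"
  unfolding trimultilinear_def
  by (intro conjI ballI multilinear_comp[OF multilinear_pure[OF V]] trilinD[OF F] pure_in_tpow[OF V])

lemma tpow_bialg_trilin [simp]: "trilin (tpow_bialg H N) W F \<longleftrightarrow> trilin (tpow H N) W F"
  by (simp add: trilin_def)

lemma
  assumes H: "comul_linear H" and W: "is_vspace W" and F: "trilin (tpow H N) W F" and hs: "hs \<in> tuples H N"
  shows csum_tpow_pure_left: "csum (tpow_bialg H N) W (\<lambda>x z. csum (tpow_bialg H N) W (\<lambda>u v. F x u v) z) (pure H hs) =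
      csum_list H W (\<lambda>xs zs. csum_list H W (\<lambda>us vs. F (pure H xs) (pure H us) (pure H vs)) zs) hs"
    and csum_tpow_pure_right: "csum (tpow_bialg H N) W (\<lambda>z y. csum (tpow_bialg H N) W (\<lambda>u v. F u v y) z) (pure H hs) =
      csum_list H W (\<lambda>zs ys. csum_list H W (\<lambda>us vs. F (pure H us) (pure H vs) (pure H ys)) zs) hs"
proof -
  note D = comul_linear_tpow[OF H, of N]
  note V = comul_linear_vspace[OF H]
  note t = trilinD[OF F]
  have F': "trilin (tpow_bialg H N) W F" using F by simp
  have "csum (tpow_bialg H N) W (\<lambda>x z. csum (tpow_bialg H N) W (\<lambda>u v. F x u v) z) (pure H hs) =
    csum_list H W (\<lambda>xs zs. csum (tpow_bialg H N) W (\<lambda>u v. F (pure H xs) u v) (pure H zs)) hs"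
    by (rule csum_tpow_pure[OF H W _ hs]) (use bilin_csum_left[OF D W F'] in simp)
  also have "\<dots> = csum_list H W (\<lambda>xs zs. csum_list H W (\<lambda>us vs. F (pure H xs) (pure H us) (pure H vs)) zs) hs"
    by (intro csum_list_cong[OF H hs] csum_tpow_pure[OF H W] bilinI t pure_in_tpow[OF V])
  finally show "csum (tpow_bialg H N) W (\<lambda>x z. csum (tpow_bialg H N) W (\<lambda>u v. F x u v) z) (pure H hs) =
      csum_list H W (\<lambda>xs zs. csum_list H W (\<lambda>us vs. F (pure H xs) (pure H us) (pure H vs)) zs) hs" .
  have "csum (tpow_bialg H N) W (\<lambda>z y. csum (tpow_bialg H N) W (\<lambda>u v. F u v y) z) (pure H hs) =
    csum_list H W (\<lambda>zs ys. csum (tpow_bialg H N) W (\<lambda>u v. F u v (pure H ys)) (pure H zs)) hs"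
    by (rule csum_tpow_pure[OF H W _ hs]) (use bilin_csum_right[OF D W F'] in simp)
  also have "\<dots> = csum_list H W (\<lambda>zs ys. csum_list H W (\<lambda>us vs. F (pure H us) (pure H vs) (pure H ys)) zs) hs"
    by (intro csum_list_cong[OF H hs] csum_tpow_pure[OF H W] bilinI t pure_in_tpow[OF V])
  finally show "csum (tpow_bialg H N) W (\<lambda>z y. csum (tpow_bialg H N) W (\<lambda>u v. F u v y) z) (pure H hs) =
      csum_list H W (\<lambda>zs ys. csum_list H W (\<lambda>us vs. F (pure H us) (pure H vs) (pure H ys)) zs) hs" .
qed

lemma
  assumes C: "is_coalgebra H"
  shows lin_map_counit_tpow: "lin_map (tpow H N) ground (counit (tpow_bialg H N))"
    and counit_tpow_pure: "hs \<in> tuples H N \<Longrightarrow> counit (tpow_bialg H N) (pure H hs) = counits H hs"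
  using tensor_universal(1,2)[OF is_vspace_ground multilinear_counits[OF C, of N]]
  by (simp_all add: tpow_bialg_def counits_def[abs_def])

text \<open>Each law compares two linear maps, so pure tensors suffice, and there it becomes the
  corresponding law for tuples.\<close>

theorem is_coalgebra_tpow:
  assumes C: "is_coalgebra H"
  shows "is_coalgebra (tpow_bialg H N)"
proof -
  note H = is_coalgebra_comul_linear[OF C]
  note V = comul_linear_vspace[OF H]
  note D = comul_linear_tpow[OF H, of N]
  let ?D = "tpow_bialg H N" and ?V = "tpow H N"
  let ?W = "tpow ?V 3"
  have t: "trilin ?D ?W (\<lambda>x y z. pure ?V [x, y, z])" and t': "trilin ?V ?W (\<lambda>x y z. pure ?V [x, y, z])"
    using trilin_pure[OF is_vspace_tpow[of H N]] by auto
  note e = lin_map_counit_tpow[OF C, of N]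
  have coassoc: "csum ?D ?W (\<lambda>z y. csum ?D ?W (\<lambda>u v. pure ?V [u, v, y]) z) a =
      csum ?D ?W (\<lambda>x z. csum ?D ?W (\<lambda>u v. pure ?V [x, u, v]) z) a" if "a \<in> carrier ?V" for a
  proof (rule lin_map_tpow_eqI[OF is_vspace_tpow[of ?V 3] V _ _ _ that])
    show "lin_map ?V ?W (csum ?D ?W (\<lambda>z y. csum ?D ?W (\<lambda>u v. pure ?V [u, v, y]) z))"
      using lin_map_csum_arg[OF D is_vspace_tpow bilin_csum_right[OF D is_vspace_tpow t]] by simp
    show "lin_map ?V ?W (csum ?D ?W (\<lambda>x z. csum ?D ?W (\<lambda>u v. pure ?V [x, u, v]) z))"
      using lin_map_csum_arg[OF D is_vspace_tpow bilin_csum_left[OF D is_vspace_tpow t]] by simp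
    show "csum ?D ?W (\<lambda>z y. csum ?D ?W (\<lambda>u v. pure ?V [u, v, y]) z) (pure H hs) =
      csum ?D ?W (\<lambda>x z. csum ?D ?W (\<lambda>u v. pure ?V [x, u, v]) z) (pure H hs)" if "hs \<in> tuples H N" for hs
      unfolding csum_tpow_pure_left[OF H is_vspace_tpow t' that] csum_tpow_pure_right[OF H is_vspace_tpow t' that]
      by (rule csum_list_coassoc[OF C is_vspace_tpow trilin_pure_trimultilinear[OF V t'] that])
  qed
  have b1: "bilin ?V ?V ?V (\<lambda>x y. smult ?V (counit ?D x) y)"
    by (rule bilin_smult[OF is_vspace_tpow e lin_map_id])
  then have b2: "bilin ?V ?V ?V (\<lambda>x y. smult ?V (counit ?D y) x)"
    by (subst bilin_flip)
  note m = multilinear_pure[OF V, of N]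
  have u1: "csum ?D ?V (\<lambda>x y. smult ?V (counit ?D x) y) a = a" if "a \<in> carrier ?V" for a
  proof (rule lin_map_tpow_eqI[OF is_vspace_tpow[of H N] V _ lin_map_id _ that])
    show "lin_map ?V ?V (csum ?D ?V (\<lambda>x y. smult ?V (counit ?D x) y))"
      using lin_map_csum_arg[OF D is_vspace_tpow] b1 by simp
    show "csum ?D ?V (\<lambda>x y. smult ?V (counit ?D x) y) (pure H hs) = pure H hs" if "hs \<in> tuples H N" for hs
      unfolding csum_tpow_pure[OF H is_vspace_tpow b1 that]
      using csum_list_counits(1)[OF C is_vspace_tpow m that] by (simp add: counit_tpow_pure[OF C] cong: csum_list_cong[OF H that])
  qed
  have u2: "csum ?D ?V (\<lambda>x y. smult ?V (counit ?D y) x) a = a" if "a \<in> carrier ?V" for a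
  proof (rule lin_map_tpow_eqI[OF is_vspace_tpow[of H N] V _ lin_map_id _ that])
    show "lin_map ?V ?V (csum ?D ?V (\<lambda>x y. smult ?V (counit ?D y) x))"
      using lin_map_csum_arg[OF D is_vspace_tpow] b2 by simp
    show "csum ?D ?V (\<lambda>x y. smult ?V (counit ?D y) x) (pure H hs) = pure H hs" if "hs \<in> tuples H N" for hs
      unfolding csum_tpow_pure[OF H is_vspace_tpow b2 that]
      using csum_list_counits(2)[OF C is_vspace_tpow m that] by (simp add: counit_tpow_pure[OF C] cong: csum_list_cong[OF H that])
  qed
  have "sweedler ?D ?D (\<lambda>x y. smult ?D (counit ?D x) y) a = a" "sweedler ?D ?D (\<lambda>x y. smult ?D (counit ?D y) x) a = a"
    if "a \<in> carrier ?D" for a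
    using sweedler_eq_csum[OF D, of ?D _ a] b1 b2 u1 u2 that by simp_all
  moreover have "sweedler ?D (tpow ?D 3) (\<lambda>x y. tjoin ?D 2 1 (comul ?D x) (pure ?D [y])) a =
        sweedler ?D (tpow ?D 3) (\<lambda>x y. tjoin ?D 1 2 (pure ?D [x]) (comul ?D y)) a" if "a \<in> carrier ?D" for a
    unfolding sweedler_tjoin[OF D that] using coassoc that by simp
  ultimately show ?thesis
    unfolding is_coalgebra_def using D e by (simp add: comul_linear_def del: One_nat_def)
qed

section \<open>The convolution algebra\<close>

lemma lin_map_counit: "is_coalgebra D \<Longrightarrow> lin_map D ground (counit D)"
  by (simp add: is_coalgebra_def)

lemma bilin_mult:
  "lin_map V ground f \<Longrightarrow> lin_map V' ground g \<Longrightarrow> bilin V V' ground (\<lambda>x y. f x * g y)"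
  using bilin_smult[of ground V f V' g] by simp

lemma conv_eq_csum:
  assumes D: "comul_linear D" and "lin_map D ground f" "lin_map D ground g" "d \<in> carrier D"
  shows "conv D f g d = csum D ground (\<lambda>x y. f x * g y) d"
  unfolding conv_def using assms by (intro sweedler_eq_csum bilin_mult) auto

lemma lin_map_conv:
  assumes D: "comul_linear D" and f: "lin_map D ground f" and g: "lin_map D ground g"
  shows "lin_map D ground (conv D f g)"
  by (rule iffD2[OF lin_map_cong[OF comul_linear_vspace[OF D] conv_eq_csum[OF D f g]]
        lin_map_csum_arg[OF D is_vspace_ground bilin_mult[OF f g]]])

lemma conv_cong:
  assumes D: "comul_linear D" and f: "lin_map D ground f" and g: "lin_map D ground g"
    and "\<And>x. x \<in> carrier D \<Longrightarrow> f x = f' x" "\<And>x. x \<in> carrier D \<Longrightarrow> g x = g' x"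
    and d: "d \<in> carrier D"
  shows "conv D f g d = conv D f' g' d"
proof -
  note V = comul_linear_vspace[OF D]
  have f': "lin_map D ground f'" and g': "lin_map D ground g'"
    using f g lin_map_cong[OF V, of f f'] lin_map_cong[OF V, of g g'] assms(4,5) by auto
  show ?thesis
    unfolding conv_eq_csum[OF D f g d] conv_eq_csum[OF D f' g' d] using assms(4,5) by (intro csum_cong[OF D d]) auto
qed

text \<open>Coassociativity for the trilinear form f(x) g(y) h(z).\<close>

lemma conv_assoc:
  assumes C: "is_coalgebra D" and f: "lin_map D ground f" and g: "lin_map D ground g" and h: "lin_map D ground h"
    and d: "d \<in> carrier D"
  shows "conv D (conv D f g) h d = conv D f (conv D g h) d"
proof -
  note D = is_coalgebra_comul_linear[OF C]
  have t: "trilin D ground (\<lambda>x y z. f x * g y * h z)"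
    by (intro trilinI lin_map_mult_left lin_map_mult_right f g h)
  have "conv D (conv D f g) h d = csum D ground (\<lambda>z y. csum D ground (\<lambda>u v. f u * g v * h y) z) d"
    using lin_map_conv[OF D f g] h d
    by (simp add: conv_eq_csum[OF D] f g csum_mult_right cong: csum_cong[OF D])
  also have "\<dots> = csum D ground (\<lambda>x z. csum D ground (\<lambda>u v. f x * g u * h v) z) d"
    by (rule csum_coassoc[OF C is_vspace_ground t d])
  also have "\<dots> = csum D ground (\<lambda>x z. f x * csum D ground (\<lambda>u v. g u * h v) z) d"
    by (simp add: mult.assoc flip: csum_mult_left)
  also have "\<dots> = conv D f (conv D g h) d"
    using lin_map_conv[OF D g h] f d
    by (simp add: conv_eq_csum[OF D] g h cong: csum_cong[OF D])
  finally show ?thesis .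
qed

lemma conv_counit:
  assumes C: "is_coalgebra D" and f: "lin_map D ground f" and d: "d \<in> carrier D"
  shows "conv D (counit D) f d = f d" "conv D f (counit D) d = f d"
  using csum_counit[OF C is_vspace_ground f d]
  by (simp_all add: conv_eq_csum[OF is_coalgebra_comul_linear[OF C]] lin_map_counit[OF C] f d mult.commute)

lemma lin_map_conv_prod:
  assumes C: "is_coalgebra D" and "\<And>f. f \<in> set fs \<Longrightarrow> lin_map D ground f"
  shows "lin_map D ground (conv_prod D fs)"
  using assms(2)
  by (induction fs) (auto simp: conv_prod_def lin_map_counit[OF C] intro!: lin_map_conv is_coalgebra_comul_linear C)

lemma is_conv_inverse_conv:
  assumes C: "is_coalgebra D" and f: "lin_map D ground f" and g: "lin_map D ground g"
    and f': "is_conv_inverse D f f'" and g': "is_conv_inverse D g g'"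
  shows "is_conv_inverse D (conv D f g) (conv D g' f')"
proof -
  note D = is_coalgebra_comul_linear[OF C]
  have l: "lin_map D ground f'" "lin_map D ground g'" using f' g' by (auto simp: is_conv_inverse_def)
  note lin = f g l lin_map_conv[OF D] lin_map_counit[OF C]
  \<comment> \<open>Generic letters, since both halves of the claim are instances: a = f, b = g for
    one, and a = g', b = f' for the other.\<close>
  have cancel: "conv D (conv D a b) (conv D b' a') d = counit D d"
    if "lin_map D ground a" "lin_map D ground b" "lin_map D ground a'" "lin_map D ground b'"
      "\<And>d. d \<in> carrier D \<Longrightarrow> conv D b b' d = counit D d" "\<And>d. d \<in> carrier D \<Longrightarrow> conv D a a' d = counit D d"
      "d \<in> carrier D" for a b a' b' d
  proof -
    have "conv D (conv D a b) (conv D b' a') d = conv D a (conv D b (conv D b' a')) d"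
      by (intro conv_assoc C lin_map_conv D that)
    also have "\<dots> = conv D a (conv D (conv D b b') a') d"
      by (intro conv_cong D lin_map_conv that refl conv_assoc[symmetric] C)
    also have "\<dots> = conv D a (conv D (counit D) a') d"
      by (intro conv_cong D lin_map_conv that refl)
    also have "\<dots> = conv D a a' d"
      by (intro conv_cong D lin_map_conv that refl conv_counit C lin_map_counit)
    finally show ?thesis using that by simp
  qed
  show ?thesis
    unfolding is_conv_inverse_def
    using f' g' by (intro conjI ballI lin_map_conv D l cancel f g) (auto simp: is_conv_inverse_def)
qed

text \<open>\<open>conv_inv\<close> is a choice and says something only once an inverse exists. For
  \<open>J\<close> an inverse is composed from those of its factors, in opposite order.\<close>

lemma conv_prod_invertible:
  assumes C: "is_coalgebra D" and "\<And>f. f \<in> set fs \<Longrightarrow> lin_map D ground f \<and> (\<exists>g. is_conv_inverse D f g)"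
  shows "\<exists>g. is_conv_inverse D (conv_prod D fs) g"
  using assms(2)
proof (induction fs)
  case Nil
  have "is_conv_inverse D (counit D) (counit D)"
    by (simp add: is_conv_inverse_def conv_counit[OF C] lin_map_counit[OF C])
  then show ?case by (auto simp: conv_prod_def)
next
  case (Cons f fs)
  have "\<exists>g. is_conv_inverse D (conv_prod D fs) g"
    by (rule Cons.IH) (use Cons.prems in auto)
  then obtain g where "is_conv_inverse D (conv_prod D fs) g" ..
  moreover obtain f' where "is_conv_inverse D f f'" using Cons.prems[of f] by auto
  ultimately have "is_conv_inverse D (conv D f (conv_prod D fs)) (conv D g f')"
    using Cons.prems by (intro is_conv_inverse_conv C lin_map_conv_prod) auto
  then show ?case by (auto simp: conv_prod_def)
qed

lemma is_conv_inverse_conv_inv: "\<exists>g. is_conv_inverse D f g \<Longrightarrow> is_conv_inverse D f (conv_inv D f)"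
  unfolding conv_inv_def by (rule someI_ex[of "is_conv_inverse D f"])

section \<open>Legs\<close>

text \<open>Lets one computation treat the leg as the right (\<open>s\<close>) or the left (\<open>\<not> s\<close>) factor of a convolution.\<close>

definition pick :: "bool \<Rightarrow> 'a \<Rightarrow> 'a \<Rightarrow> 'a" where
  "pick s x y = (if s then x else y)"

lemma pick_simps [simp]:
  "pick True x y = x" "pick False x y = y"
  "pick s (x # xs) (y # ys) = pick s x y # pick s xs ys"
  by (auto simp: pick_def)

lemma pick_append [simp]: "pick s (xs @ us) (ys @ vs) = pick s xs ys @ pick s us vs"
  by (auto simp: pick_def)

lemma pick_in: "x \<in> A \<Longrightarrow> y \<in> A \<Longrightarrow> pick s x y \<in> A"
  by (auto simp: pick_def)

text \<open>Removes the sums over a block of entries that a leg sees only through counits. The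
  constant \<open>k\<close> carries whatever the other blocks contribute.\<close>

lemma csum_list_collapse:
  assumes C: "is_coalgebra H" and f: "multilinear H ground n f" and hs: "hs \<in> tuples H n"
  shows "csum_list H ground (\<lambda>xs ys. f (pick s xs ys) * (counits H (pick (\<not> s) xs ys) * k)) hs = f hs * k"
proof -
  have "csum_list H ground (\<lambda>xs ys. f (pick s xs ys) * counits H (pick (\<not> s) xs ys)) hs = f hs"
    using csum_list_counits[OF C is_vspace_ground f hs] by (cases s) (simp_all add: mult.commute)
  then show ?thesis by (simp add: csum_list_mult_right flip: mult.assoc)
qed

text \<open>\<open>L\<close> is a counit on the blocks \<open>us\<close>, \<open>vs\<close>,
  \<open>ws\<close>, so the counit laws leave only the sums over \<open>x\<close> and
  \<open>y\<close>. The sums are nested in the order of the entries, and the blocks are collapsed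
  from the inside: first \<open>ws\<close>, then \<open>vs\<close>, then \<open>us\<close>.\<close>

lemma csum_list_leg:
  assumes C: "is_coalgebra H"
    and a: "multilinear H ground (k + Suc (m + Suc l)) a"
    and us: "us \<in> tuples H k" and vs: "vs \<in> tuples H m" and ws: "ws \<in> tuples H l"
    and x: "x \<in> carrier H" and y: "y \<in> carrier H"
    and leg: "\<And>us vs ws x y. us \<in> tuples H k \<Longrightarrow> vs \<in> tuples H m \<Longrightarrow> ws \<in> tuples H l \<Longrightarrow>
      x \<in> carrier H \<Longrightarrow> y \<in> carrier H \<Longrightarrow>
      L (us @ x # vs @ y # ws) = counits H us * counits H vs * counits H ws * b x y"
  shows "csum_list H ground (\<lambda>xs ys. a (pick s xs ys) * L (pick (\<not> s) xs ys)) (us @ x # vs @ y # ws) =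
    csum H ground (\<lambda>x1 x2. csum H ground (\<lambda>y1 y2.
      a (us @ pick s x1 x2 # vs @ pick s y1 y2 # ws) * b (pick (\<not> s) x1 x2) (pick (\<not> s) y1 y2)) y) x"
proof -
  note H = is_coalgebra_comul_linear[OF C]
  have a1: "multilinear H ground (m + Suc l) (\<lambda>ks. a (us @ x # ks))"
    if "us \<in> tuples H k" "x \<in> carrier H" for us x
    using multilinear_append_right[OF a that(1)] that(2) by (simp add: multilinear_Suc)
  have a2: "multilinear H ground m (\<lambda>vs. a (us @ x # vs @ y # ws))"
    if "us \<in> tuples H k" "x \<in> carrier H" "y \<in> carrier H" for us x y
    using multilinear_append_left[OF a1[OF that(1,2)], of "y # ws"] that(3) ws by simp
  have a3: "multilinear H ground l (\<lambda>ws. a (us @ x # vs @ y # ws))"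
    if "us \<in> tuples H k" "x \<in> carrier H" "vs \<in> tuples H m" "y \<in> carrier H" for us x vs y
    using multilinear_append_right[OF a1[OF that(1,2)] that(3)] that(4) by (simp add: multilinear_Suc)
  have a4: "multilinear H ground k (\<lambda>us. a (us @ x # vs @ y # ws))"
    if "x \<in> carrier H" "y \<in> carrier H" for x y
    by (rule multilinear_append_left[OF a]) (use that vs ws tuples_append[OF vs, of "y # ws" "Suc l"] in simp)
  \<comment> \<open>Hides the sum over \<open>y\<close>, so that what stands under the sum over
    \<open>vs\<close> is a multilinear function of \<open>vs\<close> times counits.\<close>
  define Y where "Y us x1 vs x2 = csum H ground (\<lambda>y1 y2. a (us @ x1 # vs @ pick s y1 y2 # ws) * b x2 (pick (\<not> s) y1 y2)) y"
    for us x1 vs x2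
  have ws_step: "csum_list H ground (\<lambda>ws1 ws2. a (us1 @ x1 # vs1 @ y1 # pick s ws1 ws2) *
      L (us2 @ x2 # vs2 @ y2 # pick (\<not> s) ws1 ws2)) ws =
      a (us1 @ x1 # vs1 @ y1 # ws) * b x2 y2 * (counits H us2 * counits H vs2)"
    if "us1 \<in> tuples H k" "x1 \<in> carrier H" "vs1 \<in> tuples H m" "y1 \<in> carrier H"
      "us2 \<in> tuples H k" "x2 \<in> carrier H" "vs2 \<in> tuples H m" "y2 \<in> carrier H"
    for us1 x1 vs1 y1 us2 x2 vs2 y2
  proof -
    have "csum_list H ground (\<lambda>ws1 ws2. a (us1 @ x1 # vs1 @ y1 # pick s ws1 ws2) *
        L (us2 @ x2 # vs2 @ y2 # pick (\<not> s) ws1 ws2)) ws =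
      csum_list H ground (\<lambda>ws1 ws2. a (us1 @ x1 # vs1 @ y1 # pick s ws1 ws2) *
        (counits H (pick (\<not> s) ws1 ws2) * (counits H us2 * counits H vs2 * b x2 y2))) ws"
      using that by (intro csum_list_cong[OF H ws]) (simp add: leg pick_in)
    also have "\<dots> = a (us1 @ x1 # vs1 @ y1 # ws) * (counits H us2 * counits H vs2 * b x2 y2)"
      by (rule csum_list_collapse[OF C a3 ws]) (use that in auto)
    finally show ?thesis by simp
  qed
  have Y: "csum H ground (\<lambda>y1 y2. a (us1 @ x1 # vs1 @ pick s y1 y2 # ws) * b x2 (pick (\<not> s) y1 y2) * K) y = Y us1 x1 vs1 x2 * K"
    for us1 x1 vs1 x2 K
    by (simp add: Y_def csum_mult_right)
  have vs_step: "csum_list H ground (\<lambda>vs1 vs2. Y us1 x1 (pick s vs1 vs2) x2 * (counits H us2 * counits H (pick (\<not> s) vs1 vs2))) vs =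
     Y us1 x1 vs x2 * counits H us2"
    if "us1 \<in> tuples H k" "x1 \<in> carrier H" for us1 x1 us2 x2
  proof -
    have "multilinear H ground m (\<lambda>vs. Y us1 x1 vs x2)"
      unfolding Y_def using that
      by (intro multilinear_csum_param[OF H is_vspace_ground y] multilinear_mult_right a2 pick_in)
    from csum_list_collapse[OF C this vs, of s "counits H us2"] show ?thesis by (simp add: mult.commute)
  qed
  have "csum_list H ground (\<lambda>xs ys. a (pick s xs ys) * L (pick (\<not> s) xs ys)) (us @ x # vs @ y # ws) =
    csum_list H ground (\<lambda>us1 us2. csum H ground (\<lambda>x1 x2. csum_list H ground (\<lambda>vs1 vs2. csum H ground (\<lambda>y1 y2.
      csum_list H ground (\<lambda>ws1 ws2. a (pick s us1 us2 @ pick s x1 x2 # pick s vs1 vs2 @ pick s y1 y2 # pick s ws1 ws2) *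
       L (pick (\<not> s) us1 us2 @ pick (\<not> s) x1 x2 # pick (\<not> s) vs1 vs2 @ pick (\<not> s) y1 y2 # pick (\<not> s) ws1 ws2)) ws) y) vs) x) us"
    by (simp add: csum_list_append)
  also have "\<dots> = csum_list H ground (\<lambda>us1 us2. csum H ground (\<lambda>x1 x2. csum_list H ground (\<lambda>vs1 vs2. csum H ground (\<lambda>y1 y2.
      a (pick s us1 us2 @ pick s x1 x2 # pick s vs1 vs2 @ pick s y1 y2 # ws) *
      b (pick (\<not> s) x1 x2) (pick (\<not> s) y1 y2) * (counits H (pick (\<not> s) us1 us2) * counits H (pick (\<not> s) vs1 vs2))) y) vs) x) us"
    by (intro csum_list_cong[OF H us] csum_cong[OF H x] csum_list_cong[OF H vs] csum_cong[OF H y] ws_step pick_in)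
  also have "\<dots> = csum_list H ground (\<lambda>us1 us2. csum H ground (\<lambda>x1 x2.
      Y (pick s us1 us2) (pick s x1 x2) vs (pick (\<not> s) x1 x2) * counits H (pick (\<not> s) us1 us2)) x) us"
    unfolding Y by (intro csum_list_cong[OF H us] csum_cong[OF H x] vs_step pick_in)
  \<comment> \<open>The factor 1 plays the part of \<open>k\<close> in
    \<open>csum_list_collapse\<close>, as \<open>us\<close> is the last block.\<close>
  also have "\<dots> = csum_list H ground (\<lambda>us1 us2. csum H ground (\<lambda>x1 x2. Y (pick s us1 us2) (pick s x1 x2) vs (pick (\<not> s) x1 x2)) x *
      (counits H (pick (\<not> s) us1 us2) * 1)) us"
    by (simp add: csum_mult_right)
  also have "\<dots> = csum H ground (\<lambda>x1 x2. Y us (pick s x1 x2) vs (pick (\<not> s) x1 x2)) x * 1"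
    unfolding Y_def
    by (rule csum_list_collapse[OF C _ us])
      (intro multilinear_csum_param[OF H is_vspace_ground] x y multilinear_mult_right a4 pick_in)
  finally show ?thesis by (simp add: Y_def)
qed

text \<open>\<open>leg\<close> counts positions from 1 and lists from 0, so the lemmas on legs write
  positions as \<open>Suc p\<close> and \<open>Suc q\<close>, with \<open>p\<close> and
  \<open>q\<close> the list indices.\<close>

lemma prod_leg:
  "(\<Prod>j\<in>{1..N} - set [Suc p, Suc q]. g (j - 1)) = (\<Prod>i\<in>{..<N} - {p, q}. g i)"
  by (rule prod.reindex_bij_witness[of _ Suc "\<lambda>j. j - 1"]) auto

lemma multilinear_leg:
  assumes C: "is_coalgebra H" and b: "bilin H H ground b" and pq: "p < q" "q < N"
  shows "multilinear H ground N (\<lambda>hs. b (hs ! p) (hs ! q) * (\<Prod>i\<in>{..<N} - {p, q}. counit H (hs ! i)))"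
  unfolding multilinear_iff_update
proof (intro conjI ballI allI impI)
  fix hs i assume hs: "hs \<in> tuples H N" and i: "i < N"
  have len: "length hs = N" by (rule tuples_length[OF hs])
  have c: "hs ! p \<in> carrier H" "hs ! q \<in> carrier H" using tuples_nth[OF hs] pq by auto
  have other: "(\<Prod>j\<in>{..<N} - {p, q}. counit H (hs[i := x] ! j)) = (\<Prod>j\<in>{..<N} - {p, q}. counit H (hs ! j))"
    if "i = p \<or> i = q" for x
    using that by (intro prod.cong) auto
  consider "i = p" | "i = q" | "i \<noteq> p" "i \<noteq> q" by blast
  then show "lin_map H ground (\<lambda>x. b (hs[i := x] ! p) (hs[i := x] ! q) * (\<Prod>j\<in>{..<N} - {p, q}. counit H (hs[i := x] ! j)))"
  proof cases
    case 1
    then show ?thesis using pq len c b by (simp add: other lin_map_mult_right bilinD)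
  next
    case 2
    then show ?thesis using pq len c bilinD(3)[OF b c(1)] by (simp add: other lin_map_mult_right)
  next
    \<comment> \<open>Away from \<open>p\<close> and \<open>q\<close> the varying entry sits in
      exactly one counit factor, which is split off from the product.\<close>
    case 3
    have "(\<Prod>j\<in>{..<N} - {p, q}. counit H (hs[i := x] ! j)) =
        counit H x * (\<Prod>j\<in>{..<N} - {p, q} - {i}. counit H (hs ! j))" for x
      using 3 i len by (subst prod.remove[of _ i]) (auto intro!: prod.cong)
    then show ?thesis
      using 3 len by (simp add: lin_map_mult_left lin_map_mult_right lin_map_counit[OF C])
  qed
qed simp

lemma counits_conv_prod: "counits H hs = (\<Prod>i<length hs. counit H (hs ! i))"
  by (simp add: counits_def prod.list_conv_set_nth lessThan_atLeast0)

lemma prod_leg_append: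
  assumes "length us = p" "q = p + Suc (length vs)" "N = q + Suc (length ws)"
  shows "(\<Prod>i\<in>{..<N} - {p, q}. counit H ((us @ x # vs @ y # ws) ! i)) = counits H us * counits H vs * counits H ws"
proof -
  let ?g = "\<lambda>i. counit H ((us @ x # vs @ y # ws) ! i)"
  have "{..<N} - {p, q} = {..<p} \<union> {p + 1..<q} \<union> {q + 1..<N}" using assms by auto
  then have "(\<Prod>i\<in>{..<N} - {p, q}. ?g i) = (\<Prod>i<p. ?g i) * (\<Prod>i\<in>{p + 1..<q}. ?g i) * (\<Prod>i\<in>{q + 1..<N}. ?g i)"
    using assms by (simp add: prod.union_disjoint disjoint_iff)
  also have "(\<Prod>i<p. ?g i) = counits H us"
    using assms by (auto simp: counits_conv_prod nth_append intro!: prod.cong)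
  also have "(\<Prod>i\<in>{p + 1..<q}. ?g i) = counits H vs"
    unfolding counits_conv_prod
    by (rule prod.reindex_bij_witness[of _ "\<lambda>i. p + 1 + i" "\<lambda>i. i - (p + 1)"])
       (use assms in \<open>auto simp: nth_append nth_Cons'\<close>)
  also have "(\<Prod>i\<in>{q + 1..<N}. ?g i) = counits H ws"
    unfolding counits_conv_prod
    by (rule prod.reindex_bij_witness[of _ "\<lambda>i. q + 1 + i" "\<lambda>i. i - (q + 1)"])
       (use assms in \<open>auto simp: nth_append nth_Cons'\<close>)
  finally show ?thesis .
qed

lemma
  assumes C: "is_coalgebra H" and f: "lin_map (tpow H 2) ground f" and pq: "p < q" "q < N"
  shows lin_map_leg: "lin_map (tpow H N) ground (leg H N f [Suc p, Suc q])"
    and leg_pure: "hs \<in> tuples H N \<Longrightarrow> leg H N f [Suc p, Suc q] (pure H hs) =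
      f (pure H [hs ! p, hs ! q]) * (\<Prod>i\<in>{..<N} - {p, q}. counit H (hs ! i))"
proof -
  note V = comul_linear_vspace[OF is_coalgebra_comul_linear[OF C]]
  have b: "bilin H H ground (\<lambda>x y. f (pure H [x, y]))"
    using multilinear_comp[OF multilinear_pure[OF V] f] by (simp add: multilinear_2)
  have eq: "leg H N f [Suc p, Suc q] = tlift H ground N
      (\<lambda>hs. f (pure H [hs ! p, hs ! q]) * (\<Prod>i\<in>{..<N} - {p, q}. counit H (hs ! i)))"
  proof -
    have "(\<Prod>j\<in>{1..N} - set [Suc p, Suc q]. counit H (hs ! (j - 1))) = (\<Prod>i\<in>{..<N} - {p, q}. counit H (hs ! i))" for hs
      by (rule prod_leg)
    then show ?thesis unfolding leg_def by simp
  qed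
  show "lin_map (tpow H N) ground (leg H N f [Suc p, Suc q])"
    unfolding eq by (rule tensor_universal(1)[OF is_vspace_ground multilinear_leg[OF C b pq]])
  show "leg H N f [Suc p, Suc q] (pure H hs) =
      f (pure H [hs ! p, hs ! q]) * (\<Prod>i\<in>{..<N} - {p, q}. counit H (hs ! i))" if "hs \<in> tuples H N"
    unfolding eq by (rule tensor_universal(2)[OF is_vspace_ground multilinear_leg[OF C b pq] that])
qed

lemma leg_pure_append:
  assumes C: "is_coalgebra H" and f: "lin_map (tpow H 2) ground f" and N: "N = k + Suc (m + Suc l)"
    and hs: "us \<in> tuples H k" "vs \<in> tuples H m" "ws \<in> tuples H l" "x \<in> carrier H" "y \<in> carrier H"
  shows "leg H N f [Suc k, Suc (k + Suc m)] (pure H (us @ x # vs @ y # ws)) =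
     counits H us * counits H vs * counits H ws * f (pure H [x, y])"
proof -
  have t: "us @ x # vs @ y # ws \<in> tuples H N"
    unfolding N by (intro tuples_append hs tuples_simps(3)[THEN iffD2] conjI)
  note l = tuples_length[OF hs(1)] tuples_length[OF hs(2)] tuples_length[OF hs(3)]
  have "(us @ x # vs @ y # ws) ! k = x" "(us @ x # vs @ y # ws) ! (k + Suc m) = y"
    using l by (simp_all add: nth_append)
  moreover have "(\<Prod>i\<in>{..<N} - {k, k + Suc m}. counit H ((us @ x # vs @ y # ws) ! i)) =
      counits H us * counits H vs * counits H ws"
    by (rule prod_leg_append) (use l N in auto)
  ultimately show ?thesis
    by (subst leg_pure[OF C f _ _ t]) (use N in auto)
qed

lemma tuples_split:
  assumes "hs \<in> tuples V N" "p < q" "q < N"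
  obtains us x vs y ws where "hs = us @ x # vs @ y # ws" "us \<in> tuples V p" "vs \<in> tuples V (q - Suc p)"
    "ws \<in> tuples V (N - Suc q)" "x \<in> carrier V" "y \<in> carrier V"
proof -
  have len: "length hs = N" by (rule tuples_length[OF assms(1)])
  let ?ks = "drop (Suc p) hs"
  have "hs = take p hs @ hs ! p # ?ks"
    using assms len by (simp add: id_take_nth_drop)
  moreover have "?ks = take (q - Suc p) ?ks @ ?ks ! (q - Suc p) # drop (Suc (q - Suc p)) ?ks"
    using assms len by (intro id_take_nth_drop) auto
  ultimately have "hs = take p hs @ hs ! p # take (q - Suc p) ?ks @ ?ks ! (q - Suc p) # drop (Suc (q - Suc p)) ?ks"
    by simp
  then show thesis
    by (rule that) (use assms len in \<open>auto simp: tuples_def dest!: in_set_takeD in_set_dropD\<close>)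
qed

text \<open>Convolution with a leg affects two entries only and leaves the others in place, which
  makes an exchange of two letters inside a long word a computation in \<open>H\<close>. The two
  equations are \<open>csum_list_leg\<close> with \<open>s\<close> true and false.\<close>

lemma conv_leg:
  assumes C: "is_coalgebra H" and f: "lin_map (tpow H 2) ground f" and N: "N = k + Suc (m + Suc l)"
    and hs: "us \<in> tuples H k" "vs \<in> tuples H m" "ws \<in> tuples H l" "x \<in> carrier H" "y \<in> carrier H"
    and A: "lin_map (tpow H N) ground A"
  defines "L \<equiv> leg H N f [Suc k, Suc (k + Suc m)]"
  shows "conv (tpow_bialg H N) A L (pure H (us @ x # vs @ y # ws)) =
    csum H ground (\<lambda>x1 x2. csum H ground (\<lambda>y1 y2. A (pure H (us @ x1 # vs @ y1 # ws)) * f (pure H [x2, y2])) y) x"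
   and "conv (tpow_bialg H N) L A (pure H (us @ x # vs @ y # ws)) =
    csum H ground (\<lambda>x1 x2. csum H ground (\<lambda>y1 y2. f (pure H [x1, y1]) * A (pure H (us @ x2 # vs @ y2 # ws))) y) x"
proof -
  note H = is_coalgebra_comul_linear[OF C]
  note V = comul_linear_vspace[OF H]
  have L: "lin_map (tpow H N) ground L"
    unfolding L_def by (rule lin_map_leg[OF C f]) (use N in auto)
  have t: "us @ x # vs @ y # ws \<in> tuples H N"
    unfolding N by (intro tuples_append hs tuples_simps(3)[THEN iffD2] conjI)
  have a: "multilinear H ground (k + Suc (m + Suc l)) (\<lambda>hs. A (pure H hs))"
    using multilinear_comp[OF multilinear_pure[OF V] A] N by simp
  note S = csum_list_leg[OF C a hs(1-5) leg_pure_append[OF C f N, folded L_def]]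
  show "conv (tpow_bialg H N) A L (pure H (us @ x # vs @ y # ws)) =
    csum H ground (\<lambda>x1 x2. csum H ground (\<lambda>y1 y2. A (pure H (us @ x1 # vs @ y1 # ws)) * f (pure H [x2, y2])) y) x"
    using S[of True] csum_tpow_pure[OF H is_vspace_ground bilin_mult[OF A L] t] pure_in_tpow[OF V t] A L
    by (simp add: conv_eq_csum[OF comul_linear_tpow[OF H]])
  show "conv (tpow_bialg H N) L A (pure H (us @ x # vs @ y # ws)) =
    csum H ground (\<lambda>x1 x2. csum H ground (\<lambda>y1 y2. f (pure H [x1, y1]) * A (pure H (us @ x2 # vs @ y2 # ws))) y) x"
    using S[of False] csum_tpow_pure[OF H is_vspace_ground bilin_mult[OF L A] t] pure_in_tpow[OF V t] A L
    by (simp add: conv_eq_csum[OF comul_linear_tpow[OF H]] mult.commute)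
qed

lemma conv_tpow_2_pure:
  assumes C: "is_coalgebra H" and f: "lin_map (tpow H 2) ground f" and g: "lin_map (tpow H 2) ground g"
    and xy: "x \<in> carrier H" "y \<in> carrier H"
  shows "conv (tpow_bialg H 2) f g (pure H [x, y]) =
    csum H ground (\<lambda>x1 x2. csum H ground (\<lambda>y1 y2. f (pure H [x1, y1]) * g (pure H [x2, y2])) y) x"
proof -
  note H = is_coalgebra_comul_linear[OF C]
  have t: "[x, y] \<in> tuples H 2" using xy by (simp add: tuples_2)
  show ?thesis
    using csum_tpow_pure[OF H is_vspace_ground bilin_mult[OF f g] t] f g pure_in_tpow[OF comul_linear_vspace[OF H] t]
    by (simp add: conv_eq_csum[OF comul_linear_tpow[OF H]])
qed

text \<open>Placing a form on two positions respects convolution and unit: by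
  \<open>conv_leg\<close> the convolution of two legs on the same positions is the one in H^{(x)2}
  times the counits of the other entries.\<close>

lemma is_conv_inverse_leg:
  assumes C: "is_coalgebra H" and f: "lin_map (tpow H 2) ground f"
    and g: "is_conv_inverse (tpow_bialg H 2) f g" and pq: "p < q" "q < N"
  shows "is_conv_inverse (tpow_bialg H N) (leg H N f [Suc p, Suc q]) (leg H N g [Suc p, Suc q])"
proof -
  note H = is_coalgebra_comul_linear[OF C]
  note V = comul_linear_vspace[OF H]
  have g': "lin_map (tpow H 2) ground g" using g by (simp add: is_conv_inverse_def)
  \<comment> \<open>Stated for fresh \<open>f\<close> and \<open>g\<close>, because it is used a
    second time with the form and its inverse exchanged.\<close>
  have *: "conv (tpow_bialg H N) (leg H N f [Suc p, Suc q]) (leg H N g [Suc p, Suc q]) d = counit (tpow_bialg H N) d"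
    if f: "lin_map (tpow H 2) ground f" and g: "lin_map (tpow H 2) ground g"
      and inv: "\<And>d. d \<in> carrier (tpow H 2) \<Longrightarrow> conv (tpow_bialg H 2) f g d = counit (tpow_bialg H 2) d"
      and d: "d \<in> carrier (tpow H N)" for f g d
  proof (rule lin_map_tpow_eqI[OF is_vspace_ground V _ lin_map_counit_tpow[OF C] _ d])
    note lf = lin_map_leg[OF C f pq] and lg = lin_map_leg[OF C g pq]
    show "lin_map (tpow H N) ground (conv (tpow_bialg H N) (leg H N f [Suc p, Suc q]) (leg H N g [Suc p, Suc q]))"
      using lin_map_conv[OF comul_linear_tpow[OF H]] lf lg by simp
    fix hs assume t: "hs \<in> tuples H N"
    obtain us x vs y ws where hs: "hs = us @ x # vs @ y # ws" and
      h: "us \<in> tuples H p" "vs \<in> tuples H (q - Suc p)"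
      "ws \<in> tuples H (N - Suc q)" "x \<in> carrier H" "y \<in> carrier H"
      by (rule tuples_split[OF t pq])
    have N: "N = p + Suc (q - Suc p + Suc (N - Suc q))" and q: "p + Suc (q - Suc p) = q" using pq by auto
    have "conv (tpow_bialg H N) (leg H N f [Suc p, Suc q]) (leg H N g [Suc p, Suc q]) (pure H hs) =
      csum H ground (\<lambda>x1 x2. csum H ground (\<lambda>y1 y2. leg H N f [Suc p, Suc q] (pure H (us @ x1 # vs @ y1 # ws)) * g (pure H [x2, y2])) y) x"
      using conv_leg(1)[OF C g N h lf, unfolded q] by (simp add: hs)
    also have "\<dots> = csum H ground (\<lambda>x1 x2. csum H ground (\<lambda>y1 y2. counits H us * counits H vs * counits H ws *
        (f (pure H [x1, y1]) * g (pure H [x2, y2]))) y) x"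
      using leg_pure_append[OF C f N h(1-3), unfolded q] h(4,5) by (simp add: mult.assoc cong: csum_cong[OF H])
    also have "\<dots> = counits H us * counits H vs * counits H ws * counits H [x, y]"
      using conv_tpow_2_pure[OF C f g h(4,5)] inv[of "pure H [x, y]"] h(4,5)
      by (simp add: csum_mult_left counit_tpow_pure[OF C] pure_in_tpow[OF V] tuples_2)
    also have "\<dots> = counit (tpow_bialg H N) (pure H hs)"
      by (simp add: counit_tpow_pure[OF C t]) (simp add: hs)
    finally show "conv (tpow_bialg H N) (leg H N f [Suc p, Suc q]) (leg H N g [Suc p, Suc q]) (pure H hs) =
      counit (tpow_bialg H N) (pure H hs)" .
  qed
  show ?thesis
    unfolding is_conv_inverse_def
    using *[OF f g'] *[OF g' f] g lin_map_leg[OF C g' pq] by (simp add: is_conv_inverse_def)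
qed

section \<open>Products of lists\<close>

definition prodl :: "('k::field, 'a::ab_group_add) bialg \<Rightarrow> 'a list \<Rightarrow> 'a" where
  "prodl H hs = foldr (mul H) hs (unit H)"

lemma prodl_simps [simp]: "prodl H [] = unit H" "prodl H (h # hs) = mul H h (prodl H hs)"
  by (simp_all add: prodl_def)

lemma is_algebraD:
  assumes "is_algebra H"
  shows "is_vspace H" "a \<in> carrier H \<Longrightarrow> lin_map H H (mul H a)" "a \<in> carrier H \<Longrightarrow> lin_map H H (\<lambda>b. mul H b a)"
    "a \<in> carrier H \<Longrightarrow> b \<in> carrier H \<Longrightarrow> c \<in> carrier H \<Longrightarrow> mul H (mul H a b) c = mul H a (mul H b c)"
    "unit H \<in> carrier H" "a \<in> carrier H \<Longrightarrow> mul H (unit H) a = a" "a \<in> carrier H \<Longrightarrow> mul H a (unit H) = a"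
  using assms by (auto simp: is_algebra_def)

lemma is_algebra_mul_carrier: "is_algebra H \<Longrightarrow> a \<in> carrier H \<Longrightarrow> b \<in> carrier H \<Longrightarrow> mul H a b \<in> carrier H"
  by (rule lin_mapD(1)[OF is_algebraD(2)])

lemma prodl_carrier: "is_algebra H \<Longrightarrow> set hs \<subseteq> carrier H \<Longrightarrow> prodl H hs \<in> carrier H"
  by (induction hs) (auto simp: is_algebraD is_algebra_mul_carrier)

lemma prodl_append:
  "is_algebra H \<Longrightarrow> set hs \<subseteq> carrier H \<Longrightarrow> set ks \<subseteq> carrier H \<Longrightarrow>
    prodl H (hs @ ks) = mul H (prodl H hs) (prodl H ks)"
  by (induction hs) (auto simp: is_algebraD prodl_carrier)

lemma lin_map_prodl_middle:
  assumes A: "is_algebra H" and us: "set us \<subseteq> carrier H" and ws: "set ws \<subseteq> carrier H"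
  shows "lin_map H H (\<lambda>x. mul H (prodl H us) (mul H x (prodl H ws)))"
  by (intro lin_map_comp[OF is_algebraD(3) is_algebraD(2)] A prodl_carrier us ws)

text \<open>Each position occurs exactly once in \<sigma>, so splitting the word at that occurrence
  exhibits linearity in the entry.\<close>

lemma multilinear_prodl_nth:
  assumes A: "is_algebra H" and \<sigma>: "distinct \<sigma>" "set \<sigma> = {..<N}"
  shows "multilinear H H N (\<lambda>hs. prodl H (map ((!) hs) \<sigma>))"
  unfolding multilinear_iff_update
proof (intro conjI ballI allI impI)
  fix hs assume hs: "hs \<in> tuples H N"
  have sub: "set (map ((!) hs) \<tau>) \<subseteq> carrier H" if "set \<tau> \<subseteq> {..<N}" for \<tau>
    using tuples_nth[OF hs] that by auto
  show "prodl H (map ((!) hs) \<sigma>) \<in> carrier H"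
    using \<sigma> by (intro prodl_carrier A sub) simp
  fix i assume "i < N"
  then obtain \<alpha> \<beta> where s: "\<sigma> = \<alpha> @ i # \<beta>" using \<sigma> by (metis in_set_conv_decomp lessThan_iff)
  have ab: "set \<alpha> \<subseteq> {..<N}" "set \<beta> \<subseteq> {..<N}" "i \<notin> set \<alpha>" "i \<notin> set \<beta>" using \<sigma> s by auto
  have eq: "map ((!) (hs[i := x])) \<sigma> = map ((!) hs) \<alpha> @ x # map ((!) hs) \<beta>" for x
    using s ab \<open>i < N\<close> tuples_length[OF hs] by (auto intro!: map_cong nth_list_update_neq)
  have p: "prodl H (map ((!) (hs[i := x])) \<sigma>) =
      mul H (prodl H (map ((!) hs) \<alpha>)) (mul H x (prodl H (map ((!) hs) \<beta>)))" if "x \<in> carrier H" for x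
    unfolding eq using that sub[OF ab(1)] sub[OF ab(2)] by (subst prodl_append[OF A]) auto
  show "lin_map H H (\<lambda>x. prodl H (map ((!) (hs[i := x])) \<sigma>))"
    by (rule iffD2[OF lin_map_cong[OF is_algebraD(1)[OF A] p] lin_map_prodl_middle[OF A sub[OF ab(1)] sub[OF ab(2)]]])
qed

lemma multilinear_prodl:
  assumes A: "is_algebra H"
  shows "multilinear H H N (prodl H)"
proof -
  have eq: "prodl H hs = prodl H (map ((!) hs) [0..<N])" if "hs \<in> tuples H N" for hs
    using tuples_length[OF that] map_nth[of hs] by simp
  show ?thesis
    by (rule iffD2[OF multilinear_cong[OF is_algebraD(1)[OF A] eq] multilinear_prodl_nth[OF A]]) auto
qed

lemma
  assumes A: "is_algebra H"
  shows lin_map_iterated_mul: "lin_map (tpow H n) H (iterated_mul H n)"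
    and iterated_mul_pure: "hs \<in> tuples H n \<Longrightarrow> iterated_mul H n (pure H hs) = prodl H hs"
  using tensor_universal(1,2)[OF is_algebraD(1)[OF A] multilinear_prodl[OF A, of n]]
  unfolding iterated_mul_def prodl_def[abs_def] by auto

lemma lin_map_separates:
  fixes V :: "('k::field, 'a::ab_group_add, 'z) vspace_scheme"
  assumes V: "is_vspace V" and eq: "\<And>\<phi>. lin_map V ground \<phi> \<Longrightarrow> \<phi> x = \<phi> y"
  shows "x = y"
proof (rule ccontr)
  assume "x \<noteq> y"
  then obtain \<phi> where lin: "Vector_Spaces.linear (smult V) (*) \<phi>" and ne: "\<phi> (x - y) \<noteq> 0"
    using separating_functional[OF is_vspaceD(1)[OF V], of "x - y"] by auto
  interpret L: Vector_Spaces.linear "smult V" "(*)" \<phi> by (rule lin)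
  have "lin_map V ground \<phi>" by (simp add: lin_map_def L.add L.scale)
  from eq[OF this] ne show False by (simp add: L.diff)
qed

section \<open>Transposing adjacent factors\<close>

text \<open>The word \<sigma> records an order of multiplication. The two products to be compared
  are the cases \<open>interleaved n 0\<close> and the increasing word, and each exchange changes
  \<sigma> by one adjacent swap.\<close>

definition perm_mul where
  "perm_mul H N \<phi> \<sigma> = tlift H ground N (\<lambda>hs. \<phi> (prodl H (map ((!) hs) \<sigma>)))"

lemma
  assumes A: "is_algebra H" and \<phi>: "lin_map H ground \<phi>" and \<sigma>: "distinct \<sigma>" "set \<sigma> = {..<N}"
  shows lin_map_perm_mul: "lin_map (tpow H N) ground (perm_mul H N \<phi> \<sigma>)"
    and perm_mul_pure: "hs \<in> tuples H N \<Longrightarrow> perm_mul H N \<phi> \<sigma> (pure H hs) = \<phi> (prodl H (map ((!) hs) \<sigma>))"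
  using tensor_universal(1,2)[OF is_vspace_ground multilinear_comp[OF multilinear_prodl_nth[OF A \<sigma>] \<phi>]]
  unfolding perm_mul_def by auto

text \<open>The exchange axiom in \<open>coquasitriangular\<close> nests one \<open>sweedler\<close>
  in another. The outer one can be converted only after its integrand, itself a sum over
  \<open>b\<close>, is known to be bilinear; hence one bilinearity hypothesis for each pair of
  variables.\<close>

lemma sweedler_sweedler_eq_csum:
  assumes H: "comul_linear H" and W: "is_vspace W" and ab: "a \<in> carrier H" "b \<in> carrier H"
    and 1: "\<And>x y. x \<in> carrier H \<Longrightarrow> y \<in> carrier H \<Longrightarrow> bilin H H W (G x y)"
    and 2: "\<And>u v. u \<in> carrier H \<Longrightarrow> v \<in> carrier H \<Longrightarrow> bilin H H W (\<lambda>x y. G x y u v)"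
  shows "sweedler H W (\<lambda>x y. sweedler H W (G x y) b) a = csum H W (\<lambda>x y. csum H W (G x y) b) a"
proof -
  note V = comul_linear_vspace[OF H]
  have eq: "sweedler H W (G x y) b = csum H W (G x y) b" if "x \<in> carrier H" "y \<in> carrier H" for x y
    by (rule sweedler_eq_csum[OF H W 1[OF that] ab(2)])
  have "bilin H H W (\<lambda>x y. csum H W (G x y) b)"
    by (intro bilinI lin_map_csum_param[OF H W ab(2)]) (use bilinD(1)[OF 2] bilinD(3)[OF 2] in auto)
  then have "bilin H H W (\<lambda>x y. sweedler H W (G x y) b)"
    using bilin_cong[OF V V, of "\<lambda>x y. sweedler H W (G x y) b" "\<lambda>x y. csum H W (G x y) b" W] eq by simp
  from sweedler_eq_csum[OF H W this ab(1)] show ?thesis by (simp add: eq cong: csum_cong[OF H ab(1)])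
qed

lemma is_bialgebraD:
  "is_bialgebra H \<Longrightarrow> is_algebra H" "is_bialgebra H \<Longrightarrow> is_coalgebra H"
  by (auto simp: is_bialgebra_def)

lemma coquasitriangular_lin_map: "coquasitriangular H R \<Longrightarrow> lin_map (tpow H 2) ground R"
  by (simp add: coquasitriangular_def)

lemma bilin_mul: "is_algebra H \<Longrightarrow> bilin H H H (mul H)"
  by (intro bilinI) (auto simp: is_algebraD)

text \<open>The exchange axiom with \<psi> applied to both sides. An arbitrary \<psi> is allowed
  because it will also carry the letters to the left and right of the exchanged pair.\<close>

lemma coquasitriangular_csum:
  assumes B: "is_bialgebra H" and R: "coquasitriangular H R" and \<psi>: "lin_map H ground \<psi>"
    and ab: "a \<in> carrier H" "b \<in> carrier H"
  shows "csum H ground (\<lambda>a1 a2. csum H ground (\<lambda>b1 b2. R (pure H [a1, b1]) * \<psi> (mul H a2 b2)) b) a =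
    csum H ground (\<lambda>a1 a2. csum H ground (\<lambda>b1 b2. \<psi> (mul H b1 a1) * R (pure H [a2, b2])) b) a"
proof -
  note A = is_bialgebraD(1)[OF B] and C = is_bialgebraD(2)[OF B]
  note H = is_coalgebra_comul_linear[OF C]
  note V = comul_linear_vspace[OF H]
  have b: "bilin H H ground (\<lambda>x y. R (pure H [x, y]))"
    using multilinear_comp[OF multilinear_pure[OF V] coquasitriangular_lin_map[OF R]] by (simp add: multilinear_2)
  note l = bilinD[OF b] bilinD[OF bilin_mul[OF A]]
  have 1: "sweedler H H (\<lambda>a1 a2. sweedler H H (\<lambda>b1 b2. smult H (R (pure H [a1, b1])) (mul H a2 b2)) b) a =
     csum H H (\<lambda>a1 a2. csum H H (\<lambda>b1 b2. smult H (R (pure H [a1, b1])) (mul H a2 b2)) b) a"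
    by (rule sweedler_sweedler_eq_csum[OF H V ab]) (rule bilin_smult[OF V l(2) l(7)] bilin_smult[OF V l(1) l(5)]; assumption)+
  have 2: "sweedler H H (\<lambda>a1 a2. sweedler H H (\<lambda>b1 b2. smult H (R (pure H [a2, b2])) (mul H b1 a1)) b) a =
     csum H H (\<lambda>a1 a2. csum H H (\<lambda>b1 b2. smult H (R (pure H [a2, b2])) (mul H b1 a1)) b) a"
    by (rule sweedler_sweedler_eq_csum[OF H V ab])
       (rule iffD2[OF bilin_flip bilin_smult[OF V l(2) l(5)]] iffD2[OF bilin_flip bilin_smult[OF V l(1) l(7)]]; assumption)+
  have "csum H H (\<lambda>a1 a2. csum H H (\<lambda>b1 b2. smult H (R (pure H [a1, b1])) (mul H a2 b2)) b) a =
    csum H H (\<lambda>a1 a2. csum H H (\<lambda>b1 b2. smult H (R (pure H [a2, b2])) (mul H b1 a1)) b) a"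
    using R ab unfolding 1[symmetric] 2[symmetric] by (simp add: coquasitriangular_def)
  then have "\<psi> (csum H H (\<lambda>a1 a2. csum H H (\<lambda>b1 b2. smult H (R (pure H [a1, b1])) (mul H a2 b2)) b) a) =
    \<psi> (csum H H (\<lambda>a1 a2. csum H H (\<lambda>b1 b2. smult H (R (pure H [a2, b2])) (mul H b1 a1)) b) a)" by simp
  then show ?thesis
    using ab
    by (simp add: lin_map_csum[OF H V is_vspace_ground \<psi>] csum_carrier[OF H V] vspace_smult[OF V] is_algebra_mul_carrier[OF A]
        lin_mapD(3)[OF \<psi>] mult.commute cong: csum_cong[OF H])
qed

text \<open>On a pure tensor \<open>conv_leg\<close> leaves sums over the entries at
  \<open>p\<close> and \<open>q\<close> alone. The rest of the word is constant, and what remains is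
  the exchange axiom in \<open>H\<close>.\<close>

lemma conv_perm_mul_leg:
  assumes B: "is_bialgebra H" and R: "coquasitriangular H R" and \<phi>: "lin_map H ground \<phi>"
    and pq: "p < q" "q < N"
    and \<sigma>: "distinct (\<alpha> @ [q, p] @ \<beta>)" "set (\<alpha> @ [q, p] @ \<beta>) = {..<N}"
    and d: "d \<in> carrier (tpow H N)"
  shows "conv (tpow_bialg H N) (perm_mul H N \<phi> (\<alpha> @ [q, p] @ \<beta>)) (leg H N R [Suc p, Suc q]) d =
    conv (tpow_bialg H N) (leg H N R [Suc p, Suc q]) (perm_mul H N \<phi> (\<alpha> @ [p, q] @ \<beta>)) d"
proof -
  note A = is_bialgebraD(1)[OF B] and C = is_bialgebraD(2)[OF B]
  note H = is_coalgebra_comul_linear[OF C]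
  note V = comul_linear_vspace[OF H]
  note f = coquasitriangular_lin_map[OF R]
  have \<tau>: "distinct (\<alpha> @ [p, q] @ \<beta>)" "set (\<alpha> @ [p, q] @ \<beta>) = {..<N}" using \<sigma> by auto
  note l1 = lin_map_perm_mul[OF A \<phi> \<sigma>] and l2 = lin_map_perm_mul[OF A \<phi> \<tau>] and lf = lin_map_leg[OF C f pq]
  show ?thesis
  proof (rule lin_map_tpow_eqI[OF is_vspace_ground V _ _ _ d])
    show "lin_map (tpow H N) ground (conv (tpow_bialg H N) (perm_mul H N \<phi> (\<alpha> @ [q, p] @ \<beta>)) (leg H N R [Suc p, Suc q]))"
      "lin_map (tpow H N) ground (conv (tpow_bialg H N) (leg H N R [Suc p, Suc q]) (perm_mul H N \<phi> (\<alpha> @ [p, q] @ \<beta>)))"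
      using lin_map_conv[OF comul_linear_tpow[OF H]] l1 l2 lf by simp_all
    fix hs assume t: "hs \<in> tuples H N"
    obtain us x vs y ws where hs: "hs = us @ x # vs @ y # ws" and
      h: "us \<in> tuples H p" "vs \<in> tuples H (q - Suc p)"
      "ws \<in> tuples H (N - Suc q)" "x \<in> carrier H" "y \<in> carrier H"
      by (rule tuples_split[OF t pq])
    have N: "N = p + Suc (q - Suc p + Suc (N - Suc q))" and q: "p + Suc (q - Suc p) = q" using pq by auto
    \<comment> \<open>The surrounding letters may be taken from the original \<open>hs\<close>:
      \<sigma> is distinct, so \<alpha> and \<beta> avoid \<open>p\<close> and \<open>q\<close>, the
      only entries that get replaced.\<close>
    define \<psi> where "\<psi> z = \<phi> (mul H (prodl H (map ((!) hs) \<alpha>)) (mul H z (prodl H (map ((!) hs) \<beta>))))" for z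
    have sub: "set (map ((!) hs) \<alpha>) \<subseteq> carrier H" "set (map ((!) hs) \<beta>) \<subseteq> carrier H"
      using tuples_nth[OF t] \<sigma> by auto
    have \<psi>: "lin_map H ground \<psi>"
      unfolding \<psi>_def by (rule lin_map_comp[OF lin_map_prodl_middle[OF A sub] \<phi>])
    have upd: "us @ x' # vs @ y' # ws = hs[p := x', q := y']" for x' y'
    proof -
      have "p = length us" "q = length us + Suc (length vs)"
        using tuples_length[OF h(1)] tuples_length[OF h(2)] q by auto
      then show ?thesis by (simp add: hs list_update_append)
    qed
    \<comment> \<open>\<open>i\<close> and \<open>j\<close> are left open so that both orders of the
      exchanged letters are instances.\<close>
    have val: "prodl H (map ((!) (us @ x' # vs @ y' # ws)) (\<alpha> @ [i, j] @ \<beta>)) =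
        mul H (prodl H (map ((!) hs) \<alpha>)) (mul H (mul H (hs[p := x', q := y'] ! i) (hs[p := x', q := y'] ! j)) (prodl H (map ((!) hs) \<beta>)))"
      if "x' \<in> carrier H" "y' \<in> carrier H" "i \<in> {p, q}" "j \<in> {p, q}" for x' y' i j
    proof -
      have m: "map ((!) (hs[p := x', q := y'])) \<alpha> = map ((!) hs) \<alpha>" "map ((!) (hs[p := x', q := y'])) \<beta> = map ((!) hs) \<beta>"
        using \<sigma>(1) by (auto intro!: nth_list_update_neq[THEN trans])
      have c: "hs[p := x', q := y'] ! i \<in> carrier H" "hs[p := x', q := y'] ! j \<in> carrier H"
        using that tuples_length[OF t] pq by auto
      show ?thesis
        unfolding upd map_append m using sub c
        by (subst prodl_append[OF A])
          (auto simp: prodl_carrier[OF A] is_algebraD(4)[OF A])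
    qed
    have nth: "hs[p := x', q := y'] ! p = x'" "hs[p := x', q := y'] ! q = y'" for x' y'
      using tuples_length[OF t] pq by auto
    have tt: "us @ x' # vs @ y' # ws \<in> tuples H N" if "x' \<in> carrier H" "y' \<in> carrier H" for x' y'
      unfolding upd by (intro tuples_update t that)
    have v1: "perm_mul H N \<phi> (\<alpha> @ [q, p] @ \<beta>) (pure H (us @ x' # vs @ y' # ws)) = \<psi> (mul H y' x')"
      if "x' \<in> carrier H" "y' \<in> carrier H" for x' y'
      unfolding perm_mul_pure[OF A \<phi> \<sigma> tt[OF that]] using val[OF that, of q p] by (simp add: \<psi>_def nth)
    have v2: "perm_mul H N \<phi> (\<alpha> @ [p, q] @ \<beta>) (pure H (us @ x' # vs @ y' # ws)) = \<psi> (mul H x' y')"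
      if "x' \<in> carrier H" "y' \<in> carrier H" for x' y'
      unfolding perm_mul_pure[OF A \<phi> \<tau> tt[OF that]] using val[OF that, of p q] by (simp add: \<psi>_def nth)
    have "conv (tpow_bialg H N) (perm_mul H N \<phi> (\<alpha> @ [q, p] @ \<beta>)) (leg H N R [Suc p, Suc q]) (pure H hs) =
       csum H ground (\<lambda>a1 a2. csum H ground (\<lambda>b1 b2. \<psi> (mul H b1 a1) * R (pure H [a2, b2])) y) x"
      unfolding hs conv_leg(1)[OF C f N h l1, unfolded q]
      by (intro csum_cong[OF H] h) (simp only: v1)
    also have "\<dots> = csum H ground (\<lambda>a1 a2. csum H ground (\<lambda>b1 b2. R (pure H [a1, b1]) * \<psi> (mul H a2 b2)) y) x"
      by (rule coquasitriangular_csum[OF B R \<psi> h(4,5), symmetric])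
    also have "\<dots> = conv (tpow_bialg H N) (leg H N R [Suc p, Suc q]) (perm_mul H N \<phi> (\<alpha> @ [p, q] @ \<beta>)) (pure H hs)"
      unfolding hs conv_leg(2)[OF C f N h l2, unfolded q]
      by (intro csum_cong[OF H] h) (simp only: v2)
    finally show "conv (tpow_bialg H N) (perm_mul H N \<phi> (\<alpha> @ [q, p] @ \<beta>)) (leg H N R [Suc p, Suc q]) (pure H hs) =
      conv (tpow_bialg H N) (leg H N R [Suc p, Suc q]) (perm_mul H N \<phi> (\<alpha> @ [p, q] @ \<beta>)) (pure H hs)" .
  qed
qed

text \<open>The positions \<open>i - 1\<close> and \<open>n + j - 1\<close>, counted from 0, are those of \<open>h\<^sub>i\<close> and \<open>h'\<^sub>j\<close>; the pair
  \<open>(i, j)\<close> stands for the factor \<open>\<R>\<^bsub>i,n+j\<^esub>\<close> of \<open>\<J>\<^sub>c\<close>.\<close>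

inductive transposes :: "nat \<Rightarrow> nat list \<Rightarrow> (nat \<times> nat) list \<Rightarrow> nat list \<Rightarrow> bool" for n where
  Nil: "transposes n \<sigma> [] \<sigma>"
| Cons: "transposes n (\<alpha> @ [i - 1, n + j - 1] @ \<beta>) ms \<tau> \<Longrightarrow> transposes n (\<alpha> @ [n + j - 1, i - 1] @ \<beta>) ((i, j) # ms) \<tau>"

lemma transposes_append:
  "transposes n \<sigma> ms \<tau> \<Longrightarrow> transposes n \<tau> ms' \<upsilon> \<Longrightarrow> transposes n \<sigma> (ms @ ms') \<upsilon>"
proof (induction rule: transposes.induct)
  case (Cons \<alpha> i j \<beta> ms \<tau>)
  then show ?case using transposes.Cons by (simp only: append_Cons)
qed simp

text \<open>Applied backwards from the increasing word, this shows that
  \<open>interleaved n 0\<close> is a permutation of the positions without any counting.\<close>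

lemma transposes_set:
  "transposes n \<sigma> ms \<tau> \<Longrightarrow> set \<tau> = set \<sigma> \<and> (distinct \<tau> \<longleftrightarrow> distinct \<sigma>)"
  by (induction rule: transposes.induct) auto

text \<open>Row i of \<open>J\<close>: the letter h_i travels left through h'_1 ... h'_k. The last
  letter of that block is its neighbour, which is why j decreases. The induction peels that letter
  off, and \<beta> is generalised to absorb it.\<close>

lemma transposes_row:
  "transposes n (\<alpha> @ [n..<n + k] @ (i - 1) # \<beta>) (map (Pair i) (rev [1..<Suc k])) (\<alpha> @ [i - 1] @ [n..<n + k] @ \<beta>)"
proof (induction k arbitrary: \<beta>)
  case 0
  show ?case by (simp add: transposes.Nil)
next
  case (Suc k)
  have "transposes n ((\<alpha> @ [n..<n + k]) @ [n + Suc k - 1, i - 1] @ \<beta>) ((i, Suc k) # map (Pair i) (rev [1..<Suc k]))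
      (\<alpha> @ [i - 1] @ [n..<n + k] @ (n + k) # \<beta>)"
    by (rule transposes.Cons) (use Suc[of "(n + k) # \<beta>"] in simp)
  then show ?case by simp
qed

text \<open>The tail h_{k+1} h'_{k+1} ... h_n h'_n of the first product; the start index
  \<open>k\<close> describes the part that the rows treated so far have not reached.\<close>

abbreviation interleaved :: "nat \<Rightarrow> nat \<Rightarrow> nat list" where
  "interleaved n k \<equiv> concat (map (\<lambda>i. [i, n + i]) [k..<n])"

text \<open>The invariant behind the order of \<open>J\<close>: after the rows up to m, the first m
  pairs are sorted and the tail is untouched.\<close>

lemma transposes_rows:
  assumes "1 \<le> m" "m \<le> n"
  shows "transposes n (interleaved n 0) (concat (map (\<lambda>i. map (Pair i) (rev [1..<i])) [2..<Suc m]))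
    ([0..<m] @ [n..<n + m] @ interleaved n m)"
  using assms
proof (induction m rule: dec_induct)
  \<comment> \<open>For m = 1 there are no rows, and the first pair h_1 h'_1 is already
    sorted.\<close>
  case base
  then show ?case by (simp add: upt_conv_Cons transposes.Nil)
next
  case (step m)
  \<comment> \<open>The next letter, at position m, is h_{m+1}; it is written
    \<open>Suc m - 1\<close> to match \<open>transposes_row\<close> with i =
    \<open>Suc m\<close>.\<close>
  have il: "interleaved n m = (Suc m - 1) # (n + m) # interleaved n (Suc m)"
    using step.prems by (simp add: upt_conv_Cons)
  have "transposes n ([0..<m] @ [n..<n + m] @ interleaved n m) (map (Pair (Suc m)) (rev [1..<Suc m]))
      ([0..<m] @ [Suc m - 1] @ [n..<n + m] @ (n + m) # interleaved n (Suc m))"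
    unfolding il by (rule transposes_row)
  from transposes_append[OF step.IH this] step show ?case by simp
qed

text \<open>The legs cross the product functional one at a time from right to left, and each
  crossing performs one swap in the word. For an empty list the convolution unit stands on both
  sides.\<close>

lemma conv_perm_mul_transposes:
  assumes B: "is_bialgebra H" and \<phi>: "lin_map H ground \<phi>"
    and tr: "transposes n \<sigma> ms \<tau>"
    and R: "\<And>i j. (i, j) \<in> set ms \<Longrightarrow> coquasitriangular H (R i j)"
    and ms: "\<And>i j. (i, j) \<in> set ms \<Longrightarrow> 1 \<le> j \<and> j < i \<and> i \<le> n"
    and \<sigma>: "distinct \<sigma>" "set \<sigma> = {..<2 * n}"
    and d: "d \<in> carrier (tpow H (2 * n))"
  defines "D \<equiv> tpow_bialg H (2 * n)"
  defines "fs \<equiv> map (\<lambda>(i, j). leg H (2 * n) (R i j) [i, n + j]) ms"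
  shows "conv D (perm_mul H (2 * n) \<phi> \<sigma>) (conv_prod D fs) d = conv D (conv_prod D fs) (perm_mul H (2 * n) \<phi> \<tau>) d"
  using tr R ms \<sigma> d unfolding fs_def
proof (induction arbitrary: d rule: transposes.induct)
  case (Nil \<sigma>)
  note A = is_bialgebraD(1)[OF B] and C = is_bialgebraD(2)[OF B]
  show ?case
    using conv_counit[OF is_coalgebra_tpow[OF C, of "2 * n"]] lin_map_perm_mul[OF A \<phi> Nil(3,4)] Nil(5)
    by (simp add: conv_prod_def D_def)
next
  case (Cons \<alpha> i j \<beta> ms \<tau>)
  note A = is_bialgebraD(1)[OF B] and C = is_bialgebraD(2)[OF B]
  let ?M = "perm_mul H (2 * n) \<phi>"
  let ?fs = "conv_prod D (map (\<lambda>(i, j). leg H (2 * n) (R i j) [i, n + j]) ms)"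
  let ?f = "leg H (2 * n) (R i j) [i, n + j]"
  have ij: "1 \<le> j" "j < i" "i \<le> n" using Cons.prems(2)[of i j] by auto
  have pq: "i - 1 < n + j - 1" "n + j - 1 < 2 * n" "[i, n + j] = [Suc (i - 1), Suc (n + j - 1)]"
    using ij by auto
  have CD: "is_coalgebra D" unfolding D_def by (rule is_coalgebra_tpow[OF C])
  note DD = is_coalgebra_comul_linear[OF CD]
  have [simp]: "carrier D = carrier (tpow H (2 * n))" "lin_map D ground = lin_map (tpow H (2 * n)) ground"
    by (simp_all add: D_def)
  have R: "coquasitriangular H (R i j)" using Cons.prems(1) by simp
  have \<sigma>': "distinct (\<alpha> @ [i - 1, n + j - 1] @ \<beta>)" "set (\<alpha> @ [i - 1, n + j - 1] @ \<beta>) = {..<2 * n}"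
    using Cons.prems(3,4) by auto
  have \<tau>: "distinct \<tau>" "set \<tau> = {..<2 * n}" using transposes_set[OF Cons.hyps] \<sigma>' by auto
  have legs: "lin_map (tpow H (2 * n)) ground (leg H (2 * n) (R i' j') [i', n + j'])" if "(i', j') \<in> set ((i, j) # ms)" for i' j'
  proof -
    have "1 \<le> j'" "j' < i'" "i' \<le> n" using Cons.prems(2)[OF that] by auto
    then show ?thesis
      using lin_map_leg[OF C coquasitriangular_lin_map[OF Cons.prems(1)[OF that]], of "i' - 1" "n + j' - 1" "2 * n"] by simp
  qed
  have f: "lin_map D ground ?f" using legs by simp
  have fs: "lin_map D ground ?fs" by (rule lin_map_conv_prod[OF CD]) (use legs in auto)
  have M: "lin_map D ground (?M (\<alpha> @ [n + j - 1, i - 1] @ \<beta>))" "lin_map D ground (?M (\<alpha> @ [i - 1, n + j - 1] @ \<beta>))"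
    "lin_map D ground (?M \<tau>)"
    using lin_map_perm_mul[OF A \<phi> Cons.prems(3,4)] lin_map_perm_mul[OF A \<phi> \<sigma>'] lin_map_perm_mul[OF A \<phi> \<tau>] by auto
  have d: "d \<in> carrier D" using Cons.prems(5) by simp
  have swap: "conv D (?M (\<alpha> @ [n + j - 1, i - 1] @ \<beta>)) ?f d' = conv D ?f (?M (\<alpha> @ [i - 1, n + j - 1] @ \<beta>)) d'"
    if "d' \<in> carrier D" for d'
    unfolding pq(3) D_def
    by (rule conv_perm_mul_leg[OF B R \<phi> pq(1,2) Cons.prems(3,4)]) (use that in simp)
  have IH: "conv D (?M (\<alpha> @ [i - 1, n + j - 1] @ \<beta>)) ?fs d' = conv D ?fs (?M \<tau>) d'" if "d' \<in> carrier D" for d'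
    by (rule Cons.IH) (use Cons.prems(1,2) \<sigma>' that in auto)
  \<comment> \<open>Reassociating brings the functional next to the first leg; after that crossing
    the induction hypothesis handles the remaining legs.\<close>
  have "conv D (?M (\<alpha> @ [n + j - 1, i - 1] @ \<beta>)) (conv D ?f ?fs) d = conv D (conv D (?M (\<alpha> @ [n + j - 1, i - 1] @ \<beta>)) ?f) ?fs d"
    by (rule conv_assoc[OF CD M(1) f fs d, symmetric])
  also have "\<dots> = conv D (conv D ?f (?M (\<alpha> @ [i - 1, n + j - 1] @ \<beta>))) ?fs d"
    by (intro conv_cong[OF DD] lin_map_conv[OF DD] M f fs d swap refl)
  also have "\<dots> = conv D ?f (conv D (?M (\<alpha> @ [i - 1, n + j - 1] @ \<beta>)) ?fs) d"
    by (rule conv_assoc[OF CD f M(2) fs d])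
  also have "\<dots> = conv D ?f (conv D ?fs (?M \<tau>)) d"
    by (intro conv_cong[OF DD] lin_map_conv[OF DD] M f fs d IH refl)
  also have "\<dots> = conv D (conv D ?f ?fs) (?M \<tau>) d"
    by (rule conv_assoc[OF CD f fs M(3) d, symmetric])
  finally show ?case by (simp add: conv_prod_def)
qed

section \<open>The iterated multiplication\<close>

lemma bilin_tpow_eqI:
  assumes V: "is_vspace V" and W: "is_vspace W"
    and F: "bilin (tpow V m) (tpow V n) W F" and G: "bilin (tpow V m) (tpow V n) W G"
    and eq: "\<And>hs ks. hs \<in> tuples V m \<Longrightarrow> ks \<in> tuples V n \<Longrightarrow> F (pure V hs) (pure V ks) = G (pure V hs) (pure V ks)"
    and t: "t \<in> carrier (tpow V m)" and u: "u \<in> carrier (tpow V n)"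
  shows "F t u = G t u"
  by (rule lin_map_tpow_eqI[OF W V bilinD(1)[OF F u] bilinD(1)[OF G u] _ t],
      rule lin_map_tpow_eqI[OF W V bilinD(3)[OF F] bilinD(3)[OF G] _ u])
     (intro pure_in_tpow V eq; assumption)+

lemma bilin_comp: "bilin V V' W F \<Longrightarrow> lin_map W U g \<Longrightarrow> bilin V V' U (\<lambda>x y. g (F x y))"
  by (intro bilinI) (rule lin_map_comp[of _ W], erule (1) bilinD, assumption)+

lemma bilin_csum_csum:
  assumes D: "comul_linear D" and E: "comul_linear E" and W: "is_vspace W"
    and 1: "\<And>x y. x \<in> carrier D \<Longrightarrow> y \<in> carrier D \<Longrightarrow> bilin E E W (G x y)"
    and 2: "\<And>u v. u \<in> carrier E \<Longrightarrow> v \<in> carrier E \<Longrightarrow> bilin D D W (\<lambda>x y. G x y u v)"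
  shows "bilin D E W (\<lambda>a b. csum D W (\<lambda>x y. csum E W (G x y) b) a)"
proof (rule bilinI)
  show "lin_map D W (csum D W (\<lambda>x y. csum E W (G x y) b))" if "b \<in> carrier E" for b
    by (intro lin_map_csum_arg[OF D W] bilinI lin_map_csum_param[OF E W that])
       (use bilinD(1)[OF 2] bilinD(3)[OF 2] in auto)
  show "lin_map E W (\<lambda>b. csum D W (\<lambda>x y. csum E W (G x y) b) a)" if "a \<in> carrier D" for a
    by (intro lin_map_csum_param[OF D W that] lin_map_csum_arg[OF E W] 1)
qed

text \<open>The coproduct of a tensor power acts entry by entry, so under juxtaposition it acts on
  the two parts separately. Both sides are bilinear in \<open>t\<close> and \<open>u\<close>; on
  pure tensors the claim is \<open>csum_list_append\<close>.\<close>

lemma csum_tjoin: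
  assumes H: "comul_linear H" and W: "is_vspace W" and F: "bilin (tpow H (m + n)) (tpow H (m + n)) W F"
    and t: "t \<in> carrier (tpow H m)" and u: "u \<in> carrier (tpow H n)"
  shows "csum (tpow_bialg H (m + n)) W F (tjoin H m n t u) =
    csum (tpow_bialg H m) W (\<lambda>t1 t2. csum (tpow_bialg H n) W (\<lambda>u1 u2. F (tjoin H m n t1 u1) (tjoin H m n t2 u2)) u) t"
proof -
  note V = comul_linear_vspace[OF H]
  note D = comul_linear_tpow[OF H]
  note J = bilin_tjoin[OF V, of m n]
  have b1: "bilin (tpow H n) (tpow H n) W (\<lambda>u1 u2. F (tjoin H m n t1 u1) (tjoin H m n t2 u2))"
    if "t1 \<in> carrier (tpow H m)" "t2 \<in> carrier (tpow H m)" for t1 t2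
    by (intro bilinI lin_map_comp[OF bilinD(3)[OF J that(1)] bilinD(1)[OF F]]
       lin_map_comp[OF bilinD(3)[OF J that(2)] bilinD(3)[OF F]] bilinD(4)[OF J] that)
  have b2: "bilin (tpow H m) (tpow H m) W (\<lambda>t1 t2. F (tjoin H m n t1 u1) (tjoin H m n t2 u2))"
    if "u1 \<in> carrier (tpow H n)" "u2 \<in> carrier (tpow H n)" for u1 u2
    by (intro bilinI lin_map_comp[OF bilinD(1)[OF J that(1)] bilinD(1)[OF F]]
       lin_map_comp[OF bilinD(1)[OF J that(2)] bilinD(3)[OF F]] bilinD(4)[OF J] that)
  have L: "lin_map (tpow H (m + n)) W (csum (tpow_bialg H (m + n)) W F)"
    using lin_map_csum_arg[OF D W, of "m + n" F] F by simp
  show ?thesis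
  proof (rule bilin_tpow_eqI[OF V W bilin_comp[OF J L] _ _ t u])
    show "bilin (tpow H m) (tpow H n) W (\<lambda>t u. csum (tpow_bialg H m) W
        (\<lambda>t1 t2. csum (tpow_bialg H n) W (\<lambda>u1 u2. F (tjoin H m n t1 u1) (tjoin H m n t2 u2)) u) t)"
      using bilin_csum_csum[OF D D W, of m n "\<lambda>t1 t2 u1 u2. F (tjoin H m n t1 u1) (tjoin H m n t2 u2)"] b1 b2 by simp
    fix hs ks assume hs: "hs \<in> tuples H m" "ks \<in> tuples H n"
    have "csum (tpow_bialg H (m + n)) W F (tjoin H m n (pure H hs) (pure H ks)) =
      csum_list H W (\<lambda>xs ys. csum_list H W (\<lambda>us vs. F (pure H (xs @ us)) (pure H (ys @ vs))) ks) hs"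
      unfolding tjoin_pure[OF V hs] csum_tpow_pure[OF H W F tuples_append[OF hs]] csum_list_append ..
    also have "\<dots> = csum_list H W (\<lambda>xs ys. csum_list H W (\<lambda>us vs. F (tjoin H m n (pure H xs) (pure H us)) (tjoin H m n (pure H ys) (pure H vs))) ks) hs"
      by (intro csum_list_cong[OF H hs(1)] csum_list_cong[OF H hs(2)]) (simp add: tjoin_pure[OF V])
    also have "\<dots> = csum_list H W (\<lambda>xs ys. csum (tpow_bialg H n) W (\<lambda>u1 u2. F (tjoin H m n (pure H xs) u1) (tjoin H m n (pure H ys) u2)) (pure H ks)) hs"
      by (intro csum_list_cong[OF H hs(1)] csum_tpow_pure[OF H W b1 hs(2), symmetric] pure_in_tpow V)
    also have "\<dots> = csum (tpow_bialg H m) W (\<lambda>t1 t2. csum (tpow_bialg H n) W (\<lambda>u1 u2. F (tjoin H m n t1 u1) (tjoin H m n t2 u2)) (pure H ks)) (pure H hs)"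
      by (intro csum_tpow_pure[OF H W _ hs(1), symmetric] bilinI lin_map_csum_param[OF D W])
         (use b2[THEN bilinD(1)] b2[THEN bilinD(3)] pure_in_tpow[OF V hs(2)] in auto)
    finally show "csum (tpow_bialg H (m + n)) W F (tjoin H m n (pure H hs) (pure H ks)) =
      csum (tpow_bialg H m) W (\<lambda>t1 t2. csum (tpow_bialg H n) W (\<lambda>u1 u2. F (tjoin H m n t1 u1) (tjoin H m n t2 u2)) (pure H ks)) (pure H hs)" .
  qed
qed

lemma map2_mul_tuples:
  "is_algebra H \<Longrightarrow> hs \<in> tuples H n \<Longrightarrow> ks \<in> tuples H n \<Longrightarrow> map2 (mul H) hs ks \<in> tuples H n"
  by (induction n arbitrary: hs ks) (auto simp: tuples_Suc is_algebra_mul_carrier)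

lemma multilinear_map2_mul_left:
  assumes A: "is_algebra H" and F: "multilinear H W n F" and ks: "ks \<in> tuples H n"
  shows "multilinear H W n (\<lambda>hs. F (map2 (mul H) hs ks))"
  using F ks
proof (induction n arbitrary: F ks)
  case (Suc n)
  then obtain k ks' where ks: "ks = k # ks'" "k \<in> carrier H" "ks' \<in> tuples H n" by (auto simp: tuples_Suc)
  have "multilinear H W n (\<lambda>hs. F (mul H x k # map2 (mul H) hs ks'))" if "x \<in> carrier H" for x
    using Suc.IH[of "\<lambda>hs. F (mul H x k # hs)", OF _ ks(3)] Suc.prems(1) that ks(2)
    by (simp add: multilinear_Suc is_algebra_mul_carrier[OF A])
  then show ?case
    unfolding multilinear_Suc ks(1)
    using Suc.prems(1) ks map2_mul_tuples[OF A _ ks(3)]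
    by (auto simp: multilinear_Suc is_algebra_mul_carrier[OF A] intro: lin_map_comp[OF is_algebraD(3)[OF A ks(2)]])
qed simp

lemma multilinear_map2_mul_right:
  assumes A: "is_algebra H" and F: "multilinear H W n F" and hs: "hs \<in> tuples H n"
  shows "multilinear H W n (\<lambda>ks. F (map2 (mul H) hs ks))"
  using F hs
proof (induction n arbitrary: F hs)
  case (Suc n)
  then obtain k hs' where hs: "hs = k # hs'" "k \<in> carrier H" "hs' \<in> tuples H n" by (auto simp: tuples_Suc)
  have "multilinear H W n (\<lambda>ks. F (mul H k x # map2 (mul H) hs' ks))" if "x \<in> carrier H" for x
    using Suc.IH[of "\<lambda>ks. F (mul H k x # ks)", OF _ hs(3)] Suc.prems(1) that hs(2)
    by (simp add: multilinear_Suc is_algebra_mul_carrier[OF A])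
  then show ?case
    unfolding multilinear_Suc hs(1)
    using Suc.prems(1) hs map2_mul_tuples[OF A hs(3)]
    by (auto simp: multilinear_Suc is_algebra_mul_carrier[OF A] intro: lin_map_comp[OF is_algebraD(2)[OF A hs(2)]])
qed simp

lemma
  assumes A: "is_algebra H"
  shows bilin_tmul: "bilin (tpow H n) (tpow H n) (tpow H n) (tmul H n)"
    and tmul_pure: "hs \<in> tuples H n \<Longrightarrow> ks \<in> tuples H n \<Longrightarrow>
      tmul H n (pure H hs) (pure H ks) = pure H (map2 (mul H) hs ks)"
proof -
  note V = is_algebraD(1)[OF A]
  have B: "bimultilinear H (tpow H n) n n (\<lambda>hs ks. pure H (map2 (mul H) hs ks))"
    by (intro bimultilinearI multilinear_map2_mul_left multilinear_map2_mul_right A multilinear_pure V)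
  show "bilin (tpow H n) (tpow H n) (tpow H n) (tmul H n)"
    "hs \<in> tuples H n \<Longrightarrow> ks \<in> tuples H n \<Longrightarrow> tmul H n (pure H hs) (pure H ks) = pure H (map2 (mul H) hs ks)"
    using tlift_bimultilinear[OF V is_vspace_tpow B] unfolding tmul_def by auto
qed

lemma sweedler3_eq_csum:
  assumes D: "comul_linear D" and W: "is_vspace W" and F: "trilin D W F" and d: "d \<in> carrier D"
  shows "sweedler3 D W F d = csum D W (\<lambda>x y. csum D W (F x) y) d"
proof -
  note V = comul_linear_vspace[OF D]
  note t = trilinD[OF F]
  have eq: "sweedler D W (F x) y = csum D W (F x) y" if "x \<in> carrier D" "y \<in> carrier D" for x y
    by (rule sweedler_eq_csum[OF D W bilinI that(2)]) (use t that in auto)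
  have "bilin D D W (\<lambda>x y. sweedler D W (F x) y)"
    using bilin_cong[OF V V, of "\<lambda>x y. sweedler D W (F x) y" "\<lambda>x y. csum D W (F x) y" W] eq bilin_csum_left[OF D W F]
    by simp
  from sweedler_eq_csum[OF D W this d] show ?thesis
    unfolding sweedler3_def by (simp add: eq cong: csum_cong[OF D d])
qed

section \<open>Compatibility of products with coproduct and counit\<close>

text \<open>Multiplicativity of the coproduct, transported to \<open>csum\<close> by lifting
  \<open>G\<close> to the tensor square and expanding the two coproducts one after the
  other.\<close>

lemma csum_mul:
  assumes B: "is_bialgebra H" and W: "is_vspace W" and G: "bilin H H W G" and ab: "a \<in> carrier H" "b \<in> carrier H"
  shows "csum H W G (mul H a b) = csum H W (\<lambda>a1 a2. csum H W (\<lambda>b1 b2. G (mul H a1 b1) (mul H a2 b2)) b) a"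
proof -
  note A = is_bialgebraD(1)[OF B] and C = is_bialgebraD(2)[OF B]
  note H = is_coalgebra_comul_linear[OF C]
  note V = comul_linear_vspace[OF H]
  define T where "T = tlift H W 2 (\<lambda>xs. G (xs ! 0) (xs ! 1))"
  have T: "lin_map (tpow H 2) W T"
    and Tp: "\<And>x y. x \<in> carrier H \<Longrightarrow> y \<in> carrier H \<Longrightarrow> T (pure H [x, y]) = G x y"
    using bilin_tlift[OF V W G] unfolding T_def by auto
  note TB = bilin_comp[OF bilin_tmul[OF A, of 2] T]
  have c: "comul H x \<in> carrier (tpow H 2)" if "x \<in> carrier H" for x
    using H that by (auto simp: comul_linear_def lin_map_def)
  have p: "pure H [x, y] \<in> carrier (tpow H 2)" if "x \<in> carrier H" "y \<in> carrier H" for x y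
    by (rule pure_in_tpow[OF V]) (use that in \<open>simp add: tuples_2\<close>)
  have ab': "mul H a b \<in> carrier H" by (rule is_algebra_mul_carrier[OF A ab])
  have "csum H W G (mul H a b) = T (comul H (mul H a b))"
    unfolding lin_map_comul[OF H W T ab'] by (intro csum_cong[OF H ab'] Tp[symmetric])
  also have "\<dots> = T (tmul H 2 (comul H a) (comul H b))"
    using B ab by (simp add: is_bialgebra_def)
  also have "\<dots> = csum H W (\<lambda>a1 a2. T (tmul H 2 (pure H [a1, a2]) (comul H b))) a"
    by (rule lin_map_comul[OF H W bilinD(1)[OF TB c[OF ab(2)]] ab(1)])
  also have "\<dots> = csum H W (\<lambda>a1 a2. csum H W (\<lambda>b1 b2. T (tmul H 2 (pure H [a1, a2]) (pure H [b1, b2]))) b) a"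
    by (intro csum_cong[OF H ab(1)] lin_map_comul[OF H W bilinD(3)[OF TB p] ab(2)])
  also have "\<dots> = csum H W (\<lambda>a1 a2. csum H W (\<lambda>b1 b2. G (mul H a1 b1) (mul H a2 b2)) b) a"
    by (intro csum_cong[OF H] ab)
       (simp add: tmul_pure[OF A] tuples_2 Tp is_algebra_mul_carrier[OF A])
  finally show ?thesis .
qed

text \<open>Makes the iterated multiplication compatible with coproducts: induction with
  \<open>csum_mul\<close> for the head, starting from the fact that the unit is grouplike.\<close>

lemma csum_prodl:
  assumes B: "is_bialgebra H" and W: "is_vspace W" and G: "bilin H H W G" and hs: "hs \<in> tuples H n"
  shows "csum H W G (prodl H hs) = csum_list H W (\<lambda>xs ys. G (prodl H xs) (prodl H ys)) hs"
  using G hs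
proof (induction n arbitrary: G hs)
  note A = is_bialgebraD(1)[OF B] and C = is_bialgebraD(2)[OF B]
  note H = is_coalgebra_comul_linear[OF C]
  note V = comul_linear_vspace[OF H]
  case 0
  note T = bilin_tlift[OF V W 0(1)]
  have u: "unit H \<in> carrier H" by (rule is_algebraD(5)[OF A])
  have "csum H W G (unit H) = tlift H W 2 (\<lambda>xs. G (xs ! 0) (xs ! 1)) (comul H (unit H))"
    unfolding lin_map_comul[OF H W T(1) u] by (intro csum_cong[OF H u] T(2)[symmetric])
  also have "\<dots> = G (unit H) (unit H)"
    using B T(2)[OF u u] by (simp add: is_bialgebra_def)
  finally show ?case using 0 by simp
next
  note A = is_bialgebraD(1)[OF B] and C = is_bialgebraD(2)[OF B]
  note H = is_coalgebra_comul_linear[OF C]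
  case (Suc n)
  obtain h ks where hs: "hs = h # ks" "h \<in> carrier H" "ks \<in> tuples H n"
    using Suc.prems(2) by (auto simp: tuples_Suc)
  have "csum H W G (prodl H hs) = csum H W (\<lambda>a1 a2. csum H W (\<lambda>b1 b2. G (mul H a1 b1) (mul H a2 b2)) (prodl H ks)) h"
    unfolding hs(1) prodl_simps
    by (rule csum_mul[OF B W Suc.prems(1) hs(2)]) (rule prodl_carrier[OF A], use hs in \<open>simp add: tuples_def\<close>)
  also have "\<dots> = csum H W (\<lambda>a1 a2. csum_list H W (\<lambda>xs ys. G (mul H a1 (prodl H xs)) (mul H a2 (prodl H ys))) ks) h"
  proof (intro csum_cong[OF H hs(2)] Suc.IH[OF _ hs(3)] bilinI)
    fix x y z assume x: "x \<in> carrier H" "y \<in> carrier H" "z \<in> carrier H"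
    note m = is_algebra_mul_carrier[OF A] is_algebraD(2)[OF A]
    show "lin_map H W (\<lambda>b. G (mul H x b) (mul H y z))"
      by (rule lin_map_comp[OF m(2) bilinD(1)[OF Suc.prems(1)]]) (intro x m(1))+
    show "lin_map H W (\<lambda>b. G (mul H x z) (mul H y b))"
      by (rule lin_map_comp[OF m(2) bilinD(3)[OF Suc.prems(1)]]) (intro x m(1))+
  qed
  also have "\<dots> = csum_list H W (\<lambda>xs ys. G (prodl H xs) (prodl H ys)) hs" by (simp add: hs(1))
  finally show ?case .
qed

lemma counit_prodl:
  assumes B: "is_bialgebra H" and hs: "set hs \<subseteq> carrier H"
  shows "counit H (prodl H hs) = counits H hs"
  using hs B prodl_carrier[OF is_bialgebraD(1)[OF B]]
  by (induction hs) (auto simp: is_bialgebra_def)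

text \<open>Twisting changes only the field \<open>mul\<close>, which Sweedler sums do not
  read.\<close>

lemma sweedler_mul_update [simp]: "sweedler (D\<lparr>mul := m\<rparr>) W F = sweedler D W F"
  by (simp add: sweedler_def fun_eq_iff tlift_def pure_def multilinear_def tuples_def)

text \<open>Associativity flattens (h_1 h'_1)(h_2 h'_2) ... into a single word, to which letter
  exchanges apply.\<close>

lemma prodl_map2_mul:
  "is_algebra H \<Longrightarrow> hs \<in> tuples H n \<Longrightarrow> ks \<in> tuples H n \<Longrightarrow>
    prodl H (map2 (mul H) hs ks) = prodl H (concat (map2 (\<lambda>x y. [x, y]) hs ks))"
proof (induction n arbitrary: hs ks)
  case (Suc n)
  then obtain x xs y ys where hs: "hs = x # xs" "x \<in> carrier H" "xs \<in> tuples H n"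
    and ks: "ks = y # ys" "y \<in> carrier H" "ys \<in> tuples H n" by (auto simp: tuples_Suc)
  have "prodl H (map2 (mul H) xs ys) \<in> carrier H"
    by (rule prodl_carrier[OF Suc.prems(1)]) (use map2_mul_tuples[OF Suc.prems(1) hs(3) ks(3)] in \<open>simp add: tuples_def\<close>)
  then show ?case
    using Suc.IH[OF Suc.prems(1) hs(3) ks(3)] hs ks by (simp add: is_algebraD(4)[OF Suc.prems(1)])
qed simp

lemma map_nth_interleaved:
  assumes "length hs = n" "length ks = n"
  shows "map ((!) (hs @ ks)) (interleaved n 0) = concat (map2 (\<lambda>x y. [x, y]) hs ks)"
proof -
  have "map (\<lambda>i. [(hs @ ks) ! i, (hs @ ks) ! (n + i)]) [0..<n] = map2 (\<lambda>x y. [x, y]) hs ks"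
    by (rule nth_equalityI) (use assms in \<open>auto simp: nth_append\<close>)
  then show ?thesis by (simp add: map_concat comp_def)
qed

text \<open>Identifies the first and last word of the chain of exchanges with the products of the
  overview. That \<open>interleaved n 0\<close> is a permutation is assumed here and supplied later
  by \<open>transposes_set\<close>.\<close>

lemma
  assumes A: "is_algebra H" and \<phi>: "lin_map H ground \<phi>"
    and t: "t \<in> carrier (tpow H n)" and u: "u \<in> carrier (tpow H n)"
  shows perm_mul_interleaved: "distinct (interleaved n 0) \<Longrightarrow> set (interleaved n 0) = {..<2 * n} \<Longrightarrow>
      perm_mul H (2 * n) \<phi> (interleaved n 0) (tjoin H n n t u) = \<phi> (iterated_mul H n (tmul H n t u))"
    and perm_mul_upt: "perm_mul H (2 * n) \<phi> [0..<2 * n] (tjoin H n n t u) =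
      \<phi> (mul H (iterated_mul H n t) (iterated_mul H n u))"
proof -
  note V = is_algebraD(1)[OF A]
  note J = bilin_tjoin[OF V, of n n, folded mult_2]
  note m = lin_map_iterated_mul[OF A, of n]
  have sub: "set hs \<subseteq> carrier H" if "hs \<in> tuples H n" for hs using that by (simp add: tuples_def)
  have T: "hs @ ks \<in> tuples H (2 * n)" if "hs \<in> tuples H n" "ks \<in> tuples H n" for hs ks
    using tuples_append[OF that] by (simp add: mult_2)
  show "perm_mul H (2 * n) \<phi> (interleaved n 0) (tjoin H n n t u) = \<phi> (iterated_mul H n (tmul H n t u))"
    if \<sigma>: "distinct (interleaved n 0)" "set (interleaved n 0) = {..<2 * n}"
  proof (rule bilin_tpow_eqI[OF V is_vspace_ground _ _ _ t u])
    show "bilin (tpow H n) (tpow H n) ground (\<lambda>t u. perm_mul H (2 * n) \<phi> (interleaved n 0) (tjoin H n n t u))"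
      by (rule bilin_comp[OF J lin_map_perm_mul[OF A \<phi> \<sigma>]])
    show "bilin (tpow H n) (tpow H n) ground (\<lambda>t u. \<phi> (iterated_mul H n (tmul H n t u)))"
      by (rule bilin_comp[OF bilin_tmul[OF A] lin_map_comp[OF m \<phi>]])
    fix hs ks assume h: "hs \<in> tuples H n" "ks \<in> tuples H n"
    show "perm_mul H (2 * n) \<phi> (interleaved n 0) (tjoin H n n (pure H hs) (pure H ks)) =
       \<phi> (iterated_mul H n (tmul H n (pure H hs) (pure H ks)))"
      unfolding tjoin_pure[OF V h] tmul_pure[OF A h] perm_mul_pure[OF A \<phi> \<sigma> T[OF h]]
        map_nth_interleaved[OF tuples_length[OF h(1)] tuples_length[OF h(2)]]
        iterated_mul_pure[OF A map2_mul_tuples[OF A h]] prodl_map2_mul[OF A h] ..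
  qed
  have \<tau>: "distinct [0..<2 * n]" "set [0..<2 * n] = {..<2 * n}" by auto
  show "perm_mul H (2 * n) \<phi> [0..<2 * n] (tjoin H n n t u) = \<phi> (mul H (iterated_mul H n t) (iterated_mul H n u))"
  proof (rule bilin_tpow_eqI[OF V is_vspace_ground _ _ _ t u])
    show "bilin (tpow H n) (tpow H n) ground (\<lambda>t u. perm_mul H (2 * n) \<phi> [0..<2 * n] (tjoin H n n t u))"
      by (rule bilin_comp[OF J lin_map_perm_mul[OF A \<phi> \<tau>]])
    show "bilin (tpow H n) (tpow H n) ground (\<lambda>t u. \<phi> (mul H (iterated_mul H n t) (iterated_mul H n u)))"
      by (intro bilin_comp[OF _ \<phi>] bilinI lin_map_comp[OF m is_algebraD(2)[OF A]] lin_map_comp[OF m is_algebraD(3)[OF A]]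
          lin_mapD(1)[OF m])
    fix hs ks assume h: "hs \<in> tuples H n" "ks \<in> tuples H n"
    have "map ((!) (hs @ ks)) [0..<2 * n] = hs @ ks"
      using map_nth[of "hs @ ks"] tuples_length[OF T[OF h]] by simp
    then show "perm_mul H (2 * n) \<phi> [0..<2 * n] (tjoin H n n (pure H hs) (pure H ks)) =
       \<phi> (mul H (iterated_mul H n (pure H hs)) (iterated_mul H n (pure H ks)))"
      unfolding tjoin_pure[OF V h] perm_mul_pure[OF A \<phi> \<tau> T[OF h]] iterated_mul_pure[OF A h(1)] iterated_mul_pure[OF A h(2)]
      by (simp add: prodl_append[OF A sub[OF h(1)] sub[OF h(2)]])
  qed
qed

section \<open>The twisted product as a convolution\<close>

lemma trilin_cong:
  assumes V: "is_vspace V"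
    and eq: "\<And>x y z. x \<in> carrier V \<Longrightarrow> y \<in> carrier V \<Longrightarrow> z \<in> carrier V \<Longrightarrow> F x y z = G x y z"
    and G: "trilin V W G"
  shows "trilin V W F"
proof (rule trilinI)
  note t = trilinD[OF G]
  show "lin_map V W (\<lambda>x. F x y z)" if "y \<in> carrier V" "z \<in> carrier V" for y z
    using t(1)[OF that] lin_map_cong[OF V, of "\<lambda>x. F x y z" "\<lambda>x. G x y z" W] eq that by simp
  show "lin_map V W (\<lambda>y. F x y z)" if "x \<in> carrier V" "z \<in> carrier V" for x z
    using t(2)[OF that] lin_map_cong[OF V, of "\<lambda>y. F x y z" "\<lambda>y. G x y z" W] eq that by simp
  show "lin_map V W (\<lambda>z. F x y z)" if "x \<in> carrier V" "y \<in> carrier V" for x y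
    using t(3)[OF that] lin_map_cong[OF V, of "\<lambda>z. F x y z" "\<lambda>z. G x y z" W] eq that by simp
qed

text \<open>\<open>twisted_mul\<close> is built from two nested \<open>sweedler3\<close>, so
  trilinearity must be checked in the u-components and then, for the inner sum as a whole, in the
  t-components. The integrand is bracketed to fit the convolution of \<open>J'\<close> with that of
  the product functional and \<open>J\<close>.\<close>

lemma lin_map_twisted_mul:
  assumes B: "is_bialgebra H"
    and J: "lin_map (tpow H (2 * n)) ground J"
    and J': "lin_map (tpow H (2 * n)) ground (conv_inv (tpow_bialg H (2 * n)) J)"
    and \<psi>: "lin_map (tpow H n) ground \<psi>"
    and t: "t \<in> carrier (tpow H n)" and u: "u \<in> carrier (tpow H n)"
  defines "J' \<equiv> conv_inv (tpow_bialg H (2 * n)) J" and "D \<equiv> tpow_bialg H n"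
  shows "\<psi> (twisted_mul H n J t u) =
    csum D ground (\<lambda>t1 x. csum D ground (\<lambda>t2 t3. csum D ground (\<lambda>u1 y. csum D ground (\<lambda>u2 u3.
      J' (tjoin H n n t1 u1) * (\<psi> (tmul H n t2 u2) * J (tjoin H n n t3 u3))) y) u) x) t"
proof -
  note A = is_bialgebraD(1)[OF B] and C = is_bialgebraD(2)[OF B]
  have D: "comul_linear D"
    unfolding D_def by (rule comul_linear_tpow[OF is_coalgebra_comul_linear[OF C]])
  note VD = comul_linear_vspace[OF D]
  have [simp]: "carrier D = carrier (tpow H n)" by (simp add: D_def)
  have j: "bilin D D ground (\<lambda>t u. J (tjoin H n n t u))" "bilin D D ground (\<lambda>t u. J' (tjoin H n n t u))"
    unfolding D_def tpow_bialg_vspace J'_def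
    by (rule bilin_comp[OF bilin_tjoin[OF is_algebraD(1)[OF A], of n n, folded mult_2]], fact J J')+
  have m: "bilin D D D (tmul H n)" using bilin_tmul[OF A, of n] by (simp add: D_def)
  have \<psi>D: "lin_map D ground \<psi>" using \<psi> by (simp add: D_def)
  define G where "G t1 t2 t3 u1 u2 u3 = smult D (J' (tjoin H n n t1 u1) * J (tjoin H n n t3 u3)) (tmul H n t2 u2)"
    for t1 t2 t3 u1 u2 u3
  \<comment> \<open>The inner \<open>sweedler3\<close> in \<open>csum\<close> form: a finite sum for
    fixed \<open>u\<close>, so its trilinearity in the t-components is termwise.\<close>
  define K where "K t1 t2 t3 = csum D D (\<lambda>x y. csum D D (G t1 t2 t3 x) y) u" for t1 t2 t3
  note lin = lin_map_smult_left[OF VD lin_map_mult_left] lin_map_smult_left[OF VD lin_map_mult_right] lin_map_smult[OF VD]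
  have Gu: "trilin D D (G t1 t2 t3)" if "t1 \<in> carrier D" "t2 \<in> carrier D" "t3 \<in> carrier D" for t1 t2 t3
    unfolding G_def by (intro trilinI lin bilinD(3)[OF j(1)] bilinD(3)[OF j(2)] bilinD(3,4)[OF m] that)
  have Gt: "trilin D D (\<lambda>t1 t2 t3. G t1 t2 t3 u1 u2 u3)" if "u1 \<in> carrier D" "u2 \<in> carrier D" "u3 \<in> carrier D" for u1 u2 u3
    unfolding G_def by (intro trilinI lin bilinD(1)[OF j(1)] bilinD(1)[OF j(2)] bilinD(1,4)[OF m] that)
  have \<psi>G: "\<psi> (G t1 t2 t3 u1 u2 u3) = J' (tjoin H n n t1 u1) * (\<psi> (tmul H n t2 u2) * J (tjoin H n n t3 u3))"
    if "t2 \<in> carrier D" "u2 \<in> carrier D" for t1 t2 t3 u1 u2 u3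
    unfolding G_def lin_mapD(3)[OF \<psi>D bilinD(4)[OF m that]] by (simp add: mult_ac)
  have u': "u \<in> carrier D" and t': "t \<in> carrier D" using u t by auto
  have K: "trilin D D K"
    unfolding K_def
    by (intro trilinI; rule lin_map_csum_param[OF D VD u'], rule lin_map_csum_param[OF D VD], assumption;
        rule trilinD[OF Gt]; assumption)
  have K_eq: "sweedler3 D D (G t1 t2 t3) u = K t1 t2 t3" if "t1 \<in> carrier D" "t2 \<in> carrier D" "t3 \<in> carrier D" for t1 t2 t3
    unfolding K_def by (rule sweedler3_eq_csum[OF D VD Gu[OF that] u'])
  have "twisted_mul H n J t u = sweedler3 D D (\<lambda>t1 t2 t3. sweedler3 D D (G t1 t2 t3) u) t"
    by (simp add: twisted_mul_def Let_def D_def J'_def G_def[abs_def] tpow_bialg_def)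
  also have "\<dots> = csum D D (\<lambda>t1 x. csum D D (\<lambda>t2 t3. sweedler3 D D (G t1 t2 t3) u) x) t"
    by (rule sweedler3_eq_csum[OF D VD trilin_cong[OF VD K_eq K] t'])
  also have "\<dots> = csum D D (\<lambda>t1 x. csum D D (\<lambda>t2 t3. K t1 t2 t3) x) t"
    by (intro csum_cong[OF D] t' K_eq)
  finally have "\<psi> (twisted_mul H n J t u) = \<psi> (csum D D (\<lambda>t1 x. csum D D (\<lambda>t2 t3. K t1 t2 t3) x) t)"
    by simp
  also have "\<dots> = csum D ground (\<lambda>t1 x. \<psi> (csum D D (\<lambda>t2 t3. K t1 t2 t3) x)) t"
    by (intro lin_map_csum[OF D VD is_vspace_ground \<psi>D t'] csum_carrier[OF D VD] trilinD(4)[OF K])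
  also have "\<dots> = csum D ground (\<lambda>t1 x. csum D ground (\<lambda>t2 t3. \<psi> (K t1 t2 t3)) x) t"
    by (intro csum_cong[OF D t'] lin_map_csum[OF D VD is_vspace_ground \<psi>D] trilinD(4)[OF K])
  also have "\<dots> = csum D ground (\<lambda>t1 x. csum D ground (\<lambda>t2 t3. csum D ground (\<lambda>u1 y. \<psi> (csum D D (G t1 t2 t3 u1) y)) u) x) t"
    unfolding K_def
    by (intro csum_cong[OF D t'] csum_cong[OF D] lin_map_csum[OF D VD is_vspace_ground \<psi>D u'] csum_carrier[OF D VD] trilinD(4)[OF Gu])
  also have "\<dots> = csum D ground (\<lambda>t1 x. csum D ground (\<lambda>t2 t3. csum D ground (\<lambda>u1 y. csum D ground (\<lambda>u2 u3.
      \<psi> (G t1 t2 t3 u1 u2 u3)) y) u) x) t"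
    by (intro csum_cong[OF D t'] csum_cong[OF D] csum_cong[OF D u'] lin_map_csum[OF D VD is_vspace_ground \<psi>D] trilinD(4)[OF Gu])
  also have "\<dots> = csum D ground (\<lambda>t1 x. csum D ground (\<lambda>t2 t3. csum D ground (\<lambda>u1 y. csum D ground (\<lambda>u2 u3.
      J' (tjoin H n n t1 u1) * (\<psi> (tmul H n t2 u2) * J (tjoin H n n t3 u3))) y) u) x) t"
    by (intro csum_cong[OF D] t' u' \<psi>G)
  finally show ?thesis .
qed

text \<open>\<open>N\<close> is a variable tied to m + n by an equation, because the convolution
  lives on \<open>2 * n\<close> while juxtaposition produces \<open>n + n\<close>.\<close>

lemma conv_tjoin:
  assumes H: "comul_linear H" and n: "m + n = N"
    and f: "lin_map (tpow H N) ground f" and g: "lin_map (tpow H N) ground g"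
    and t: "t \<in> carrier (tpow H m)" and u: "u \<in> carrier (tpow H n)"
  shows "conv (tpow_bialg H N) f g (tjoin H m n t u) =
    csum (tpow_bialg H m) ground (\<lambda>t1 t2. csum (tpow_bialg H n) ground
      (\<lambda>u1 u2. f (tjoin H m n t1 u1) * g (tjoin H m n t2 u2)) u) t"
proof -
  have "tjoin H m n t u \<in> carrier (tpow H N)"
    using bilinD(4)[OF bilin_tjoin[OF comul_linear_vspace[OF H]] t u] n by simp
  then show ?thesis
    using csum_tjoin[OF H is_vspace_ground bilin_mult t u, of f g] f g n
    by (simp add: conv_eq_csum[OF comul_linear_tpow[OF H]])
qed

theorem theorem5p14:
  fixes H :: "('k::field_char_0, 'a::ab_group_add) bialg"
    and C :: "'c set"
    and R :: "'c \<Rightarrow> ('k, 'a) tensor \<Rightarrow> 'k"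
    and n :: nat
    and c :: "nat \<times> nat \<Rightarrow> 'c"
  assumes "is_bialgebra H"
    and "\<And>x. x \<in> C \<Longrightarrow> coquasitriangular H (R x)"
    and "n \<ge> 1"
    and "\<And>i j. 1 \<le> i \<Longrightarrow> i < j \<Longrightarrow> j \<le> n \<Longrightarrow> c (i, j) \<in> C"
    and "transitive_colouring n c"
  shows "bialgebra_hom (twisted_bialg H R n c) H (iterated_mul H n)"
proof -
  note B = assms(1)
  note A = is_bialgebraD(1)[OF B] and C = is_bialgebraD(2)[OF B]
  note H = is_coalgebra_comul_linear[OF C]
  note V = comul_linear_vspace[OF H]
  note m = lin_map_iterated_mul[OF A, of n]
  define D where "D = tpow_bialg H n"
  define D2 where "D2 = tpow_bialg H (2 * n)"
  define J where "J = twist H R n c"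
  define J' where "J' = conv_inv D2 J"
  \<comment> \<open>The index pairs are kept apart from their legs, since \<open>transposes\<close>
    concerns positions only.\<close>
  define ms where "ms = concat (map (\<lambda>i. map (Pair i) (rev [1..<i])) [2..<Suc n])"
  define fs where "fs = map (\<lambda>(i, j). leg H (2 * n) (R (c (j, i))) [i, n + j]) ms"
  have J_eq: "J = conv_prod D2 fs"
    by (simp add: J_def twist_def fs_def ms_def D2_def map_concat comp_def)
  have CD: "is_coalgebra D" and CD2: "is_coalgebra D2"
    unfolding D_def D2_def by (rule is_coalgebra_tpow[OF C])+
  note DD = is_coalgebra_comul_linear[OF CD] and DD2 = is_coalgebra_comul_linear[OF CD2]
  have lin2: "lin_map D2 ground = lin_map (tpow H (2 * n)) ground" by (simp add: D2_def)
  have ms: "1 \<le> j \<and> j < i \<and> i \<le> n" if "(i, j) \<in> set ms" for i j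
    using that by (auto simp: ms_def)
  \<comment> \<open>Pairs in \<open>ms\<close> have j < i, whereas \<open>c\<close> colours pairs
    with the smaller index first.\<close>
  have R: "coquasitriangular H (R (c (j, i)))" if "(i, j) \<in> set ms" for i j
    using ms[OF that] assms(2,4) by auto
  \<comment> \<open>Invertibility of each factor is what turns the choice \<open>conv_inv\<close>
    into a true inverse of \<open>J\<close>.\<close>
  have fs: "lin_map D2 ground f \<and> (\<exists>g. is_conv_inverse D2 f g)" if f: "f \<in> set fs" for f
  proof -
    from f obtain i j where ij: "(i, j) \<in> set ms" and f_eq: "f = leg H (2 * n) (R (c (j, i))) [i, n + j]"
      by (auto simp: fs_def)
    have pq: "i - 1 < n + j - 1" "n + j - 1 < 2 * n" "[i, n + j] = [Suc (i - 1), Suc (n + j - 1)]"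
      using ms[OF ij] by auto
    note l = coquasitriangular_lin_map[OF R[OF ij]]
    obtain R' where R': "is_conv_inverse (tpow_bialg H 2) (R (c (j, i))) R'"
      using R[OF ij] by (auto simp: coquasitriangular_def)
    show ?thesis
      unfolding f_eq pq(3) D2_def
      using lin_map_leg[OF C l pq(1,2)] is_conv_inverse_leg[OF C l R' pq(1,2)] by auto
  qed
  have J: "lin_map D2 ground J"
    unfolding J_eq by (rule lin_map_conv_prod[OF CD2]) (use fs in auto)
  have inv: "is_conv_inverse D2 J J'"
    unfolding J'_def J_eq by (intro is_conv_inverse_conv_inv conv_prod_invertible CD2 fs)
  then have J': "lin_map D2 ground J'" by (simp add: is_conv_inverse_def)
  let ?\<sigma> = "interleaved n 0"
  \<comment> \<open>All rows have been processed: with m = n the tail \<open>interleaved n n\<close>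
    is empty, and the two sorted blocks join to the increasing word.\<close>
  have tr: "transposes n ?\<sigma> ms [0..<2 * n]"
  proof -
    have "[0..<n] @ [n..<n + n] = [0..<2 * n]"
      using upt_add_eq_append[of 0 n n] by (simp add: mult_2)
    then show ?thesis using transposes_rows[of n n] assms(3) unfolding ms_def by simp
  qed
  have \<sigma>: "distinct ?\<sigma>" "set ?\<sigma> = {..<2 * n}" using transposes_set[OF tr] by auto
  have \<tau>: "distinct [0..<2 * n]" "set [0..<2 * n] = {..<2 * n}" by auto
  have mul: "iterated_mul H n (twisted_mul H n J t u) = mul H (iterated_mul H n t) (iterated_mul H n u)"
    if t: "t \<in> carrier (tpow H n)" and u: "u \<in> carrier (tpow H n)" for t u
  proof (rule lin_map_separates[OF V])
    fix \<phi> assume \<phi>: "lin_map H ground \<phi>"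
    let ?M = "perm_mul H (2 * n) \<phi> ?\<sigma>" and ?M' = "perm_mul H (2 * n) \<phi> [0..<2 * n]"
    have M: "lin_map D2 ground ?M" "lin_map D2 ground ?M'"
      unfolding lin2 by (rule lin_map_perm_mul[OF A \<phi> \<sigma>], rule lin_map_perm_mul[OF A \<phi> \<tau>])
    have swap: "conv D2 ?M J d = conv D2 J ?M' d" if "d \<in> carrier D2" for d
      using conv_perm_mul_transposes[where R = "\<lambda>i j. R (c (j, i))" and d = d, OF B \<phi> tr R ms \<sigma>] that
      unfolding J_eq fs_def D2_def by simp
    have t'u': "t \<in> carrier D" "u \<in> carrier D" using t u by (simp_all add: D_def)
    have d: "tjoin H n n t u \<in> carrier D2"
      using bilinD(4)[OF bilin_tjoin[OF V] t u] by (simp add: D2_def mult_2)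
    have "\<phi> (iterated_mul H n (twisted_mul H n J t u)) =
      csum D ground (\<lambda>t1 x. csum D ground (\<lambda>t2 t3. csum D ground (\<lambda>u1 y. csum D ground (\<lambda>u2 u3.
        J' (tjoin H n n t1 u1) * (\<phi> (iterated_mul H n (tmul H n t2 u2)) * J (tjoin H n n t3 u3))) y) u) x) t"
      unfolding D_def J'_def D2_def
      by (rule lin_map_twisted_mul[OF B _ _ lin_map_comp[OF m \<phi>] t u]) (use J J' in \<open>simp_all add: J'_def D2_def\<close>)
    also have "\<dots> = csum D ground (\<lambda>t1 x. csum D ground (\<lambda>t2 t3. csum D ground (\<lambda>u1 y. csum D ground (\<lambda>u2 u3.
        J' (tjoin H n n t1 u1) * (?M (tjoin H n n t2 u2) * J (tjoin H n n t3 u3))) y) u) x) t"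
      by (intro csum_cong[OF DD] t'u' arg_cong2[of _ _ _ _ "(*)"] refl perm_mul_interleaved[OF A \<phi> _ _ \<sigma>, symmetric])
         (simp_all add: D_def)
    \<comment> \<open>\<open>J'\<close> depends on the first components only. The first sum over
      \<open>u\<close> moves outside the second one over \<open>t\<close>, \<open>J'\<close> leaves
      the inner sums, and these form a convolution at the remaining components \<open>x\<close> and
      \<open>y\<close>.\<close>
    also have "\<dots> = csum D ground (\<lambda>t1 x. csum D ground (\<lambda>u1 y. J' (tjoin H n n t1 u1) *
        csum D ground (\<lambda>t2 t3. csum D ground (\<lambda>u2 u3. ?M (tjoin H n n t2 u2) * J (tjoin H n n t3 u3)) y) x) u) t"
      unfolding csum_mult_left[symmetric]
      by (rule csum_cong[OF DD t'u'(1)]) (rule csum_swap[OF is_vspace_ground])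
    also have "\<dots> = csum D ground (\<lambda>t1 x. csum D ground (\<lambda>u1 y. J' (tjoin H n n t1 u1) * conv D2 ?M J (tjoin H n n x y)) u) t"
      using M J unfolding D_def D2_def
      by (intro csum_cong[OF DD[unfolded D_def]] t'u'[unfolded D_def])
         (subst conv_tjoin[OF H mult_2[symmetric]], simp_all)
    also have "\<dots> = conv D2 J' (conv D2 ?M J) (tjoin H n n t u)"
      using J' lin_map_conv[OF DD2 M(1) J] t u unfolding D_def D2_def
      by (subst conv_tjoin[OF H mult_2[symmetric], where f = J']) simp_all
    \<comment> \<open>The exchange puts \<open>J\<close> directly to the right of \<open>J'\<close>,
      where the two cancel.\<close>
    also have "\<dots> = conv D2 J' (conv D2 J ?M') (tjoin H n n t u)"
      by (intro conv_cong[OF DD2] J' lin_map_conv[OF DD2] M J d swap refl)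
    also have "\<dots> = conv D2 (conv D2 J' J) ?M' (tjoin H n n t u)"
      by (rule conv_assoc[OF CD2 J' J M(2) d, symmetric])
    also have "\<dots> = conv D2 (counit D2) ?M' (tjoin H n n t u)"
      using inv by (intro conv_cong[OF DD2] J' lin_map_conv[OF DD2] M J d) (simp_all add: is_conv_inverse_def)
    also have "\<dots> = ?M' (tjoin H n n t u)"
      by (rule conv_counit(1)[OF CD2 M(2) d])
    also have "\<dots> = \<phi> (mul H (iterated_mul H n t) (iterated_mul H n u))"
      by (rule perm_mul_upt[OF A \<phi> t u])
    finally show "\<phi> (iterated_mul H n (twisted_mul H n J t u)) = \<phi> (mul H (iterated_mul H n t) (iterated_mul H n u))" .
  qed
  have unit: "iterated_mul H n (pure H (replicate n (unit H))) = unit H"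
  proof -
    have "prodl H (replicate k (unit H)) = unit H" for k
      by (induction k) (simp_all add: is_algebraD[OF A])
    moreover have "replicate n (unit H) \<in> tuples H n"
      by (auto simp: tuples_def is_algebraD(5)[OF A])
    ultimately show ?thesis by (simp add: iterated_mul_pure[OF A])
  qed
  have counit: "counit H (iterated_mul H n x) = counit D x" if "x \<in> carrier (tpow H n)" for x
  proof (rule lin_map_tpow_eqI[OF is_vspace_ground V _ _ _ that])
    show "lin_map (tpow H n) ground (\<lambda>x. counit H (iterated_mul H n x))"
      by (rule lin_map_comp[OF m lin_map_counit[OF C]])
    show "lin_map (tpow H n) ground (counit D)"
      unfolding D_def by (rule lin_map_counit_tpow[OF C])
    show "counit H (iterated_mul H n (pure H hs)) = counit D (pure H hs)" if hs: "hs \<in> tuples H n" for hs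
      unfolding D_def iterated_mul_pure[OF A hs] counit_tpow_pure[OF C hs]
      by (rule counit_prodl[OF B]) (use hs in \<open>simp add: tuples_def\<close>)
  qed
  have comul: "comul H (iterated_mul H n x) = sweedler D (tpow H 2) (\<lambda>y z. pure H [iterated_mul H n y, iterated_mul H n z]) x"
    if x: "x \<in> carrier (tpow H n)" for x
  proof -
    have b: "bilin (tpow H n) (tpow H n) (tpow H 2) (\<lambda>y z. pure H [iterated_mul H n y, iterated_mul H n z])"
      by (intro bilinI lin_map_comp[OF m bilinD(1)[OF bilin_pure[OF V]]] lin_map_comp[OF m bilinD(3)[OF bilin_pure[OF V]]]
          lin_mapD(1)[OF m])
    have b': "bilin D D (tpow H 2) (\<lambda>y z. pure H [iterated_mul H n y, iterated_mul H n z])"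
      using b by (simp add: D_def)
    have "comul H (iterated_mul H n x) = csum D (tpow H 2) (\<lambda>y z. pure H [iterated_mul H n y, iterated_mul H n z]) x"
    proof (rule lin_map_tpow_eqI[OF is_vspace_tpow[of H 2] V _ _ _ x])
      show "lin_map (tpow H n) (tpow H 2) (\<lambda>x. comul H (iterated_mul H n x))"
        by (rule lin_map_comp[OF m]) (use H in \<open>simp add: comul_linear_def\<close>)
      show "lin_map (tpow H n) (tpow H 2) (csum D (tpow H 2) (\<lambda>y z. pure H [iterated_mul H n y, iterated_mul H n z]))"
        using lin_map_csum_arg[OF DD is_vspace_tpow b'] by (simp add: D_def)
      fix hs assume hs: "hs \<in> tuples H n"
      have p: "prodl H hs \<in> carrier H"
        by (rule prodl_carrier[OF A]) (use hs in \<open>simp add: tuples_def\<close>)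
      \<comment> \<open>With the identity as linear map, \<open>lin_map_comul\<close> writes the
        coproduct itself as a sum of pure tensors, and \<open>csum_prodl\<close> then applies with
        the pure tensor map as integrand.\<close>
      have "comul H (prodl H hs) = csum_list H (tpow H 2) (\<lambda>xs ys. pure H [prodl H xs, prodl H ys]) hs"
        using lin_map_comul[OF H is_vspace_tpow lin_map_id p] csum_prodl[OF B is_vspace_tpow bilin_pure[OF V] hs] by simp
      also have "\<dots> = csum D (tpow H 2) (\<lambda>y z. pure H [iterated_mul H n y, iterated_mul H n z]) (pure H hs)"
        unfolding D_def csum_tpow_pure[OF H is_vspace_tpow b hs]
        by (rule csum_list_cong[OF H hs]) (simp add: iterated_mul_pure[OF A])
      finally show "comul H (iterated_mul H n (pure H hs)) =
          csum D (tpow H 2) (\<lambda>y z. pure H [iterated_mul H n y, iterated_mul H n z]) (pure H hs)"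
        by (simp add: iterated_mul_pure[OF A hs])
    qed
    then show ?thesis
      using sweedler_eq_csum[OF DD is_vspace_tpow b'] x by (simp add: D_def)
  qed
  have T: "carrier (twisted_bialg H R n c) = carrier (tpow H n)" "counit (twisted_bialg H R n c) = counit D"
    "mul (twisted_bialg H R n c) = twisted_mul H n J" "unit (twisted_bialg H R n c) = pure H (replicate n (unit H))"
    "lin_map (twisted_bialg H R n c) H (iterated_mul H n)"
    using m by (simp_all add: twisted_bialg_def D_def J_def tpow_bialg_def lin_map_def)
  have S: "sweedler (twisted_bialg H R n c) (tpow H 2) = sweedler D (tpow H 2)"
    by (simp add: twisted_bialg_def D_def fun_eq_iff)
  show ?thesis
    unfolding bialgebra_hom_def T(1-4) S using unit mul counit comul T(5) by auto
qed

end
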